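(* Fix a prime $p>2$ and a nontrivial additive character $\psi:\mathbb{F}_p\to\mathbb{C}^\times$. Let $\Phi\in\mathcal{S}(\mathbb{R})$ be a fixed Schwartz function whose Fourier transform is supported in $|\tau|<1$. Then $$\lim_{d\to\infty}\big\langle W_1(f,\psi,\Phi)\big\rangle_{f\in\mathcal{AS}_{d,g}^{\mathrm{ord}}}=\int_{-\infty}^\infty\Phi(t)\,\mathrm{d}t,$$ uniformly over all powers $q$ of $p$ and all monic squarefree $g\in\mathbb{F}_q[x]$ with $\deg g\in\{d,d-1\}$ (i.e. for every $\varepsilon>0$ there is $d_0$ such that for all such $q,g$ and all $d\ge d_0$ the two sides differ by less than $\varepsilon$).
   Context: $q$ denotes a power of $p$, $\mathrm{tr}_{q^r/p}:\mathbb{F}_{q^r}\to\mathbb{F}_p$ the trace map. For $f\in\mathbb{F}_q(x)\setminus\mathbb{F}_q$ not of the form $h^p-h$, $h\in\mathbb{F}_q(x)$, $$L(u,f,\psi)=\exp\Big(\sum_{r\ge1}\frac{u^r}{r}\sum_{\alpha\in\mathbb{F}_{q^r}\cup\{\infty\},\ f(\alpha)\neq\infty}\psi(\mathrm{tr}_{q^r/p}f(\alpha))\Big),$$ known to be a polynomial in $u$ of degree $N=2\mathfrak{g}(C_f)/(p-1)$ ($C_f$ the smooth projective model of $y^p-y=f(x)$) with roots of absolute value $q^{-1/2}$; write $L(u,f,\psi)=\prod_{i=1}^N(1-q^{1/2}\rho_iu)$, $|\rho_i|=1$, $\theta_i=\arg(\rho_i)/2\pi\in\mathbb{R}/\mathbb{Z}$.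 The ordinary family: $\mathcal{AS}_d^{\mathrm{ord}}$ is the set of $f=h/g$ with $h,g\in\mathbb{F}_q[x]$, $g$ monic squarefree, $(h,g)=1$, and either ($\deg g=d$, $\deg h\le d$) or ($\deg g=d-1$, $\deg h=d$). For monic squarefree $g$ of degree $d$ or $d-1$, $\mathcal{AS}_{d,g}^{\mathrm{ord}}=\{h/g\in\mathcal{AS}_d^{\mathrm{ord}}\}$. For these $f$, $N=2d-2$. For $\Phi\in\mathcal S(\mathbb{R})$, $\phi_N(t)=\sum_{n\in\mathbb{Z}}\Phi(N(t+n))$, $W_1(f,\psi,\Phi)=\sum_{i=1}^N\phi_N(\theta_i)$; $\langle\cdot\rangle$ is the uniform average; $\hat\Phi(\tau)=\int\Phi(t)e^{-2\pi i\tau t}\mathrm dt$. *)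

theory Defs
  imports "HOL-Analysis.Analysis" "HOL-Computational_Algebra.Computational_Algebra"
begin

(* All finite fields of characteristic p are realised inside a fixed algebraically
   closed field 'k of characteristic p:  F_{p^m} = {x. x^(p^m) = x}. *)
definition Fpow :: "nat \<Rightarrow> nat \<Rightarrow> 'k::field set" where
  "Fpow p m = {x. x ^ (p ^ m) = x}"

definition alg_closed_type :: "'k::field itself \<Rightarrow> bool" where
  "alg_closed_type _ \<longleftrightarrow> (\<forall>P::'k poly. degree P > 0 \<longrightarrow> (\<exists>x. poly P x = 0))"

definition polys_over :: "'k::field set \<Rightarrow> 'k poly set" where
  "polys_over S = {P. \<forall>i. coeff P i \<in> S}"

definition sqfree_over :: "'k::field set \<Rightarrow> 'k poly \<Rightarrow> bool" where
  "sqfree_over S g \<longleftrightarrow> (\<forall>D\<in>polys_over S. D * D dvd g \<longrightarrow> degree D = 0)"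

definition coprime_over :: "'k::field set \<Rightarrow> 'k poly \<Rightarrow> 'k poly \<Rightarrow> bool" where
  "coprime_over S h g \<longleftrightarrow> (\<forall>D\<in>polys_over S. D dvd h \<and> D dvd g \<longrightarrow> degree D = 0)"

definition tr :: "nat \<Rightarrow> nat \<Rightarrow> 'k::field \<Rightarrow> 'k" where
  "tr p m b = (\<Sum>j<m. b ^ (p ^ j))"

definition nontriv_add_char :: "nat \<Rightarrow> ('k::field \<Rightarrow> complex) \<Rightarrow> bool" where
  "nontriv_add_char p \<psi> \<longleftrightarrow>
     (\<forall>x\<in>Fpow p 1. \<forall>y\<in>Fpow p 1. \<psi> (x + y) = \<psi> x * \<psi> y) \<and>
     (\<forall>x\<in>Fpow p 1. \<psi> x \<noteq> 0) \<and> (\<exists>x\<in>Fpow p 1. \<psi> x \<noteq> 1)"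

(* character sum over F_{q^r} \<union> {\<infinity>}, q = p^n, f = h/g with (h,g)=1 *)
definition char_sum :: "nat \<Rightarrow> nat \<Rightarrow> ('k::field \<Rightarrow> complex) \<Rightarrow> 'k poly \<Rightarrow> 'k poly \<Rightarrow> nat \<Rightarrow> complex" where
  "char_sum p n \<psi> h g r =
     (\<Sum>\<alpha>\<in>{\<alpha>\<in>Fpow p (n*r). poly g \<alpha> \<noteq> 0}. \<psi> (tr p (n*r) (poly h \<alpha> / poly g \<alpha>)))
     + (if degree h \<le> degree g
        then \<psi> (tr p (n*r) (if degree h = degree g then lead_coeff h / lead_coeff g else 0))
        else 0)"

definition L_fps :: "nat \<Rightarrow> nat \<Rightarrow> ('k::field \<Rightarrow> complex) \<Rightarrow> 'k poly \<Rightarrow> 'k poly \<Rightarrow> complex fps" where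
  "L_fps p n \<psi> h g =
     fps_exp 1 oo Abs_fps (\<lambda>r. if r = 0 then 0 else char_sum p n \<psi> h g r / of_nat r)"

definition L_poly :: "nat \<Rightarrow> nat \<Rightarrow> ('k::field \<Rightarrow> complex) \<Rightarrow> 'k poly \<Rightarrow> 'k poly \<Rightarrow> complex poly" where
  "L_poly p n \<psi> h g = (THE P. fps_of_poly P = L_fps p n \<psi> h g)"

definition phiN :: "(real \<Rightarrow> complex) \<Rightarrow> nat \<Rightarrow> real \<Rightarrow> complex" where
  "phiN \<Phi> N t = infsum (\<lambda>m::int. \<Phi> (real N * (t + of_int m))) UNIV"

(* W_1 = \<Sum>_i phi_N(theta_i); L(u) = \<Prod>(1 - a_i u) with a_i = q^(1/2) rho_i the roots
   (with multiplicity) of the reflected polynomial, theta_i = arg(rho_i)/2pi = Arg(a_i)/2pi *)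
definition W1 :: "nat \<Rightarrow> nat \<Rightarrow> ('k::field \<Rightarrow> complex) \<Rightarrow> (real \<Rightarrow> complex) \<Rightarrow> 'k poly \<Rightarrow> 'k poly \<Rightarrow> complex" where
  "W1 p n \<psi> \<Phi> h g =
     (let L = L_poly p n \<psi> h g; N = degree L; R = reflect_poly L in
      \<Sum>z\<in>{z. poly R z = 0}. of_nat (order z R) * phiN \<Phi> N (Arg z / (2 * pi)))"

(* the family AS^ord_{d,g} over F_q, q = p^n, parametrised by numerators h *)
definition AS_ord_g :: "nat \<Rightarrow> nat \<Rightarrow> nat \<Rightarrow> 'k::field poly \<Rightarrow> 'k poly set" where
  "AS_ord_g p n d g = {h \<in> polys_over (Fpow p n). coprime_over (Fpow p n) h g \<and>
      ((degree g = d \<and> degree h \<le> d) \<or> (degree g = d - 1 \<and> degree h = d))}"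

definition schwartz :: "(real \<Rightarrow> complex) \<Rightarrow> bool" where
  "schwartz \<Phi> \<longleftrightarrow> (\<exists>D::nat \<Rightarrow> real \<Rightarrow> complex. D 0 = \<Phi> \<and>
      (\<forall>k t. (D k has_vector_derivative D (Suc k) t) (at t)) \<and>
      (\<forall>k m. \<exists>C. \<forall>t. \<bar>t\<bar> ^ m * norm (D k t) \<le> C))"

definition fourier :: "(real \<Rightarrow> complex) \<Rightarrow> real \<Rightarrow> complex" where
  "fourier \<Phi> \<tau> = (LINT t|lborel. \<Phi> t * exp (- 2 * of_real pi * \<i> * of_real \<tau> * of_real t))"

end

theory Submission
  imports Defs "HOL-Real_Asymp.Real_Asymp"
begin

text \<open>
  Write \<open>q = p ^ n\<close>, \<open>N = 2d - 2\<close> and let \<open>S\<^sub>k(f)\<close> be the character sum of \<open>f = h / g\<close> over the points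
  of degree dividing \<open>k\<close>. By Poisson summation \<open>W\<^sub>1\<close> equals \<open>\<integral>\<Phi>\<close> plus a combination, with
  weights of size \<open>O(1/N)\<close>, of \<open>q\<^sup>-\<^sup>k\<^sup>/\<^sup>2 S\<^sub>k(f)\<close> and its conjugate for \<open>1 \<le> k \<le> (1 - \<delta>) N\<close>; this
  needs that all inverse roots of the L-function have modulus \<open>q\<^sup>1\<^sup>/\<^sup>2\<close>.

  The L-function is a sum over polynomials \<open>F\<close> of a character of \<open>F'(\<gamma>)/F(\<gamma>)\<close>, \<open>\<gamma>\<close> running over the
  poles of \<open>f\<close>. Averaging over the shifts \<open>F + g B\<close> shows that it is a polynomial of degree \<open>N\<close> with
  leading coefficient of modulus \<open>q\<^sup>N\<^sup>/\<^sup>2\<close>. Stepanov's method bounds the inverse roots by \<open>q\<^sup>1\<^sup>/\<^sup>2\<close>, and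
  the leading coefficient then forces equality.

  For the average over \<open>h\<close>, the shift \<open>h + c g\<close> kills \<open>S\<^sub>k\<close> unless \<open>p\<close> divides \<open>k\<close>. If \<open>p\<close> divides \<open>k\<close>,
  Moebius inversion over the Frobenius orbits of the poles leaves only those points \<open>\<alpha>\<close> whose
  characteristic polynomial \<open>F\<close> of degree \<open>k\<close> has \<open>F'\<close> divisible by a large factor of \<open>g\<close>. The set
  of such \<open>F\<close> is a module over the polynomials in \<open>x\<^sup>p\<close>, and the degrees that occur in it
  are sparse enough, for \<open>p > 2\<close> and \<open>k < (1 - \<delta>) N\<close>, to make its contribution negligible.
\<close>

section \<open>Finite fields inside an algebraically closed field\<close>

text \<open>The obstacle is uniformity in \<open>q\<close> and \<open>g\<close>: no constant may
  depend on either, and \<open>g\<close> may have many prime factors. Moebius inversion over them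
  costs \<open>4 ^ card Ob\<close>, and this must be beaten by a power of \<open>q\<close> with
  exponent proportional to the degree, whichever of \<open>q\<close> and \<open>d\<close> is large.
  What pays for it is the distance of the support of the Fourier transform from 1: compactness gives
  a gap \<open>\<delta>\<close>, so that only \<open>k < (1 - \<delta>) N\<close> matter. With
  \<open>D = degree g\<close>, the polynomials \<open>F\<close> with nonzero \<open>F'\<close>
  divisible by a factor of \<open>g\<close> contribute \<open>q ^ (k / 2)\<close> divided by
  \<open>q\<close> to the power \<open>(D - k / 2) / 3\<close>, up to \<open>q ^ p\<close> and the
  cost of the inversion. The fraction 1/3 is \<open>1 - 2 / p\<close> at \<open>p = 3\<close>; at
  \<open>p = 2\<close> there would be no saving. The polynomials with \<open>F' = 0\<close>
  contribute about \<open>q ^ (k / p)\<close>, which is small against \<open>q ^ (k / 2)\<close>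
  again because \<open>p > 2\<close>; after normalization their sum over \<open>k\<close> converges,
  and it is divided by \<open>N\<close>. Irreducible polynomials never appear: Frobenius orbits in
  the algebraic closure take their place.\<close>

locale ffield =
  fixes p :: nat and K :: "'k::field itself"
  assumes prime_p: "prime p" and char_k: "CHAR('k) = p" and algc: "alg_closed_type TYPE('k)"
begin

abbreviation FF :: "nat \<Rightarrow> 'k set" where "FF m \<equiv> Fpow p m"

lemma p_gt_1: "p > 1"
  using prime_p prime_gt_1_nat by blast

lemma pm_pos: "p ^ m > 0"
  using p_gt_1 by simp

lemma frob_add: "((x::'k) + y) ^ (p ^ m) = x ^ (p ^ m) + y ^ (p ^ m)"
  using freshmans_dream'[where ?'a='k, of "p^m" m x y] prime_p char_k by simp

lemma frob_sum: "(sum f A :: 'k) ^ (p ^ m) = (\<Sum>i\<in>A. f i ^ (p ^ m))"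
  using freshmans_dream_sum'[where ?'a='k, of "p^m" m f A] prime_p char_k by simp

lemma frob_minus: "(- (x::'k)) ^ (p ^ m) = - (x ^ (p ^ m))"
proof -
  have "(x + - x) ^ (p ^ m) = x ^ (p ^ m) + (- x) ^ (p ^ m)" by (rule frob_add)
  moreover have "(x + - x) ^ (p ^ m) = 0" using pm_pos[of m] p_gt_1 by (simp add: power_0_left)
  ultimately show ?thesis by (metis add.inverse_unique)
qed

lemma frob_diff: "((x::'k) - y) ^ (p ^ m) = x ^ (p ^ m) - y ^ (p ^ m)"
  using frob_add[of x "-y" m] by (simp add: frob_minus)

lemma frob_zero [simp]: "(0::'k) ^ (p ^ m) = 0"
  using pm_pos[of m] by (simp add: power_0_left)

lemma frob_inj: "(x::'k) ^ (p ^ m) = y ^ (p ^ m) \<longleftrightarrow> x = y"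
proof
  assume "x ^ (p ^ m) = y ^ (p ^ m)"
  then have "(x - y) ^ (p ^ m) = 0" by (simp add: frob_diff)
  then show "x = y" by simp
qed simp

lemma FF_iff: "x \<in> FF m \<longleftrightarrow> x ^ (p ^ m) = x"
  by (simp add: Fpow_def)

lemma FF_0 [simp]: "0 \<in> FF m" and FF_1 [simp]: "1 \<in> FF m"
  by (auto simp: FF_iff)

lemma FF_add: "x \<in> FF m \<Longrightarrow> y \<in> FF m \<Longrightarrow> x + y \<in> FF m"
  and FF_diff: "x \<in> FF m \<Longrightarrow> y \<in> FF m \<Longrightarrow> x - y \<in> FF m"
  and FF_minus: "x \<in> FF m \<Longrightarrow> - x \<in> FF m"
  and FF_mult: "x \<in> FF m \<Longrightarrow> y \<in> FF m \<Longrightarrow> x * y \<in> FF m"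
  and FF_divide: "x \<in> FF m \<Longrightarrow> y \<in> FF m \<Longrightarrow> x / y \<in> FF m"
  by (auto simp: FF_iff frob_add frob_diff frob_minus power_mult_distrib power_divide)

lemma FF_power: "x \<in> FF m \<Longrightarrow> x ^ k \<in> FF m"
  by (induction k) (auto intro: FF_mult)

lemma FF_sum: "(\<And>i. i \<in> A \<Longrightarrow> f i \<in> FF m) \<Longrightarrow> sum f A \<in> FF m"
  by (simp add: FF_iff frob_sum)

lemma FF_of_nat: "of_nat k \<in> FF m"
  by (induction k) (auto intro: FF_add)

lemma frob_iter: "x ^ (p ^ (m * k)) = x" if "x \<in> FF m"
proof (induction k)
  case (Suc k)
  have "p ^ (m * Suc k) = p ^ m * p ^ (m * k)" by (simp add: power_add)
  then show ?case using Suc that by (simp add: power_mult FF_iff)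
qed simp

lemma FF_mono: "x \<in> FF m \<Longrightarrow> m dvd m' \<Longrightarrow> x \<in> FF m'"
  by (auto simp: FF_iff frob_iter elim!: dvdE)

lemma has_root: "degree (P::'k poly) > 0 \<Longrightarrow> \<exists>x. poly P x = 0"
  using algc by (auto simp: alg_closed_type_def)

text \<open>Induction on the degree removes a root with its full multiplicity, so the orders at the
  remaining roots do not change.\<close>

lemma splitting:
  assumes "(P::'k poly) \<noteq> 0"
  shows "P = smult (lead_coeff P) (\<Prod>z | poly P z = 0. [:- z, 1:] ^ order z P)"
    and "degree P = (\<Sum>z | poly P z = 0. order z P)"
proof -
  have "P = smult (lead_coeff P) (\<Prod>z | poly P z = 0. [:- z, 1:] ^ order z P) \<and>
        degree P = (\<Sum>z | poly P z = 0. order z P)"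
    using assms
  proof (induction "degree P" arbitrary: P rule: less_induct)
    case (less P)
    show ?case
    proof (cases "degree P = 0")
      case True
      then obtain c where "P = [:c:]" by (elim degree_eq_zeroE)
      then show ?thesis using less.prems by simp
    next
      case False
      then obtain x where x: "poly P x = 0" using has_root by blast
      obtain Q where Q: "P = [:- x, 1:] ^ order x P * Q" "\<not> [:- x, 1:] dvd Q"
        using order_decomp[OF less.prems] by blast
      have Q0: "Q \<noteq> 0" using Q less.prems by auto
      have Qx: "poly Q x \<noteq> 0" using Q(2) poly_eq_0_iff_dvd by blast
      have o: "order x P > 0" using x less.prems by (simp add: order_gt_0_iff)
      have deg: "degree P = order x P + degree Q"
        by (subst Q(1), subst degree_mult_eq) (auto simp: Q0 degree_power_eq)
      have lc: "lead_coeff P = lead_coeff Q"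
      proof -
        have "lead_coeff ([:- x, 1:] ^ order x P * Q) = lead_coeff Q"
          by (simp only: lead_coeff_mult lead_coeff_power) simp
        then show ?thesis using Q(1) by metis
      qed
      have roots: "{z. poly P z = 0} = insert x {z. poly Q z = 0}"
        by (subst Q(1)) (use o in auto)
      have ordz: "order z Q = order z P" if "z \<noteq> x" for z
      proof -
        have "order z P = order z ([:- x, 1:] ^ order x P) + order z Q"
          by (subst Q(1), rule order_mult) (use Q0 in auto)
        moreover have "order z ([:- x, 1:] ^ order x P) = 0"
          using that by (intro order_0I) auto
        ultimately show ?thesis by simp
      qed
      have fin: "finite {z. poly Q z = 0}" using Q0 by (rule poly_roots_finite)
      have IH: "Q = smult (lead_coeff Q) (\<Prod>z | poly Q z = 0. [:- z, 1:] ^ order z Q)"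
        "degree Q = (\<Sum>z | poly Q z = 0. order z Q)"
        using less.hyps[of Q] Q0 o deg by auto
      have 1: "(\<Prod>z | poly Q z = 0. [:- z, 1:] ^ order z Q) = (\<Prod>z | poly Q z = 0. [:- z, 1:] ^ order z P)"
      proof (rule prod.cong[OF refl])
        fix z assume "z \<in> {z. poly Q z = 0}"
        then have "z \<noteq> x" using Qx by auto
        then show "[:- z, 1:] ^ order z Q = [:- z, 1:] ^ order z P" by (simp add: ordz)
      qed
      have 2: "(\<Sum>z | poly Q z = 0. order z Q) = (\<Sum>z | poly Q z = 0. order z P)"
        by (rule sum.cong[OF refl]) (use Qx ordz in force)
      have "P = [:- x, 1:] ^ order x P * smult (lead_coeff Q) (\<Prod>z | poly Q z = 0. [:- z, 1:] ^ order z P)"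
        using Q(1) IH(1) 1 by metis
      also have "\<dots> = smult (lead_coeff P) (\<Prod>z | poly P z = 0. [:- z, 1:] ^ order z P)"
        unfolding roots using Qx fin by (simp add: lc)
      finally show ?thesis
        unfolding roots using Qx fin by (simp add: deg IH(2) 2)
    qed
  qed
  then show "P = smult (lead_coeff P) (\<Prod>z | poly P z = 0. [:- z, 1:] ^ order z P)"
    "degree P = (\<Sum>z | poly P z = 0. order z P)" by auto
qed

lemma order_eq_1:
  assumes "poly P z = 0" "poly (pderiv P) z \<noteq> 0"
  shows "order z (P::'k poly) = 1"
proof -
  have P0: "P \<noteq> 0" using assms by auto
  have "order z P > 0" using assms P0 by (simp add: order_gt_0_iff)
  moreover have "\<not> order z P \<ge> 2"
  proof
    assume "order z P \<ge> 2"
    then have "[:- z, 1:] ^ 2 dvd P" by (simp add: order_divides)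
    then obtain R where "P = [:- z, 1:] * ([:- z, 1:] * R)"
      by (metis dvd_def mult.assoc power2_eq_square)
    then have "poly (pderiv P) z = 0" by (simp only: pderiv_mult poly_add poly_mult) simp
    then show False using assms by simp
  qed
  ultimately show ?thesis by linarith
qed

lemma splitting_simple:
  assumes "lead_coeff (P::'k poly) = 1" "\<And>z. poly P z = 0 \<Longrightarrow> order z P = 1"
  shows "P = (\<Prod>z | poly P z = 0. [:- z, 1:])" "degree P = card {z. poly P z = 0}"
proof -
  have P0: "P \<noteq> 0" using assms(1) by auto
  have "(\<Prod>z | poly P z = 0. [:- z, 1:] ^ order z P) = (\<Prod>z | poly P z = 0. [:- z, 1:])"
    by (rule prod.cong) (use assms(2) in auto)
  then show "P = (\<Prod>z | poly P z = 0. [:- z, 1:])"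
    using splitting(1)[OF P0] assms(1) by simp
  show "degree P = card {z. poly P z = 0}"
    using splitting(2)[OF P0] assms(2) by simp
qed

lemma of_nat_p [simp]: "of_nat p = (0::'k)"
  using char_k by (metis of_nat_CHAR)

text \<open>The defining polynomial has the constant derivative -1, hence only simple roots, and
  their number is its degree. For \<open>m = 0\<close> the set would be the whole field.\<close>

lemma card_FF: assumes "m > 0" shows "card (FF m) = p ^ m" and "finite (FF m)"
proof -
  define P :: "'k poly" where "P = monom 1 (p ^ m) - monom 1 1"
  have pm: "p ^ m > 1" using p_gt_1 assms one_less_power by blast
  have ev: "poly P z = z ^ (p ^ m) - z" for z by (simp add: P_def poly_monom)
  have dvd: "p dvd p ^ m" using assms by (simp add: dvd_power)
  then have "of_nat (p ^ m) = (0::'k)" using char_k of_nat_eq_0_iff_char_dvd by blast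
  then have der: "poly (pderiv P) z = -1" for z by (simp add: P_def pderiv_diff pderiv_monom del: of_nat_power of_nat_p)
  have deg: "degree P = p ^ m" 
    using degree_add_eq_left[of "- monom (1::'k) 1" "monom 1 (p ^ m)"] pm
    by (simp add: P_def degree_monom_eq)
  have lc: "lead_coeff P = 1" unfolding deg using pm by (simp add: P_def)
  have "{z. poly P z = 0} = FF m" by (auto simp: ev FF_iff)
  moreover have "degree P = card {z. poly P z = 0}"
    by (rule splitting_simple(2)[OF lc]) (rule order_eq_1, auto simp: der)
  ultimately show "card (FF m) = p ^ m" using deg by simp
  then show "finite (FF m)" using pm by (metis card.infinite not_one_less_zero)
qed

section \<open>Galois descent: Frobenius acting on coefficients\<close>

definition frobp :: "nat \<Rightarrow> 'k poly \<Rightarrow> 'k poly" where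
  "frobp m = map_poly (\<lambda>x. x ^ (p ^ m))"

lemma coeff_frobp [simp]: "coeff (frobp m P) i = coeff P i ^ (p ^ m)"
  by (simp add: frobp_def coeff_map_poly)

lemma frobp_mult: "frobp m (P * Q) = frobp m P * frobp m Q"
  by (rule poly_eqI) (simp add: coeff_mult frob_sum power_mult_distrib)

lemma frobp_1 [simp]: "frobp m 1 = 1"
  by (rule poly_eqI) auto

lemma frobp_prod: "frobp m (prod f A) = (\<Prod>i\<in>A. frobp m (f i))"
  by (induction A rule: infinite_finite_induct) (auto simp: frobp_mult)

lemma frobp_power: "frobp m (P ^ k) = frobp m P ^ k"
  by (induction k) (auto simp: frobp_mult)

lemma frobp_linear: "frobp m [:- a, 1:] = [:- (a ^ (p ^ m)), 1:]"
  by (rule poly_eqI) (auto simp: coeff_pCons frob_minus split: nat.splits)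

lemma poly_frobp: "poly (frobp m P) (x ^ (p ^ m)) = poly P x ^ (p ^ m)"
proof -
  have "degree (frobp m P) = degree P"
    unfolding frobp_def by (rule degree_map_poly) simp
  then show ?thesis
    by (simp add: poly_altdef frob_sum power_mult_distrib) (simp flip: power_mult add: mult.commute)
qed

abbreviation PO :: "nat \<Rightarrow> 'k poly set" where "PO m \<equiv> polys_over (FF m)"

lemma PO_iff: "P \<in> PO m \<longleftrightarrow> frobp m P = P"
  by (auto simp: polys_over_def FF_iff poly_eq_iff)

lemma PO_coeff: "P \<in> PO m \<Longrightarrow> coeff P i \<in> FF m"
  by (auto simp: polys_over_def)

lemma PO_0 [simp]: "0 \<in> PO m" and PO_1 [simp]: "1 \<in> PO m"
  by (auto simp: polys_over_def)

lemma PO_add: "P \<in> PO m \<Longrightarrow> Q \<in> PO m \<Longrightarrow> P + Q \<in> PO m"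
  and PO_diff: "P \<in> PO m \<Longrightarrow> Q \<in> PO m \<Longrightarrow> P - Q \<in> PO m"
  and PO_smult: "c \<in> FF m \<Longrightarrow> P \<in> PO m \<Longrightarrow> smult c P \<in> PO m"
  and PO_monom: "c \<in> FF m \<Longrightarrow> monom c i \<in> PO m"
  by (auto simp: polys_over_def intro: FF_add FF_diff FF_minus FF_mult)

lemma PO_mult: "P \<in> PO m \<Longrightarrow> Q \<in> PO m \<Longrightarrow> P * Q \<in> PO m"
  by (simp add: PO_iff frobp_mult)

lemma PO_power: "P \<in> PO m \<Longrightarrow> P ^ k \<in> PO m"
  by (induction k) (auto intro: PO_mult)

lemma PO_sum: "(\<And>i. i \<in> A \<Longrightarrow> f i \<in> PO m) \<Longrightarrow> sum f A \<in> PO m"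
  by (induction A rule: infinite_finite_induct) (auto intro: PO_add)

lemma PO_linear: "c \<in> FF m \<Longrightarrow> [:- c, 1:] \<in> PO m"
  by (simp add: PO_iff frobp_linear FF_iff)

lemma PO_pderiv: "P \<in> PO m \<Longrightarrow> pderiv P \<in> PO m"
  unfolding polys_over_def by (auto simp: coeff_pderiv simp del: of_nat_Suc intro!: FF_mult FF_of_nat)

lemma PO_mono: "P \<in> PO m \<Longrightarrow> m dvd m' \<Longrightarrow> P \<in> PO m'"
  using FF_mono by (auto simp: polys_over_def)

lemma PO_poly: "P \<in> PO m \<Longrightarrow> x \<in> FF m \<Longrightarrow> poly P x \<in> FF m"
  by (auto simp: poly_altdef intro!: FF_sum FF_mult PO_coeff FF_power)

lemma PO_poly_frob: "P \<in> PO m \<Longrightarrow> poly P (x ^ (p ^ m)) = poly P x ^ (p ^ m)"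
  using poly_frobp[of m P x] by (simp add: PO_iff)

lemma PO_poly_frob_iter: "P \<in> PO m \<Longrightarrow> poly P (x ^ (p ^ (m * j))) = poly P x ^ (p ^ (m * j))"
  by (rule PO_poly_frob) (erule PO_mono, simp)

lemma PO_quotient:
  assumes "G * H \<in> PO m" "G \<in> PO m" "G \<noteq> 0" shows "H \<in> PO m"
proof -
  have "G * frobp m H = G * H" using assms by (simp add: PO_iff frobp_mult)
  then show ?thesis using assms(3) by (simp add: PO_iff)
qed

lemma order_frob:
  assumes "P \<in> PO m" "P \<noteq> 0" shows "order (x ^ (p ^ m)) P = order x P"
proof -
  obtain Q where Q: "P = [:- x, 1:] ^ order x P * Q" "\<not> [:- x, 1:] dvd Q"
    using order_decomp[OF assms(2)] by blast
  have Qx: "poly Q x \<noteq> 0" using Q(2) poly_eq_0_iff_dvd by blast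
  have "P = frobp m ([:- x, 1:] ^ order x P * Q)" using assms(1) Q(1) by (simp add: PO_iff)
  then have eq: "P = [:- (x ^ (p ^ m)), 1:] ^ order x P * frobp m Q"
    by (simp add: frobp_mult frobp_power frobp_linear)
  have "poly (frobp m Q) (x ^ (p ^ m)) \<noteq> 0" using Qx by (simp add: poly_frobp)
  then have "\<not> [:- (x ^ (p ^ m)), 1:] dvd frobp m Q" using poly_eq_0_iff_dvd by blast
  from order_unique_lemma[of _ "order x P" P] show ?thesis
    by (metis eq \<open>poly (frobp m Q) (x ^ (p ^ m)) \<noteq> 0\<close> assms(2) dvd_triv_left mult_eq_0_iff
        order_0I order_mult order_power_n_n add.right_neutral)
qed

lemma order_frob_iter:
  assumes "P \<in> PO m" "P \<noteq> 0" shows "order (x ^ (p ^ (m * j))) P = order x P"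
  by (rule order_frob) (use assms PO_mono in auto)

text \<open>Vanishing of the coefficients from index \<open>k\<close> on, instead of a degree bound,
  keeps 0 in the set and makes this a space of dimension \<open>k\<close> over \<open>FF m\<close>
  even for \<open>k = 0\<close>.\<close>

definition PD :: "nat \<Rightarrow> nat \<Rightarrow> 'k poly set" where
  "PD m k = {P \<in> PO m. \<forall>i\<ge>k. coeff P i = 0}"

lemma PD_0: "PD m 0 = {0}"
  by (auto simp: PD_def poly_eq_iff)

lemma PD_Suc_bij: "bij_betw (\<lambda>(a, P). monom a k + P) (FF m \<times> PD m k) (PD m (Suc k))"
proof (rule bij_betw_byWitness[where f' = "\<lambda>P. (coeff P k, P - monom (coeff P k) k)"])
  show "(\<lambda>(a, P). monom a k + P) ` (FF m \<times> PD m k) \<subseteq> PD m (Suc k)"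
    by (auto simp: PD_def intro!: PO_add PO_monom)
  show "(\<lambda>P. (coeff P k, P - monom (coeff P k) k)) ` PD m (Suc k) \<subseteq> FF m \<times> PD m k"
    by (auto simp: PD_def intro!: PO_diff PO_monom PO_coeff)
qed (auto simp: PD_def)

lemma card_PD: assumes "m > 0" shows "card (PD m k) = (p ^ m) ^ k" and "finite (PD m k)"
proof -
  have "finite (PD m k) \<and> card (PD m k) = (p ^ m) ^ k"
  proof (induction k)
    case (Suc k)
    have "finite (FF m \<times> PD m k)" using Suc card_FF[OF assms] by auto
    then show ?case using bij_betw_finite[OF PD_Suc_bij[of k m]] bij_betw_same_card[OF PD_Suc_bij[of k m]]
      Suc card_FF[OF assms] by (simp add: card_cartesian_product)
  qed (simp add: PD_0)
  then show "card (PD m k) = (p ^ m) ^ k" "finite (PD m k)" by auto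
qed

lemma PD_iff_degree: "P \<in> PD m (Suc k) \<longleftrightarrow> P \<in> PO m \<and> degree P \<le> k"
  unfolding PD_def by (auto intro: degree_le simp: coeff_eq_0)

lemma PD_degree_less: "P \<in> PD m k \<Longrightarrow> P = 0 \<or> degree P < k"
  unfolding PD_def by (metis (mono_tags, lifting) leading_coeff_0_iff mem_Collect_eq not_le)

lemma PD_I: "P \<in> PO m \<Longrightarrow> P = 0 \<or> degree P < k \<Longrightarrow> P \<in> PD m k"
  by (auto simp: PD_def coeff_eq_0)

lemma PD_0_mem [simp]: "0 \<in> PD m k" by (simp add: PD_def)

lemma PD_PO: "P \<in> PD m k \<Longrightarrow> P \<in> PO m" by (simp add: PD_def)

lemma PD_add: "P \<in> PD m k \<Longrightarrow> Q \<in> PD m k \<Longrightarrow> P + Q \<in> PD m k"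
  and PD_diff: "P \<in> PD m k \<Longrightarrow> Q \<in> PD m k \<Longrightarrow> P - Q \<in> PD m k"
  and PD_smult: "c \<in> FF m \<Longrightarrow> P \<in> PD m k \<Longrightarrow> smult c P \<in> PD m k"
  by (auto simp: PD_def PO_add PO_diff PO_smult)

text \<open>The Frobenius iterates of a root are again roots, of which there are finitely many. Two
  iterates coincide, and injectivity of Frobenius makes \<open>x\<close> itself periodic.\<close>

lemma roots_in_FF:
  assumes "P \<in> PO m" "P \<noteq> 0" "poly P x = 0" "m > 0"
  shows "\<exists>r>0. x \<in> FF (m * r)"
proof -
  let ?f = "\<lambda>j. x ^ (p ^ (m * j))"
  have "?f ` UNIV \<subseteq> {z. poly P z = 0}"
    using assms pm_pos by (auto simp: PO_poly_frob_iter)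
  then have "finite (range ?f)" using assms(2) poly_roots_finite finite_subset by blast
  then have "\<not> inj ?f" using finite_imageD infinite_UNIV_nat by blast
  then obtain i j where ij: "i < j" "?f i = ?f j" unfolding inj_on_def by (metis linorder_neqE_nat)
  have "p ^ (m * j) = p ^ (m * (j - i)) * p ^ (m * i)" using ij(1)
    by (simp flip: power_add add: distrib_left[symmetric])
  then have "?f j = (x ^ (p ^ (m * (j - i)))) ^ (p ^ (m * i))" by (simp add: power_mult)
  then have "x ^ (p ^ (m * (j - i))) = x" using ij(2) frob_inj by metis
  then show ?thesis using ij(1) by (intro exI[of _ "j - i"]) (auto simp: FF_iff)
qed

end

section \<open>Traces and additive characters\<close>

context ffield
begin

lemma tr_add: "tr p m (x + y) = tr p m x + tr p m (y::'k)"
  by (simp add: tr_def frob_add sum.distrib)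

lemma tr_sum: "tr p m (sum f A) = (\<Sum>i\<in>A. tr p m (f i :: 'k))"
  unfolding tr_def by (subst sum.swap) (simp add: frob_sum)

lemma tr_0 [simp]: "tr p m (0::'k) = 0"
  by (simp add: tr_def)

lemma tr_in_FF: assumes "(x::'k) \<in> FF m" shows "tr p m x \<in> FF (Suc 0)"
proof (cases m)
  case 0
  then show ?thesis by (simp add: tr_def)
next
  case (Suc m')
  have "tr p m x ^ p = (\<Sum>j<m. (x ^ (p ^ j)) ^ p)" using frob_sum[of _ _ 1] by (simp add: tr_def)
  also have "\<dots> = (\<Sum>j<m. x ^ (p ^ Suc j))"
    by (simp flip: power_mult add: mult.commute)
  also have "\<dots> = (\<Sum>j<m. x ^ (p ^ j)) + x ^ (p ^ m) - x"
    using sum.lessThan_Suc[of "\<lambda>j. x ^ (p ^ j)" m] sum.lessThan_Suc_shift[of "\<lambda>j. x ^ (p ^ j)" m]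
    by (simp add: algebra_simps)
  also have "\<dots> = tr p m x" using assms by (simp add: FF_iff tr_def)
  finally show ?thesis by (simp add: FF_iff)
qed

lemma tr_scale: "c \<in> FF (Suc 0) \<Longrightarrow> tr p m (c * x) = c * tr p m (x::'k)"
  using FF_mono[of c "Suc 0"] by (simp add: tr_def power_mult_distrib sum_distrib_left FF_iff)

text \<open>Relative trace from \<open>FF (n * r)\<close> to \<open>FF n\<close>. By transitivity
  (\<open>tr_tower\<close>), characters of all extensions are expressed by the one character
  \<open>chr n\<close>.\<close>

definition Trq :: "nat \<Rightarrow> nat \<Rightarrow> 'k \<Rightarrow> 'k" where
  "Trq n r x = (\<Sum>j<r. x ^ (p ^ (n * j)))"

lemma tr_tower: "tr p (n * r) x = tr p n (Trq n r x)"
proof -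
  have split: "(\<Sum>j<a + b. x ^ (p ^ j)) = (\<Sum>j<a. x ^ (p ^ j)) + (\<Sum>j<b. x ^ (p ^ (a + j)))" for a b
    by (induction b) (auto simp: add_ac)
  have "tr p n (Trq n r x) = (\<Sum>j<r. \<Sum>i<n. x ^ (p ^ (n * j + i)))"
    by (simp add: Trq_def tr_sum) (simp add: tr_def power_add power_mult)
  also have "\<dots> = tr p (n * r) x"
  proof (induction r)
    case (Suc r)
    have "(\<Sum>j<n * Suc r. x ^ (p ^ j)) = (\<Sum>j<n * r + n. x ^ (p ^ j))" by (simp add: add.commute)
    also have "\<dots> = (\<Sum>j<n * r. x ^ (p ^ j)) + (\<Sum>j<n. x ^ (p ^ (n * r + j)))"
      by (rule split)
    finally show ?case using Suc by (simp add: tr_def)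
  qed (simp add: tr_def)
  finally show ?thesis ..
qed

text \<open>The trace is a polynomial of degree at most \<open>p ^ (m - 1)\<close>, nonzero because
  its linear coefficient is 1, so it cannot vanish at \<open>p ^ m\<close> points.\<close>

lemma tr_nontrivial: assumes "m > 0" shows "\<exists>x\<in>FF m. tr p m x \<noteq> (0::'k)"
proof (rule ccontr)
  assume *: "\<not> ?thesis"
  define P :: "'k poly" where "P = (\<Sum>j<m. monom 1 (p ^ j))"
  have ev: "poly P x = tr p m x" for x by (simp add: P_def poly_sum poly_monom tr_def)
  have c1: "coeff P 1 = 1"
  proof -
    have "coeff P 1 = (\<Sum>j<m. if j = 0 then 1 else 0)"
      unfolding P_def coeff_sum
      by (rule sum.cong) (use p_gt_1 in \<open>auto simp: power_eq_1_iff\<close>)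
    then show ?thesis using assms by simp
  qed
  have P0: "P \<noteq> 0" using c1 by auto
  have deg: "degree P \<le> p ^ (m - 1)"
    unfolding P_def
  proof (rule degree_sum_le)
    fix j assume "j \<in> {..<m}"
    then have "p ^ j \<le> p ^ (m - 1)" using p_gt_1 by (intro power_increasing) auto
    then show "degree (monom (1::'k) (p ^ j)) \<le> p ^ (m - 1)" by (simp add: degree_monom_eq)
  qed simp
  have "FF m \<subseteq> {x. poly P x = 0}" using * by (auto simp: ev)
  then have "card (FF m) \<le> degree P"
    using card_poly_roots_bound[OF P0] poly_roots_finite[OF P0] card_mono by (metis order.trans)
  then have "p ^ m \<le> p ^ (m - 1)" using card_FF[OF assms] deg by simp
  moreover have "p ^ (m - 1) < p ^ m" using p_gt_1 assms by (intro power_strict_increasing) auto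
  ultimately show False by simp
qed

end

locale ffield_char = ffield p K for p :: nat and K :: "'k::field itself" +
  fixes \<psi> :: "'k \<Rightarrow> complex"
  assumes psi: "nontriv_add_char p \<psi>"
begin

lemma psi_add: "x \<in> FF (Suc 0) \<Longrightarrow> y \<in> FF (Suc 0) \<Longrightarrow> \<psi> (x + y) = \<psi> x * \<psi> y"
  and psi_nz: "x \<in> FF (Suc 0) \<Longrightarrow> \<psi> x \<noteq> 0"
  and psi_nontrivial: "\<exists>x\<in>FF (Suc 0). \<psi> x \<noteq> 1"
  using psi by (auto simp: nontriv_add_char_def)

lemma psi_0 [simp]: "\<psi> 0 = 1"
  using psi_add[of 0 0] psi_nz[of 0] by simp

lemma psi_norm: assumes "x \<in> FF (Suc 0)" shows "norm (\<psi> x) = 1"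
proof -
  have "\<psi> (of_nat k * x) = \<psi> x ^ k" for k
    by (induction k) (auto simp: distrib_right psi_add FF_mult FF_of_nat assms)
  from this[of p] have "\<psi> x ^ p = 1" by simp
  then have "norm (\<psi> x) ^ p = 1" by (metis norm_one norm_power)
  then show ?thesis using p_gt_1 power_eq_imp_eq_base[of "norm (\<psi> x)" p 1] by simp
qed

definition chr :: "nat \<Rightarrow> 'k \<Rightarrow> complex" where "chr m x = \<psi> (tr p m x)"

lemma chr_add: "x \<in> FF m \<Longrightarrow> y \<in> FF m \<Longrightarrow> chr m (x + y) = chr m x * chr m y"
  by (simp add: chr_def tr_add psi_add tr_in_FF)

lemma chr_norm: "x \<in> FF m \<Longrightarrow> norm (chr m x) = 1"
  by (simp add: chr_def psi_norm tr_in_FF)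

lemma chr_0 [simp]: "chr m 0 = 1"
  by (simp add: chr_def)

lemma chr_of_nat: "x \<in> FF m \<Longrightarrow> chr m (of_nat k * x) = chr m x ^ k"
  by (induction k) (auto simp: distrib_right chr_add FF_mult FF_of_nat)

lemma chr_tower: "chr (n * r) x = chr n (Trq n r x)"
  by (simp add: chr_def tr_tower)

text \<open>The trace is linear over the prime field, so scaling a point of nonzero trace reaches
  every value, in particular one where \<open>\<psi>\<close> is not 1.\<close>

lemma chr_nontrivial: assumes "m > 0" "u \<in> FF m" "u \<noteq> 0" shows "\<exists>y\<in>FF m. chr m (y * u) \<noteq> 1"
proof -
  obtain x where x: "x \<in> FF m" "tr p m x \<noteq> 0" using tr_nontrivial[OF assms(1)] by blast
  obtain c where c: "c \<in> FF (Suc 0)" "\<psi> c \<noteq> 1" using psi_nontrivial by blast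
  define e where "e = c / tr p m x"
  have e: "e \<in> FF (Suc 0)" unfolding e_def by (intro FF_divide c tr_in_FF x)
  have "tr p m (e * x) = c" using x by (simp add: tr_scale e) (simp add: e_def)
  moreover have "e * x / u \<in> FF m" using e x assms by (intro FF_divide FF_mult) (auto intro: FF_mono[of e "Suc 0"])
  ultimately show ?thesis using c assms by (intro bexI[of _ "e * x / u"]) (auto simp: chr_def)
qed

end

lemma sum_shift_zero:
  fixes f :: "'a \<Rightarrow> 'b::field"
  assumes "bij_betw s A A" "\<And>x. x \<in> A \<Longrightarrow> f (s x) = w * f x" "w \<noteq> 1"
  shows "sum f A = 0"
proof -
  have "sum f A = (\<Sum>x\<in>A. f (s x))" using sum.reindex_bij_betw[OF assms(1), of f] by simp
  also have "\<dots> = w * sum f A" using assms(2) by (simp add: sum_distrib_left)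
  finally show ?thesis using assms(3) by (simp add: algebra_simps)
qed

context ffield_char
begin

text \<open>Some multiple \<open>B1\<close> of \<open>B0\<close> has a character value other than 1,
  and translation by \<open>B1\<close> multiplies the sum by that value.\<close>

lemma linear_char_sum_zero:
  assumes m: "m > 0" and B0: "B0 \<in> V" and V: "\<And>B B'. B \<in> V \<Longrightarrow> B' \<in> V \<Longrightarrow> B + B' \<in> V"
    "\<And>B B'. B \<in> V \<Longrightarrow> B' \<in> V \<Longrightarrow> B - B' \<in> V"
    "\<And>c B. c \<in> FF m \<Longrightarrow> B \<in> V \<Longrightarrow> smult c B \<in> V"
    and lam: "\<And>B. B \<in> V \<Longrightarrow> lam B \<in> FF m" "\<And>B B'. B \<in> V \<Longrightarrow> B' \<in> V \<Longrightarrow> lam (B + B') = lam B + lam B'"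
    "\<And>c B. c \<in> FF m \<Longrightarrow> B \<in> V \<Longrightarrow> lam (smult c B) = c * lam B" and nz: "lam B0 \<noteq> (0::'k)"
  shows "(\<Sum>B\<in>V. chr m (lam B)) = 0"
proof -
  obtain y where y: "y \<in> FF m" "chr m (y * lam B0) \<noteq> 1" using chr_nontrivial[OF m lam(1)[OF B0] nz] by blast
  define B1 where "B1 = smult y B0"
  have B1: "B1 \<in> V" unfolding B1_def by (intro V y B0)
  show ?thesis
  proof (rule sum_shift_zero[where s = "\<lambda>B. B + B1" and w = "chr m (lam B1)"])
    show "bij_betw (\<lambda>B. B + B1) V V"
      by (rule bij_betw_byWitness[where f' = "\<lambda>B. B - B1"]) (use V B1 in auto)
    show "chr m (lam (B + B1)) = chr m (lam B1) * chr m (lam B)" if "B \<in> V" for B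
      using that B1 lam by (simp add: chr_add)
    show "chr m (lam B1) \<noteq> 1" using y lam(3)[OF y(1) B0] by (simp add: B1_def)
  qed
qed

end

section \<open>Frobenius orbits and the Euler product\<close>

lemma prod_lessThan_add:
  fixes f :: "nat \<Rightarrow> 'a::comm_monoid_mult"
  shows "(\<Prod>j<a + b. f j) = (\<Prod>j<a. f j) * (\<Prod>j<b. f (a + j))"
  by (induction b) (auto simp: mult_ac)

context ffield
begin

lemma prod_linear_power_dvd:
  assumes "(P::'k poly) \<noteq> 0" "finite S" "\<And>z. z \<in> S \<Longrightarrow> s \<le> order z P"
  shows "(\<Prod>z\<in>S. [:- z, 1:] ^ s) dvd P"
proof (cases "s = 0")
  case False
  have "S \<subseteq> {z. poly P z = 0}" using assms False by (force simp: order_root)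
  then have "(\<Prod>z\<in>S. [:- z, 1:] ^ order z P) dvd (\<Prod>z | poly P z = 0. [:- z, 1:] ^ order z P)"
    using poly_roots_finite[OF assms(1)] by (rule prod_dvd_prod_subset[rotated])
  moreover have "(\<Prod>z\<in>S. [:- z, 1:] ^ s) dvd (\<Prod>z\<in>S. [:- z, 1:] ^ order z P)"
    by (rule prod_dvd_prod) (use assms in \<open>auto intro: le_imp_power_dvd\<close>)
  ultimately have "(\<Prod>z\<in>S. [:- z, 1:] ^ s) dvd (\<Prod>z | poly P z = 0. [:- z, 1:] ^ order z P)"
    by (rule dvd_trans[rotated])
  then show ?thesis by (subst splitting(1)[OF assms(1)]) (rule dvd_smult)
qed simp

text \<open>For \<open>\<alpha>\<close> in the extension of degree \<open>r\<close> of the field \<open>FF n\<close>, this is the characteristic polynomial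
  of \<open>\<alpha>\<close>; the degree of \<open>\<alpha>\<close> over \<open>FF n\<close> is \<open>odeg n \<alpha>\<close>.\<close>

definition cpoly :: "nat \<Rightarrow> nat \<Rightarrow> 'k \<Rightarrow> 'k poly" where
  "cpoly n r \<alpha> = (\<Prod>j<r. [:- (\<alpha> ^ (p ^ (n * j))), 1:])"

lemma cpoly_lead [simp]: "lead_coeff (cpoly n r \<alpha>) = 1"
  unfolding cpoly_def lead_coeff_prod by simp

lemma cpoly_nz [simp]: "cpoly n r \<alpha> \<noteq> 0"
  using cpoly_lead[of n r \<alpha>] by force

lemma cpoly_degree [simp]: "degree (cpoly n r \<alpha>) = r"
  unfolding cpoly_def by (subst degree_prod_eq_sum_degree) auto

lemma cpoly_root: "r > 0 \<Longrightarrow> poly (cpoly n r \<alpha>) \<alpha> = 0"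
  unfolding cpoly_def poly_prod by (intro prod_zero bexI[of _ 0]) auto

lemma cpoly_PO: assumes "\<alpha> \<in> FF (n * r)" shows "cpoly n r \<alpha> \<in> PO n"
proof -
  let ?f = "\<lambda>j. [:- (\<alpha> ^ (p ^ (n * j))), 1:]"
  have "frobp n (cpoly n r \<alpha>) = (\<Prod>j<r. ?f (Suc j))"
    unfolding cpoly_def frobp_prod frobp_linear
    by (simp flip: power_mult add: power_add mult.commute)
  \<comment> \<open>The shifted product gains the factor of index \<open>r\<close>, which equals
    that of index 0 because \<alpha> lies in \<open>FF (n * r)\<close>.\<close>
  moreover have "(\<Prod>j<r. ?f (Suc j)) * ?f 0 = (\<Prod>j<r. ?f j) * ?f 0"
    using prod.lessThan_Suc[of ?f r] prod.lessThan_Suc_shift[of ?f r] assms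
    by (simp only: FF_iff mult.commute o_def) simp
  then have "(\<Prod>j<r. ?f (Suc j)) = (\<Prod>j<r. ?f j)" by (rule mult_right_cancel[THEN iffD1, rotated]) simp
  ultimately show ?thesis by (simp only: PO_iff cpoly_def)
qed

definition odeg :: "nat \<Rightarrow> 'k \<Rightarrow> nat" where
  "odeg n \<alpha> = (LEAST r. r > 0 \<and> \<alpha> \<in> FF (n * r))"

lemma odeg:
  assumes "\<alpha> \<in> FF (n * r0)" "r0 > 0"
  shows "odeg n \<alpha> > 0" "\<alpha> \<in> FF (n * odeg n \<alpha>)" "\<alpha> \<in> FF (n * r) \<longleftrightarrow> odeg n \<alpha> dvd r"
proof -
  define D where "D = odeg n \<alpha>"
  have D: "D > 0 \<and> \<alpha> \<in> FF (n * D)" unfolding D_def odeg_def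
    by (rule LeastI[of _ r0]) (use assms in auto)
  have least: "D \<le> t" if "t > 0" "\<alpha> \<in> FF (n * t)" for t
    unfolding D_def odeg_def using that by (intro Least_le) auto
  have "D dvd r" if "\<alpha> \<in> FF (n * r)"
  proof -
    have "n * r = n * D * (r div D) + n * (r mod D)"
      by (metis mult.assoc distrib_left mult_div_mod_eq)
    then have "\<alpha> ^ (p ^ (n * r)) = (\<alpha> ^ (p ^ (n * D * (r div D)))) ^ (p ^ (n * (r mod D)))"
      by (simp add: power_add power_mult)
    then have "\<alpha> \<in> FF (n * (r mod D))" using that D by (simp add: FF_iff frob_iter)
    then have "r mod D = 0" using least[of "r mod D"] D by (metis gr0I mod_less_divisor not_le)
    then show ?thesis by auto
  qed
  moreover have "\<alpha> \<in> FF (n * r)" if "D dvd r"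
    using D that by (auto intro: FF_mono)
  ultimately show "odeg n \<alpha> > 0" "\<alpha> \<in> FF (n * odeg n \<alpha>)" "\<alpha> \<in> FF (n * r) \<longleftrightarrow> odeg n \<alpha> dvd r"
    using D by (auto simp: D_def)
qed

lemma odeg_inj:
  assumes "\<alpha> \<in> FF (n * r0)" "r0 > 0"
  shows "inj_on (\<lambda>j. \<alpha> ^ (p ^ (n * j))) {..<odeg n \<alpha>}"
proof -
  have False if "i < j" "j < odeg n \<alpha>" "\<alpha> ^ (p ^ (n * i)) = \<alpha> ^ (p ^ (n * j))" for i j
  proof -
    have "p ^ (n * j) = p ^ (n * (j - i)) * p ^ (n * i)" using that(1)
      by (simp flip: power_add add: distrib_left[symmetric])
    then have "\<alpha> ^ (p ^ (n * j)) = (\<alpha> ^ (p ^ (n * (j - i)))) ^ (p ^ (n * i))" by (simp add: power_mult)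
    then have "\<alpha> \<in> FF (n * (j - i))" using that(3) frob_inj by (metis FF_iff)
    then have "odeg n \<alpha> dvd (j - i)" using odeg(3)[OF assms] by blast
    then show False using that by (auto dest!: dvd_imp_le)
  qed
  then show ?thesis unfolding inj_on_def by (metis lessThan_iff linorder_neqE_nat)
qed

lemma cpoly_power:
  assumes "\<alpha> \<in> FF (n * D)" shows "cpoly n (D * s) \<alpha> = cpoly n D \<alpha> ^ s"
proof (induction s)
  case 0
  show ?case by (simp add: cpoly_def)
next
  case (Suc s)
  let ?f = "\<lambda>j. [:- (\<alpha> ^ (p ^ (n * j))), 1:]"
  have "?f (D * s + j) = ?f j" for j
  proof -
    have "\<alpha> ^ (p ^ (n * (D * s + j))) = (\<alpha> ^ (p ^ (n * D * s))) ^ (p ^ (n * j))"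
      by (simp add: distrib_left mult.assoc power_add power_mult)
    then show ?thesis using assms by (simp add: frob_iter)
  qed
  then have "(\<Prod>j<D * s + D. ?f j) = (\<Prod>j<D * s. ?f j) * (\<Prod>j<D. ?f j)"
    unfolding prod_lessThan_add by simp
  moreover have "D * Suc s = D * s + D" by simp
  ultimately show ?case using Suc unfolding cpoly_def by (metis power_Suc2)
qed

text \<open>\<open>cpoly n (odeg n \<alpha>) \<alpha>\<close> plays the role of the minimal
  polynomial: its roots are the distinct conjugates of \<alpha>, all of the same order in
  \<open>P\<close>.\<close>

lemma cpoly_odeg_dvd_iff:
  assumes "\<alpha> \<in> FF (n * r0)" "r0 > 0" "P \<in> PO n" "P \<noteq> 0"
  shows "cpoly n (odeg n \<alpha>) \<alpha> ^ s dvd P \<longleftrightarrow> s \<le> order \<alpha> P"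
proof
  let ?D = "odeg n \<alpha>"
  assume "cpoly n ?D \<alpha> ^ s dvd P"
  moreover have "[:- \<alpha>, 1:] dvd cpoly n ?D \<alpha>"
    using cpoly_root odeg(1)[OF assms(1,2)] poly_eq_0_iff_dvd by blast
  ultimately have "[:- \<alpha>, 1:] ^ s dvd P" by (meson dvd_power_same dvd_trans)
  then show "s \<le> order \<alpha> P" using assms(4) by (simp add: order_divides)
next
  let ?D = "odeg n \<alpha>"
  assume s: "s \<le> order \<alpha> P"
  have "cpoly n ?D \<alpha> ^ s = (\<Prod>j<?D. [:- (\<alpha> ^ (p ^ (n * j))), 1:] ^ s)"
    by (simp add: cpoly_def prod_power_distrib)
  also have "\<dots> = (\<Prod>z\<in>(\<lambda>j. \<alpha> ^ (p ^ (n * j))) ` {..<?D}. [:- z, 1:] ^ s)"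
    by (subst prod.reindex[OF odeg_inj[OF assms(1,2)]]) simp
  also have "\<dots> dvd P"
    by (rule prod_linear_power_dvd) (use assms s in \<open>auto simp: order_frob_iter\<close>)
  finally show "cpoly n ?D \<alpha> ^ s dvd P" .
qed

text \<open>Every root \<open>\<alpha>\<close> of \<open>P\<close> is thus counted with its multiplicity by the pairs \<open>(r, \<alpha>)\<close> with
  \<open>cpoly n r \<alpha>\<close> dividing \<open>P\<close>; this replaces unique factorization in the Euler product.\<close>

lemma card_cpoly_dvd:
  assumes "P \<in> PO n" "P \<noteq> 0" "poly P \<alpha> = 0" "n > 0"
  shows "card {r. r > 0 \<and> \<alpha> \<in> FF (n * r) \<and> cpoly n r \<alpha> dvd P} = order \<alpha> P"
proof -
  obtain r0 where r0: "r0 > 0" "\<alpha> \<in> FF (n * r0)" using roots_in_FF[OF assms] by blast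
  let ?D = "odeg n \<alpha>"
  note D = odeg[OF r0(2,1)]
  have "{r. r > 0 \<and> \<alpha> \<in> FF (n * r) \<and> cpoly n r \<alpha> dvd P} = (\<lambda>s. ?D * s) ` {1..order \<alpha> P}"
  proof (intro set_eqI iffI)
    fix r assume r: "r \<in> {r. r > 0 \<and> \<alpha> \<in> FF (n * r) \<and> cpoly n r \<alpha> dvd P}"
    then obtain s where s: "r = ?D * s" using D by blast
    then have "cpoly n ?D \<alpha> ^ s dvd P" using r cpoly_power[OF D(2)] by simp
    then have "s \<le> order \<alpha> P" using cpoly_odeg_dvd_iff[OF r0(2,1) assms(1,2)] by blast
    then show "r \<in> (\<lambda>s. ?D * s) ` {1..order \<alpha> P}" using r s by (auto intro!: imageI)
  next
    fix r assume "r \<in> (\<lambda>s. ?D * s) ` {1..order \<alpha> P}"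
    then obtain s where s: "r = ?D * s" "1 \<le> s" "s \<le> order \<alpha> P" by fastforce
    then have "cpoly n r \<alpha> dvd P" using cpoly_odeg_dvd_iff[OF r0(2,1) assms(1,2)] cpoly_power[OF D(2)] by simp
    then show "r \<in> {r. r > 0 \<and> \<alpha> \<in> FF (n * r) \<and> cpoly n r \<alpha> dvd P}"
      using s D by auto
  qed
  moreover have "inj_on (\<lambda>s. ?D * s) {1..order \<alpha> P}" using D(1) by (auto simp: inj_on_def)
  ultimately show ?thesis by (simp add: card_image)
qed

section \<open>Monic polynomials and the Euler product in coefficient form\<close>

definition MP :: "nat \<Rightarrow> nat \<Rightarrow> 'k poly set" where
  "MP n k = {P \<in> PO n. lead_coeff P = 1 \<and> degree P = k}"

lemma finite_MP: "n > 0 \<Longrightarrow> finite (MP n k)"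
  by (rule finite_subset[OF _ card_PD(2)[of n "Suc k"]]) (auto simp: MP_def PD_iff_degree)

lemma MP_0: "MP n 0 = {1}"
  by (auto simp: MP_def elim!: degree_eq_zeroE)

lemma cpoly_MP: "\<alpha> \<in> FF (n * r) \<Longrightarrow> cpoly n r \<alpha> \<in> MP n r"
  using cpoly_lead[of n r \<alpha>] by (simp add: MP_def cpoly_PO)

lemma MP_mult: "P \<in> MP n a \<Longrightarrow> Q \<in> MP n b \<Longrightarrow> P * Q \<in> MP n (a + b)"
proof -
  assume a: "P \<in> MP n a" "Q \<in> MP n b"
  then have "P \<noteq> 0" "Q \<noteq> 0" by (auto simp: MP_def)
  then show ?thesis using a lead_coeff_mult[of P Q]
    by (auto simp: MP_def PO_mult degree_mult_eq)
qed

lemma MP_quotient: "C \<in> MP n r \<Longrightarrow> C * Q \<in> MP n k \<Longrightarrow> r \<le> k \<and> Q \<in> MP n (k - r)"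
proof -
  assume a: "C \<in> MP n r" "C * Q \<in> MP n k"
  then have nz: "C \<noteq> 0" "Q \<noteq> 0" by (auto simp: MP_def)
  then show ?thesis using a PO_quotient[of C Q n] lead_coeff_mult[of C Q]
    by (auto simp: MP_def degree_mult_eq)
qed

text \<open>This is \<open>u L' = L * (sum of S_r u ^ r)\<close> at \<open>u ^ k\<close>. Both sides
  sum \<open>\<xi> P\<close> over triples of a monic \<open>P\<close> of degree \<open>k\<close>, a
  root \<alpha> and an \<open>r\<close> such that \<open>cpoly n r \<alpha>\<close> divides
  \<open>P\<close>: a given \<open>P\<close> has \<open>k\<close> such pairs, and a given pair
  leaves a free monic cofactor of degree \<open>k - r\<close>.\<close>

lemma euler_identity:
  fixes \<xi> :: "'k poly \<Rightarrow> complex"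
  assumes n: "n > 0" and mult: "\<And>P Q a b. P \<in> MP n a \<Longrightarrow> Q \<in> MP n b \<Longrightarrow> \<xi> (P * Q) = \<xi> P * \<xi> Q"
  shows "of_nat k * (\<Sum>P\<in>MP n k. \<xi> P) =
    (\<Sum>r\<in>{1..k}. (\<Sum>\<alpha>\<in>FF (n * r). \<xi> (cpoly n r \<alpha>)) * (\<Sum>P\<in>MP n (k - r). \<xi> P))"
proof -
  let ?R = "\<lambda>P \<alpha>. {r. r > 0 \<and> \<alpha> \<in> FF (n * r) \<and> cpoly n r \<alpha> dvd P}"
  let ?A = "SIGMA P:MP n k. SIGMA \<alpha>:{z. poly P z = 0}. ?R P \<alpha>"
  let ?B = "SIGMA r:{1..k}. FF (n * r) \<times> MP n (k - r)"
  have nz: "P \<noteq> 0" if "P \<in> MP n k" for P k using that by (auto simp: MP_def)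
  have finR: "finite (?R P \<alpha>)" if "P \<noteq> 0" for P \<alpha>
    by (rule finite_subset[of _ "{..degree P}"]) (use that dvd_imp_degree_le[of _ P] cpoly_degree in fastforce)+
  have "of_nat k * (\<Sum>P\<in>MP n k. \<xi> P) = (\<Sum>P\<in>MP n k. \<Sum>\<alpha> | poly P \<alpha> = 0. \<Sum>r\<in>?R P \<alpha>. \<xi> P)"
    unfolding sum_distrib_left
  proof (rule sum.cong[OF refl])
    fix P assume P: "P \<in> MP n k"
    have "(\<Sum>\<alpha> | poly P \<alpha> = 0. \<Sum>r\<in>?R P \<alpha>. \<xi> P) = (\<Sum>\<alpha> | poly P \<alpha> = 0. of_nat (order \<alpha> P) * \<xi> P)"
      by (rule sum.cong[OF refl]) (use P nz n card_cpoly_dvd[of P n] in \<open>auto simp: MP_def\<close>)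
    also have "\<dots> = of_nat k * \<xi> P"
      using splitting(2)[OF nz[OF P]] P by (simp add: MP_def flip: sum_distrib_right of_nat_sum)
    finally show "of_nat k * \<xi> P = (\<Sum>\<alpha> | poly P \<alpha> = 0. \<Sum>r\<in>?R P \<alpha>. \<xi> P)" ..
  qed
  also have "\<dots> = (\<Sum>(P, \<alpha>, r)\<in>?A. \<xi> P)"
  proof -
    have "(\<Sum>P\<in>MP n k. \<Sum>\<alpha> | poly P \<alpha> = 0. \<Sum>r\<in>?R P \<alpha>. \<xi> P) =
        (\<Sum>P\<in>MP n k. \<Sum>(\<alpha>, r)\<in>(SIGMA \<alpha>:{z. poly P z = 0}. ?R P \<alpha>). \<xi> P)"
      by (intro sum.cong refl sum.Sigma ballI) (use finR nz poly_roots_finite in blast)+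
    also have "\<dots> = (\<Sum>(P, \<alpha>, r)\<in>?A. \<xi> P)"
      by (intro sum.Sigma ballI finite_SigmaI finite_MP n) (use finR nz poly_roots_finite in blast)+
    finally show ?thesis .
  qed
  also have "\<dots> = (\<Sum>(r, \<alpha>, Q)\<in>?B. \<xi> (cpoly n r \<alpha>) * \<xi> Q)"
  proof (rule sum.reindex_bij_witness[where i = "\<lambda>(r, \<alpha>, Q). (cpoly n r \<alpha> * Q, \<alpha>, r)"
        and j = "\<lambda>(P, \<alpha>, r). (r, \<alpha>, P div cpoly n r \<alpha>)"])
    fix a assume "a \<in> ?A"
    then obtain P \<alpha> r where a: "a = (P, \<alpha>, r)" and P: "P \<in> MP n k" "poly P \<alpha> = 0" "r > 0" "\<alpha> \<in> FF (n * r)"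
      "cpoly n r \<alpha> dvd P" by auto
    then obtain Q where Q: "P = cpoly n r \<alpha> * Q" by blast
    have Q': "P div cpoly n r \<alpha> = Q" by (simp add: Q)
    have M: "r \<le> k \<and> Q \<in> MP n (k - r)" using MP_quotient[OF cpoly_MP[OF P(4)]] P(1) Q by blast
    show "(case (case a of (P, \<alpha>, r) \<Rightarrow> (r, \<alpha>, P div cpoly n r \<alpha>)) of (r, \<alpha>, Q) \<Rightarrow> (cpoly n r \<alpha> * Q, \<alpha>, r)) = a"
      using a Q Q' by simp
    show "(case a of (P, \<alpha>, r) \<Rightarrow> (r, \<alpha>, P div cpoly n r \<alpha>)) \<in> ?B" using a M P Q' by auto
    show "(case (case a of (P, \<alpha>, r) \<Rightarrow> (r, \<alpha>, P div cpoly n r \<alpha>)) of (r, \<alpha>, Q) \<Rightarrow> \<xi> (cpoly n r \<alpha>) * \<xi> Q)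
       = (case a of (P, \<alpha>, r) \<Rightarrow> \<xi> P)"
      using a M Q Q' mult[OF cpoly_MP[OF P(4)], of Q "k - r"] by simp
  next
    fix b assume "b \<in> ?B"
    then obtain r \<alpha> Q where b: "b = (r, \<alpha>, Q)" and r: "1 \<le> r" "r \<le> k" "\<alpha> \<in> FF (n * r)" "Q \<in> MP n (k - r)" by auto
    show "(case (case b of (r, \<alpha>, Q) \<Rightarrow> (cpoly n r \<alpha> * Q, \<alpha>, r)) of (P, \<alpha>, r) \<Rightarrow> (r, \<alpha>, P div cpoly n r \<alpha>)) = b"
      using b by simp
    have "cpoly n r \<alpha> * Q \<in> MP n k" using MP_mult[OF cpoly_MP[OF r(3)] r(4)] r by simp
    then show "(case b of (r, \<alpha>, Q) \<Rightarrow> (cpoly n r \<alpha> * Q, \<alpha>, r)) \<in> ?A"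
      using b r by (auto simp: cpoly_root)
  qed
  also have "\<dots> = (\<Sum>r\<in>{1..k}. \<Sum>\<alpha>\<in>FF (n * r). \<Sum>Q\<in>MP n (k - r). \<xi> (cpoly n r \<alpha>) * \<xi> Q)"
  proof -
    have "(\<Sum>r\<in>{1..k}. \<Sum>\<alpha>\<in>FF (n * r). \<Sum>Q\<in>MP n (k - r). \<xi> (cpoly n r \<alpha>) * \<xi> Q) =
        (\<Sum>r\<in>{1..k}. \<Sum>(\<alpha>, Q)\<in>FF (n * r) \<times> MP n (k - r). \<xi> (cpoly n r \<alpha>) * \<xi> Q)"
      by (intro sum.cong refl sum.cartesian_product)
    also have "\<dots> = (\<Sum>(r, \<alpha>, Q)\<in>?B. \<xi> (cpoly n r \<alpha>) * \<xi> Q)"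
      by (intro sum.Sigma ballI finite_cartesian_product finite_MP n card_FF(2)) (use n in auto)
    finally show ?thesis ..
  qed
  also have "\<dots> = (\<Sum>r\<in>{1..k}. (\<Sum>\<alpha>\<in>FF (n * r). \<xi> (cpoly n r \<alpha>)) * (\<Sum>P\<in>MP n (k - r). \<xi> P))"
    by (simp only: sum_product)
  finally show ?thesis .
qed

end

section \<open>Partial fractions and the L-function as a power series\<close>

context ffield
begin

section \<open>Products of linear factors, division and interpolation\<close>

definition PZ :: "'k set \<Rightarrow> 'k poly" where "PZ S = (\<Prod>z\<in>S. [:- z, 1:])"

lemma PZ_lead [simp]: "lead_coeff (PZ S) = 1"
  unfolding PZ_def lead_coeff_prod by simp

lemma PZ_nz [simp]: "PZ S \<noteq> 0"
  using PZ_lead[of S] by force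

lemma PZ_degree [simp]: "degree (PZ S) = card S"
  unfolding PZ_def by (subst degree_prod_eq_sum_degree) auto

lemma PZ_poly: "poly (PZ S) x = (\<Prod>z\<in>S. x - z)"
  by (simp add: PZ_def poly_prod)

lemma PZ_root: "finite S \<Longrightarrow> poly (PZ S) x = 0 \<longleftrightarrow> x \<in> S"
  by (auto simp: PZ_poly)

lemma PZ_insert: "finite S \<Longrightarrow> z \<notin> S \<Longrightarrow> PZ (insert z S) = [:- z, 1:] * PZ S"
  unfolding PZ_def by (rule prod.insert)

lemma PZ_union: "finite S \<Longrightarrow> finite T \<Longrightarrow> S \<inter> T = {} \<Longrightarrow> PZ (S \<union> T) = PZ S * PZ T"
  unfolding PZ_def by (rule prod.union_disjoint)

lemma PZ_remove: "finite S \<Longrightarrow> z \<in> S \<Longrightarrow> PZ S = [:- z, 1:] * PZ (S - {z})"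
  using PZ_insert[of "S - {z}" z] by (simp only: insert_Diff) auto

lemma PZ_pderiv: assumes "finite S" "z \<in> S" shows "poly (pderiv (PZ S)) z = poly (PZ (S - {z})) z"
  by (simp only: PZ_remove[OF assms] pderiv_mult poly_add poly_mult) (simp add: pderiv_pCons)

lemma PZ_pderiv_nz: "finite S \<Longrightarrow> z \<in> S \<Longrightarrow> poly (pderiv (PZ S)) z \<noteq> 0"
  by (simp add: PZ_pderiv PZ_root)

lemma PZ_dvd: assumes "finite S" "\<And>z. z \<in> S \<Longrightarrow> poly P z = 0" shows "PZ S dvd P"
proof (cases "P = 0")
  case False
  then have "(\<Prod>z\<in>S. [:- z, 1:] ^ 1) dvd P"
    by (intro prod_linear_power_dvd) (use assms in \<open>auto simp: Suc_le_eq order_gt_0_iff\<close>)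
  then show ?thesis by (simp add: PZ_def)
qed simp

lemma PZ_PO: assumes "bij_betw (\<lambda>z. z ^ (p ^ n)) S S" shows "PZ S \<in> PO n"
  unfolding PO_iff PZ_def frobp_prod frobp_linear
  using prod.reindex_bij_betw[OF assms, of "\<lambda>z. [:- z, 1:]"] by simp

text \<open>Frobenius on coefficients turns the division of \<open>A\<close> by \<open>G\<close>
  into another division of \<open>A\<close> by \<open>G\<close>; uniqueness makes the quotient
  rational.\<close>

lemma PO_div: assumes "A \<in> PO n" "G \<in> PO n" "G \<noteq> 0" shows "A div G \<in> PO n"
proof -
  have hmod: "A mod G = 0 \<or> degree (A mod G) < degree G"
    using degree_mod_less assms(3) by blast
  have eq: "G * frobp n (A div G) + frobp n (A mod G) = G * (A div G) + A mod G"
  proof -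
    have "A = G * (A div G) + A mod G" by simp
    then have "frobp n A = frobp n (G * (A div G) + A mod G)" by simp
    also have "\<dots> = frobp n (G * (A div G)) + frobp n (A mod G)"
      by (rule poly_eqI) (simp only: coeff_frobp coeff_add frob_add)
    finally show ?thesis using assms by (simp add: PO_iff frobp_mult)
  qed
  have deg: "frobp n (A mod G) = 0 \<or> degree (frobp n (A mod G)) < degree G"
    using hmod degree_map_poly[of "\<lambda>x. x ^ (p ^ n)" "A mod G"] by (auto simp: frobp_def)
  have dd: "degree (A mod G - frobp n (A mod G)) < degree G \<or> A mod G - frobp n (A mod G) = 0"
  proof (cases "degree G = 0")
    case True then show ?thesis using deg hmod by auto
  next
    case False
    then have "degree (A mod G) < degree G" "degree (frobp n (A mod G)) < degree G" using deg hmod by auto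
    then show ?thesis using degree_diff_less by blast
  qed
  have "G * (frobp n (A div G) - A div G) = A mod G - frobp n (A mod G)"
    using eq by (simp add: algebra_simps)
  then have "frobp n (A div G) - A div G = 0"
    using dd degree_mult_eq[OF assms(3), of "frobp n (A div G) - A div G"] assms(3)
    by (metis le_add1 mult_eq_0_iff not_le)
  then show ?thesis by (simp add: PO_iff)
qed

lemma PO_mod: assumes "A \<in> PO n" "G \<in> PO n" "G \<noteq> 0" shows "A mod G \<in> PO n"
proof -
  have "A - G * (A div G) \<in> PO n" using assms by (intro PO_diff PO_mult PO_div)
  then show ?thesis by (simp add: minus_mult_div_eq_mod)
qed

lemma lagrange:
  assumes "finite S" "B = 0 \<or> degree B < card S"
  shows "B = (\<Sum>z\<in>S. smult (poly B z / poly (pderiv (PZ S)) z) (PZ (S - {z})))" (is "_ = ?R")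
proof (cases "S = {}")
  case True
  then show ?thesis using assms by auto
next
  case ne: False
  show ?thesis
  proof (rule poly_eqI_degree[where A = S])
    fix w assume w: "w \<in> S"
    have "poly ?R w = (\<Sum>z\<in>S. poly B z / poly (pderiv (PZ S)) z * poly (PZ (S - {z})) w)"
      by (simp add: poly_sum)
    also have "\<dots> = (\<Sum>z\<in>S. if z = w then poly B w else 0)"
    proof (rule sum.cong[OF refl])
      fix z assume z: "z \<in> S"
      show "poly B z / poly (pderiv (PZ S)) z * poly (PZ (S - {z})) w = (if z = w then poly B w else 0)"
      proof (cases "z = w")
        case True
        then show ?thesis using PZ_pderiv_nz[OF assms(1) w] PZ_pderiv[OF assms(1) w] by simp
      next
        case False
        then have "poly (PZ (S - {z})) w = 0" using w assms(1) by (simp add: PZ_root)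
        then show ?thesis using False by simp
      qed
    qed
    also have "\<dots> = poly B w" using w assms(1) by simp
    finally show "poly B w = poly ?R w" ..
  next
    show "degree B < card S" using assms ne by (auto simp: card_gt_0_iff)
    have "degree ?R \<le> card S - 1"
      by (rule degree_sum_le) (use assms(1) in \<open>auto intro: order.trans[OF degree_smult_le]\<close>)
    moreover have "card S > 0" using ne assms(1) by (simp add: card_gt_0_iff)
    ultimately show "degree ?R < card S" by linarith
  qed
qed

text \<open>The residues of \<open>B / PZ S\<close> at finite points balance the one at infinity.
  Concretely, coefficients of index \<open>card S - 1\<close> are compared in the Lagrange form,
  whose cofactors are monic of exactly that degree.\<close>

lemma euler_sum:
  assumes "finite S" "B = 0 \<or> degree B < card S"
  shows "(\<Sum>z\<in>S. poly B z / poly (pderiv (PZ S)) z) = coeff B (card S - 1)"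
proof -
  have c: "coeff (PZ (S - {z})) (card S - 1) = 1" if "z \<in> S" for z
    using PZ_lead[of "S - {z}"] that assms(1) by (simp del: PZ_lead)
  have "coeff B (card S - 1) = coeff (\<Sum>z\<in>S. smult (poly B z / poly (pderiv (PZ S)) z) (PZ (S - {z}))) (card S - 1)"
    using lagrange[OF assms] by simp
  also have "\<dots> = (\<Sum>z\<in>S. poly B z / poly (pderiv (PZ S)) z)"
    unfolding coeff_sum by (rule sum.cong) (simp_all only: coeff_smult c mult_1_right)
  finally show ?thesis ..
qed

lemma partial_fractions:
  assumes "finite S" "B = 0 \<or> degree B < card S" "x \<notin> S"
  shows "poly B x / poly (PZ S) x = (\<Sum>z\<in>S. poly B z / poly (pderiv (PZ S)) z / (x - z))"
proof -
  have nz: "poly (PZ S) x \<noteq> 0" using assms by (simp add: PZ_root)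
  have "poly B x = (\<Sum>z\<in>S. poly B z / poly (pderiv (PZ S)) z * poly (PZ (S - {z})) x)"
    by (subst lagrange[OF assms(1,2)]) (simp add: poly_sum)
  also have "\<dots> = (\<Sum>z\<in>S. poly B z / poly (pderiv (PZ S)) z / (x - z) * poly (PZ S) x)"
  proof (rule sum.cong[OF refl])
    fix z assume z: "z \<in> S"
    have "poly (PZ S) x = (x - z) * poly (PZ (S - {z})) x"
      by (subst PZ_remove[OF assms(1) z]) (simp add: algebra_simps)
    moreover have "x - z \<noteq> 0" using z assms(3) by auto
    ultimately show "poly B z / poly (pderiv (PZ S)) z * poly (PZ (S - {z})) x
        = poly B z / poly (pderiv (PZ S)) z / (x - z) * poly (PZ S) x" by simp
  qed
  also have "\<dots> = (\<Sum>z\<in>S. poly B z / poly (pderiv (PZ S)) z / (x - z)) * poly (PZ S) x"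
    by (simp only: sum_distrib_right)
  finally show ?thesis using nz by (metis nonzero_mult_div_cancel_right)
qed

section \<open>Sums of a function over the roots of a polynomial\<close>

lemma poly_split_induct [consumes 1, case_names const linear]:
  assumes "(P::'k poly) \<noteq> 0" "\<And>c. c \<noteq> 0 \<Longrightarrow> Q [:c:]" "\<And>a P. P \<noteq> 0 \<Longrightarrow> Q P \<Longrightarrow> Q ([:- a, 1:] * P)"
  shows "Q P"
  using assms(1)
proof (induction "degree P" arbitrary: P)
  case 0
  then obtain c where "P = [:c:]" by (metis degree_eq_zeroE)
  then show ?case using 0 assms(2) by auto
next
  case (Suc k)
  then obtain x where "poly P x = 0" using has_root[of P] by auto
  then obtain R where R: "P = [:- x, 1:] * R" using poly_eq_0_iff_dvd by blast
  then have "R \<noteq> 0" using Suc by auto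
  moreover from this have "degree P = Suc (degree R)" unfolding R by (subst degree_mult_eq) auto
  ultimately have "Q R" using Suc by auto
  then show ?case unfolding R by (rule assms(3)[OF \<open>R \<noteq> 0\<close>])
qed

text \<open>Additive in \<open>P\<close>, so composing with an additive character gives a
  multiplicative one. On \<open>cpoly n r \<alpha>\<close> it is the relative trace of
  \<open>\<phi> \<alpha>\<close> if \<open>\<phi>\<close> commutes with Frobenius. Multiplicities
  count modulo \<open>p\<close>.\<close>

definition RS :: "('k \<Rightarrow> 'k) \<Rightarrow> 'k poly \<Rightarrow> 'k" where
  "RS \<phi> P = (\<Sum>z | poly P z = 0. of_nat (order z P) * \<phi> z)"

lemma RS_superset: assumes "P \<noteq> 0" "finite A" "{z. poly P z = 0} \<subseteq> A"
  shows "RS \<phi> P = (\<Sum>z\<in>A. of_nat (order z P) * \<phi> z)"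
  unfolding RS_def by (rule sum.mono_neutral_left) (use assms in \<open>auto simp: order_root\<close>)

lemma RS_mult: assumes "P \<noteq> 0" "Q \<noteq> 0" shows "RS \<phi> (P * Q) = RS \<phi> P + RS \<phi> Q"
proof -
  let ?A = "{z. poly P z = 0} \<union> {z. poly Q z = 0}"
  have fin: "finite ?A" using assms poly_roots_finite by blast
  have nz: "P * Q \<noteq> 0" using assms by simp
  have "RS \<phi> (P * Q) = (\<Sum>z\<in>?A. of_nat (order z (P * Q)) * \<phi> z)"
    by (rule RS_superset) (use nz fin in auto)
  also have "\<dots> = (\<Sum>z\<in>?A. of_nat (order z P) * \<phi> z) + (\<Sum>z\<in>?A. of_nat (order z Q) * \<phi> z)"
    by (simp add: order_mult[OF nz] distrib_right sum.distrib)
  also have "\<dots> = RS \<phi> P + RS \<phi> Q"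
    using RS_superset[OF assms(1) fin] RS_superset[OF assms(2) fin] by auto
  finally show ?thesis .
qed

lemma RS_const [simp]: "c \<noteq> 0 \<Longrightarrow> RS \<phi> [:c:] = 0"
  by (simp add: RS_def)

lemma RS_linear: "RS \<phi> [:- a, 1:] = \<phi> a"
proof -
  have "{z. poly [:- a, 1:] z = 0} = {a}" by auto
  then show ?thesis using order_power_n_n[of a 1] by (simp add: RS_def)
qed

lemma RS_cpoly: "RS \<phi> (cpoly n r \<alpha>) = (\<Sum>j<r. \<phi> (\<alpha> ^ (p ^ (n * j))))"
proof (induction r)
  case 0
  show ?case using RS_const[of 1] by (simp add: cpoly_def one_pCons)
next
  case (Suc r)
  have "cpoly n (Suc r) \<alpha> = cpoly n r \<alpha> * [:- (\<alpha> ^ (p ^ (n * r))), 1:]"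
    unfolding cpoly_def by (simp only: prod.lessThan_Suc)
  moreover have "[:- (\<alpha> ^ (p ^ (n * r))), 1:] \<noteq> 0" by simp
  ultimately show ?case using Suc RS_mult[OF cpoly_nz, of "[:- (\<alpha> ^ (p ^ (n * r))), 1:]" \<phi> n r \<alpha>] RS_linear by (metis sum.lessThan_Suc)
qed

lemma RS_logderiv: "P \<noteq> 0 \<Longrightarrow> poly P x \<noteq> 0 \<Longrightarrow> RS (\<lambda>z. 1 / (x - z)) P = poly (pderiv P) x / poly P x"
proof (induction P rule: poly_split_induct)
  case (linear a P)
  have nz: "[:- a, 1:] \<noteq> 0" by simp
  have x: "x - a \<noteq> 0" "poly P x \<noteq> 0" using linear by auto
  have "poly (pderiv ([:- a, 1:] * P)) x = (x - a) * poly (pderiv P) x + poly P x"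
    by (simp only: pderiv_mult poly_add poly_mult) (simp add: pderiv_pCons algebra_simps)
  moreover have "poly ([:- a, 1:] * P) x = (x - a) * poly P x" by (simp add: algebra_simps)
  ultimately show ?case using x linear
    by (simp only: RS_mult[OF nz linear(1)] RS_linear) (simp add: field_simps)
qed (simp add: pderiv_pCons)

lemma RS_ident: "P \<noteq> 0 \<Longrightarrow> degree P > 0 \<Longrightarrow> RS (\<lambda>z. z) P = - coeff P (degree P - 1) / lead_coeff P"
proof (induction P rule: poly_split_induct)
  case (linear a P)
  have nz: "[:- a, 1:] \<noteq> 0" by simp
  have deg: "degree ([:- a, 1:] * P) = Suc (degree P)" using linear(1) by (subst degree_mult_eq) auto
  have lc: "lead_coeff ([:- a, 1:] * P) = lead_coeff P" by (simp only: lead_coeff_mult) simp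
  have lcnz: "lead_coeff P \<noteq> 0" using linear(1) by simp
  have "coeff ([:- a, 1:] * P) (degree P) = - a * lead_coeff P + (if degree P = 0 then 0 else coeff P (degree P - 1))"
    by (cases "degree P") (auto simp: coeff_pCons)
  moreover have "RS (\<lambda>z. z) P = (if degree P = 0 then 0 else - coeff P (degree P - 1) / lead_coeff P)"
    using linear by (auto elim!: degree_eq_zeroE)
  moreover have "degree ([:- a, 1:] * P) - 1 = degree P" using deg by simp
  ultimately show ?case
    unfolding lc RS_mult[OF nz linear(1)] RS_linear using lcnz by (simp add: field_simps del: mult_pCons_left)
qed auto

lemma RS_constfun: "P \<noteq> 0 \<Longrightarrow> RS (\<lambda>z. c) P = of_nat (degree P) * c"
  using splitting(2)[of P] by (simp add: RS_def flip: sum_distrib_right of_nat_sum)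

lemma RS_add: "RS (\<lambda>z. \<phi> z + \<theta> z) P = RS \<phi> P + RS \<theta> P"
  by (simp add: RS_def distrib_left sum.distrib)

lemma RS_scale: "RS (\<lambda>z. c * \<phi> z) P = c * RS \<phi> P"
  by (simp add: RS_def sum_distrib_left mult_ac)

lemma RS_sum: "RS (\<lambda>z. \<Sum>i\<in>A. \<phi> i z) P = (\<Sum>i\<in>A. RS (\<phi> i) P)"
  unfolding RS_def sum_distrib_left by (rule sum.swap)

lemma RS_cong: "(\<And>z. poly P z = 0 \<Longrightarrow> \<phi> z = \<theta> z) \<Longrightarrow> RS \<phi> P = RS \<theta> P"
  by (simp add: RS_def)

lemma frob_bij_roots:
  assumes "P \<in> PO n" "P \<noteq> 0" shows "bij_betw (\<lambda>z. z ^ (p ^ n)) {z. poly P z = 0} {z. poly P z = 0}"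
  unfolding bij_betw_def
proof
  let ?A = "{z. poly P z = 0}"
  show inj: "inj_on (\<lambda>z. z ^ (p ^ n)) ?A" by (auto simp: inj_on_def frob_inj)
  show "(\<lambda>z. z ^ (p ^ n)) ` ?A = ?A"
    by (rule endo_inj_surj[OF poly_roots_finite[OF assms(2)] _ inj])
      (use assms pm_pos in \<open>auto simp: PO_poly_frob\<close>)
qed

lemma sum_frob_FF:
  assumes "bij_betw (\<lambda>z. z ^ (p ^ n)) S S" "\<And>z. z \<in> S \<Longrightarrow> \<phi> (z ^ (p ^ n)) = \<phi> z ^ (p ^ n)"
  shows "(\<Sum>z\<in>S. \<phi> z) \<in> FF n"
proof -
  have "(\<Sum>z\<in>S. \<phi> z) ^ (p ^ n) = (\<Sum>z\<in>S. \<phi> (z ^ (p ^ n)))" using assms(2) by (simp add: frob_sum)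
  also have "\<dots> = (\<Sum>z\<in>S. \<phi> z)" by (rule sum.reindex_bij_betw[OF assms(1)])
  finally show ?thesis by (simp add: FF_iff)
qed

lemma RS_FF:
  assumes "P \<in> PO n" "P \<noteq> 0" "\<And>z. poly P z = 0 \<Longrightarrow> \<phi> (z ^ (p ^ n)) = \<phi> z ^ (p ^ n)"
  shows "RS \<phi> P \<in> FF n"
  unfolding RS_def
proof (rule sum_frob_FF[OF frob_bij_roots[OF assms(1,2)]])
  fix z assume "z \<in> {z. poly P z = 0}"
  moreover have "of_nat (order z P) ^ (p ^ n) = (of_nat (order z P) :: 'k)" using FF_of_nat FF_iff by blast
  ultimately show "of_nat (order (z ^ (p ^ n)) P) * \<phi> (z ^ (p ^ n)) = (of_nat (order z P) * \<phi> z) ^ (p ^ n)"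
    using assms by (simp add: order_frob power_mult_distrib)
qed

end

text \<open>In characteristic 0 the equation \<open>F' = F * B\<close> is a recursion for the
  coefficients, so the logarithmic derivative and the constant term determine the series.\<close>

lemma fps_deriv_unique:
  fixes F G B :: "complex fps"
  assumes "fps_deriv F = F * B" "fps_deriv G = G * B" "fps_nth F 0 = fps_nth G 0"
  shows "F = G"
proof (rule fps_ext)
  fix k show "fps_nth F k = fps_nth G k"
  proof (induction k rule: less_induct)
    case (less k)
    show ?case
    proof (cases k)
      case (Suc m)
      have "of_nat k * fps_nth F k = fps_nth (fps_deriv F) m" by (simp add: Suc)
      also have "\<dots> = (\<Sum>i=0..m. fps_nth F i * fps_nth B (m - i))" by (simp add: assms fps_mult_nth)
      also have "\<dots> = (\<Sum>i=0..m. fps_nth G i * fps_nth B (m - i))"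
        by (rule sum.cong) (use less Suc in auto)
      also have "\<dots> = fps_nth (fps_deriv G) m" by (simp add: assms fps_mult_nth)
      also have "\<dots> = of_nat k * fps_nth G k" by (simp add: Suc)
      finally show ?thesis using Suc by (simp del: of_nat_Suc)
    qed (use assms in auto)
  qed
qed

text \<open>Only the denominator is fixed here, since the average runs over numerators;
  \<open>ordAS\<close> adds one. Squarefreeness over \<open>FF n\<close> appears as simplicity of
  the roots in the closure (justified by \<open>simple_of_sqfree\<close>), and
  \<open>d \<ge> 2\<close> provides a finite pole.\<close>

locale ordg = ffield_char p K \<psi> for p :: nat and K :: "'k::field itself" and \<psi> +
  fixes n d :: nat and g :: "'k poly"
  assumes n_pos: "n > 0" and d_ge: "d \<ge> 2" and g_PO: "g \<in> PO n" and g_lead: "lead_coeff g = 1"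
    and g_deg: "degree g = d \<or> degree g = d - 1"
    and g_simple: "\<And>z. poly g z = 0 \<Longrightarrow> poly (pderiv g) z \<noteq> 0"
begin

definition Z where "Z = {z. poly g z = 0}"

lemma g_nz: "g \<noteq> 0" using g_lead by auto

lemma finite_Z: "finite Z" unfolding Z_def by (rule poly_roots_finite[OF g_nz])

lemma g_eq: "g = PZ Z" and card_Z: "card Z = degree g"
proof -
  have o: "order z g = 1" if "poly g z = 0" for z using that g_simple order_eq_1 by blast
  show "g = PZ Z" unfolding PZ_def Z_def by (rule splitting_simple(1)[OF g_lead o])
  show "card Z = degree g" unfolding Z_def using splitting_simple(2)[OF g_lead o] by simp
qed

lemma Z_iff: "z \<in> Z \<longleftrightarrow> poly g z = 0" by (simp add: Z_def)

lemma Z_nonempty: "Z \<noteq> {}" using card_Z g_deg d_ge by auto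

lemma frob_Z: "bij_betw (\<lambda>z. z ^ (p ^ n)) Z Z"
  unfolding Z_def by (rule frob_bij_roots[OF g_PO g_nz])

lemma frob_Z_iff: "x ^ (p ^ n) \<in> Z \<longleftrightarrow> x \<in> Z"
  using pm_pos by (simp add: Z_iff PO_poly_frob[OF g_PO])

end

locale ordAS = ordg p K \<psi> n d g for p :: nat and K :: "'k::field itself" and \<psi> n d g +
  fixes h :: "'k poly"
  assumes h_PO: "h \<in> PO n" and h_Z: "\<And>z. poly g z = 0 \<Longrightarrow> poly h z \<noteq> 0"
    and h_deg: "(degree g = d \<and> degree h \<le> d) \<or> (degree g = d - 1 \<and> degree h = d)"
begin

text \<open>Division by zero gives the value 0 at the poles, which also commutes with Frobenius, so
  \<open>f_frob\<close> holds at every point.\<close>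

definition f where "f z = poly h z / poly g z"

lemma f_frob: "f (z ^ (p ^ n)) = f z ^ (p ^ n)"
  by (simp add: f_def PO_poly_frob[OF g_PO] PO_poly_frob[OF h_PO] power_divide)

lemma f_frob_iter: "f (z ^ (p ^ (n * j))) = f z ^ (p ^ (n * j))"
  by (simp add: f_def PO_poly_frob_iter[OF g_PO] PO_poly_frob_iter[OF h_PO] power_divide)

text \<open>The completely multiplicative character on monic polynomials whose Dirichlet series is the
  L-function, up to the Euler factor \<open>1 - winf u\<close> at infinity (\<open>winf = 0\<close> if \<open>f\<close> has a pole there).\<close>

definition xi where "xi P = (if \<exists>z. poly P z = 0 \<and> poly g z = 0 then 0 else chr n (RS f P))"

lemma RS_f_FF: "P \<in> MP n k \<Longrightarrow> RS f P \<in> FF n"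
  by (rule RS_FF) (auto simp: MP_def f_frob)

lemma xi_mult: assumes "P \<in> MP n a" "Q \<in> MP n b" shows "xi (P * Q) = xi P * xi Q"
proof -
  have "P \<noteq> 0" "Q \<noteq> 0" using assms by (auto simp: MP_def)
  then show ?thesis using assms by (auto simp: xi_def RS_mult chr_add RS_f_FF)
qed

text \<open>\<open>c + a x\<close> is the polynomial part of \<open>f\<close>. If
  \<open>degree g = d\<close>, then \<open>a = 0\<close> and \<open>c\<close> is the value at
  infinity; otherwise \<open>a \<noteq> 0\<close> and infinity is a simple pole.\<close>

definition c where "c = coeff (h div g) 0"
definition a where "a = coeff (h div g) 1"
definition winf where "winf = (if degree h \<le> degree g then chr n c else 0)"

lemma degree_hdiv: "degree (h div g) = degree h - degree g"
proof (cases "h div g = 0")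
  case True
  then have "h = h mod g" by (metis add_0 div_mult_mod_eq mult_zero_left)
  then have "h = 0 \<or> degree h < degree g" using degree_mod_less[OF g_nz, of h] by metis
  then show ?thesis using True by auto
next
  case False
  have "degree (g * (h div g)) = degree g + degree (h div g)" using False g_nz by (rule degree_mult_eq[rotated])
  moreover have "h mod g = 0 \<or> degree (h mod g) < degree g" using degree_mod_less g_nz by blast
  ultimately have "degree (g * (h div g) + h mod g) = degree g + degree (h div g)"
    by (metis add.right_neutral degree_add_eq_left le_add1 order_less_le_trans)
  then show ?thesis by simp
qed

lemma deg_quot: "h div g = [:c, a:]" "h = g * [:c, a:] + h mod g"
proof -
  have "degree (h div g) \<le> 1"
    using h_deg d_ge by (auto simp: degree_hdiv)
  then show "h div g = [:c, a:]" unfolding c_def a_def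
    by (intro poly_eqI) (auto simp: coeff_pCons coeff_eq_0 split: nat.split)
  then show "h = g * [:c, a:] + h mod g" by (metis mult_div_mod_eq)
qed

lemma hmod_deg: "h mod g = 0 \<or> degree (h mod g) < degree g"
  using degree_mod_less g_nz by blast

lemma coeff_hmod: "i \<ge> degree g \<Longrightarrow> coeff (h mod g) i = 0"
  using hmod_deg coeff_eq_0 by fastforce

lemma caseA: assumes "degree g = d" shows "a = 0" "c = coeff h (degree g)"
proof -
  have "degree h \<le> degree g" using h_deg assms d_ge by auto
  then have "degree (h div g) = 0" by (simp add: degree_hdiv)
  then show a: "a = 0" unfolding a_def by (simp add: coeff_eq_0)
  have "coeff (g * [:c, a:] + h mod g) (degree g) = c"
    using g_lead by (simp add: a coeff_hmod mult.commute)
  then show "c = coeff h (degree g)" using deg_quot(2) by metis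
qed

lemma caseB: assumes "degree g \<noteq> d" shows "a \<noteq> 0"
proof -
  have "degree h = Suc (degree g)" using h_deg assms d_ge by auto
  then have "degree (h div g) = 1" by (simp add: degree_hdiv)
  then show ?thesis unfolding a_def by (metis leading_coeff_0_iff degree_0 zero_neq_one)
qed

lemma caseA_iff: "degree g = d \<longleftrightarrow> degree h \<le> degree g"
  using h_deg d_ge by auto

lemma hdiv_PO: "h div g \<in> PO n" "h mod g \<in> PO n"
  using PO_div[OF h_PO g_PO g_nz] PO_mod[OF h_PO g_PO g_nz] by auto

lemma c_FF: "c \<in> FF n" and a_FF: "a \<in> FF n"
  unfolding c_def a_def by (intro PO_coeff hdiv_PO)+

text \<open>Phrased through \<open>xi\<close> to fit \<open>euler_identity\<close>;
  \<open>Sfin_alt\<close> identifies it with the affine part of the character sum.\<close>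

definition Sfin where "Sfin r = (\<Sum>\<alpha>\<in>FF (n * r). xi (cpoly n r \<alpha>))"

lemma Sfin_alt: assumes "r > 0"
  shows "Sfin r = (\<Sum>\<alpha>\<in>{\<alpha>\<in>FF (n * r). poly g \<alpha> \<noteq> 0}. \<psi> (tr p (n * r) (f \<alpha>)))"
proof -
  have x: "xi (cpoly n r \<alpha>) = (if poly g \<alpha> = 0 then 0 else \<psi> (tr p (n * r) (poly h \<alpha> / poly g \<alpha>)))" for \<alpha>
  proof (cases "poly g \<alpha> = 0")
    case True
    then show ?thesis using cpoly_root[OF assms] by (auto simp: xi_def)
  next
    case False
    have "\<not> (\<exists>z. poly (cpoly n r \<alpha>) z = 0 \<and> poly g z = 0)"
      using False by (auto simp: cpoly_def poly_prod PO_poly_frob_iter[OF g_PO])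
    then have "xi (cpoly n r \<alpha>) = chr n (Trq n r (f \<alpha>))"
      by (simp only: xi_def if_False RS_cpoly f_frob_iter Trq_def)
    then show ?thesis using False by (simp flip: chr_tower) (simp add: chr_def f_def)
  qed
  have fin: "finite (FF (n * r))" using n_pos assms by (simp add: card_FF)
  show ?thesis
    unfolding Sfin_def x f_def using fin by (intro sum.mono_neutral_cong_right) auto
qed

text \<open>As \<open>c\<close> lies in \<open>FF n\<close>, its relative trace is
  \<open>r * c\<close>; so the point at infinity contributes an \<open>r\<close>-th power, like an
  Euler factor of degree 1.\<close>

lemma char_sum_eq: assumes "r > 0" shows "char_sum p n \<psi> h g r = Sfin r + winf ^ r"
proof -
  have "winf ^ r = (if degree h \<le> degree g
        then \<psi> (tr p (n*r) (if degree h = degree g then lead_coeff h / lead_coeff g else 0)) else 0)"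
  proof (cases "degree h \<le> degree g")
    case True
    then have "c = coeff h (degree g)" using caseA caseA_iff by blast
    then have c: "c = (if degree h = degree g then lead_coeff h / lead_coeff g else 0)"
      using True g_lead by (auto simp: coeff_eq_0)
    have "c ^ (p ^ (n * j)) = c" for j using c_FF frob_iter by blast
    then have "Trq n r c = of_nat r * c" by (simp add: Trq_def)
    then have "\<psi> (tr p (n*r) c) = chr n c ^ r" using chr_tower[of n r c] chr_of_nat[OF c_FF] by (simp add: chr_def)
    then show ?thesis using True c by (simp add: winf_def)
  qed (use assms in \<open>simp add: winf_def\<close>)
  then show ?thesis using Sfin_alt[OF assms] by (simp add: char_sum_def f_def)
qed

definition M where "M k = (\<Sum>P\<in>MP n k. xi P)"
text \<open>Coefficient of the series of \<open>M\<close> divided by \<open>1 - winf u\<close>. If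
  \<open>winf = 0\<close>, the convention \<open>0 ^ 0 = 1\<close> leaves exactly
  \<open>M k\<close>.\<close>

definition Lk where "Lk k = (\<Sum>j\<le>k. M j * winf ^ (k - j))"

text \<open>Both series have constant term 1 and the same logarithmic derivative:
  \<open>euler_identity\<close> gives its affine part, a geometric series the part at
  infinity.\<close>

lemma L_fps_eq: "L_fps p n \<psi> h g = Abs_fps Lk"
proof -
  define A where "A = Abs_fps (\<lambda>r. if r = 0 then 0 else char_sum p n \<psi> h g r / of_nat r)"
  have dA: "fps_deriv A = Abs_fps (\<lambda>r. Sfin (Suc r)) + Abs_fps (\<lambda>r. winf ^ Suc r)"
    by (rule fps_ext) (simp add: A_def char_sum_eq del: of_nat_Suc)
  have 1: "fps_deriv (Abs_fps M) = Abs_fps M * Abs_fps (\<lambda>r. Sfin (Suc r))"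
  proof (rule fps_ext)
    fix k
    have "fps_nth (fps_deriv (Abs_fps M)) k = of_nat (Suc k) * M (Suc k)" by simp
    also have "\<dots> = (\<Sum>r\<in>{1..Suc k}. Sfin r * M (Suc k - r))"
      unfolding M_def Sfin_def by (rule euler_identity[OF n_pos xi_mult])
    also have "\<dots> = (\<Sum>i=0..k. M i * Sfin (Suc (k - i)))"
      by (rule sum.reindex_bij_witness[where i = "\<lambda>i. Suc k - i" and j = "\<lambda>r. Suc k - r"])
        (auto simp: Suc_diff_le)
    finally show "fps_nth (fps_deriv (Abs_fps M)) k = fps_nth (Abs_fps M * Abs_fps (\<lambda>r. Sfin (Suc r))) k"
      by (simp add: fps_mult_nth)
  qed
  define E where "E = Abs_fps (\<lambda>k. winf ^ k)"
  have 2: "fps_deriv E = E * Abs_fps (\<lambda>r. winf ^ Suc r)"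
  proof (rule fps_ext)
    fix k
    have "fps_nth (E * Abs_fps (\<lambda>r. winf ^ Suc r)) k = (\<Sum>i=0..k. winf ^ Suc k)"
      unfolding fps_mult_nth E_def
      by (intro sum.cong refl) (simp flip: power_add power_Suc)
    then show "fps_nth (fps_deriv E) k = fps_nth (E * Abs_fps (\<lambda>r. winf ^ Suc r)) k"
      by (simp add: E_def)
  qed
  have L: "Abs_fps Lk = Abs_fps M * E"
    by (rule fps_ext) (simp add: fps_mult_nth E_def Lk_def atLeast0AtMost)
  have "fps_deriv (Abs_fps Lk) = Abs_fps Lk * fps_deriv A"
    unfolding L fps_deriv_mult 1 2 dA by (simp add: algebra_simps)
  moreover have "fps_deriv (fps_exp 1 oo A) = (fps_exp 1 oo A) * fps_deriv A"
  proof -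
    have "fps_nth A 0 = 0" by (simp add: A_def)
    then show ?thesis by (simp add: fps_compose_deriv)
  qed
  moreover have "fps_nth (Abs_fps Lk) 0 = 1"
  proof -
    have "RS f 1 = 0" using RS_const[of 1 f] by (simp add: one_pCons)
    then show ?thesis by (simp add: Lk_def M_def MP_0 xi_def)
  qed
  moreover have "fps_nth (fps_exp 1 oo A) 0 = (1::complex)" by (simp add: A_def)
  ultimately have "fps_exp 1 oo A = Abs_fps Lk" using fps_deriv_unique by metis
  then show ?thesis by (simp add: L_fps_def A_def)
qed

end

section \<open>The L-function is a polynomial of degree 2d - 2\<close>

lemma coeff_mult_top:
  fixes A B :: "'a::comm_ring_1 poly"
  assumes "degree A \<le> i" "degree B \<le> j"
  shows "coeff (A * B) (i + j) = coeff A i * coeff B j"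
proof -
  have "coeff (A * B) (i + j) = (\<Sum>t\<le>i + j. coeff A t * coeff B (i + j - t))" by (rule coeff_mult)
  also have "\<dots> = (\<Sum>t\<in>{i}. coeff A t * coeff B (i + j - t))"
  proof (rule sum.mono_neutral_right; (intro ballI)?)
    fix t assume "t \<in> {..i + j} - {i}"
    then have "t > i \<or> i + j - t > j" by auto
    then show "coeff A t * coeff B (i + j - t) = 0" using assms by (auto simp: coeff_eq_0)
  qed auto
  finally show ?thesis by simp
qed

context ordAS
begin

text \<open>Residues of \<open>f\<close> at its finite poles, and the resulting formula for the argument of the character:
  the sum of \<open>f\<close> over the roots of \<open>P\<close> only involves \<open>P'/P\<close> at the poles. If \<open>f\<close> is regular at infinity,
  then \<open>a = 0\<close> and \<open>P\<close> is viewed as a form of degree \<open>k\<close>.\<close>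

definition b where "b \<gamma> = poly h \<gamma> / poly (pderiv g) \<gamma>"
definition Sg where "Sg P = (\<Sum>\<gamma>\<in>Z. b \<gamma> * poly (pderiv P) \<gamma> / poly P \<gamma>)"
definition EE where "EE k P = of_nat k * c - Sg P - a * coeff P (k - 1) / coeff P k"

lemma f_partial: assumes "z \<notin> Z" shows "f z = (\<Sum>\<gamma>\<in>Z. b \<gamma> / (z - \<gamma>)) + (c + a * z)"
proof -
  have gz: "poly g z \<noteq> 0" using assms by (simp add: Z_iff)
  have "poly h z = poly g z * (c + a * z) + poly (h mod g) z"
    by (subst deg_quot(2)) (simp add: algebra_simps)
  then have "f z = (c + a * z) + poly (h mod g) z / poly g z" using gz by (simp add: f_def field_simps)
  also have "poly (h mod g) z / poly g z = (\<Sum>\<gamma>\<in>Z. poly (h mod g) \<gamma> / poly (pderiv g) \<gamma> / (z - \<gamma>))"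
    using partial_fractions[OF finite_Z, of "h mod g" z] hmod_deg assms unfolding g_eq[symmetric] card_Z by blast
  also have "\<dots> = (\<Sum>\<gamma>\<in>Z. b \<gamma> / (z - \<gamma>))"
  proof (rule sum.cong[OF refl])
    fix \<gamma> assume "\<gamma> \<in> Z"
    then have "poly h \<gamma> = poly (h mod g) \<gamma>" by (subst deg_quot(2)) (simp add: Z_iff)
    then show "poly (h mod g) \<gamma> / poly (pderiv g) \<gamma> / (z - \<gamma>) = b \<gamma> / (z - \<gamma>)" by (simp add: b_def)
  qed
  finally show ?thesis by simp
qed

lemma RS_f: assumes "P \<noteq> 0" "\<forall>\<gamma>\<in>Z. poly P \<gamma> \<noteq> 0"
  shows "RS f P = of_nat (degree P) * c - Sg P + a * RS (\<lambda>z. z) P"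
proof -
  have "RS f P = RS (\<lambda>z. (\<Sum>\<gamma>\<in>Z. (- b \<gamma>) * (1 / (\<gamma> - z))) + (c + a * z)) P"
  proof (rule RS_cong)
    fix z assume "poly P z = 0"
    then have "z \<notin> Z" using assms(2) by auto
    moreover have "b \<gamma> / (z - \<gamma>) = (- b \<gamma>) * (1 / (\<gamma> - z))" for \<gamma>
      by (metis minus_diff_eq minus_divide_right mult_minus_left times_divide_eq_right mult.right_neutral)
    ultimately show "f z = (\<Sum>\<gamma>\<in>Z. (- b \<gamma>) * (1 / (\<gamma> - z))) + (c + a * z)"
      by (metis (no_types, lifting) f_partial sum.cong)
  qed
  also have "\<dots> = (\<Sum>\<gamma>\<in>Z. (- b \<gamma>) * RS (\<lambda>z. 1 / (\<gamma> - z)) P) + (of_nat (degree P) * c + a * RS (\<lambda>z. z) P)"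
    unfolding RS_add RS_sum RS_scale RS_constfun[OF assms(1)] ..
  also have "(\<Sum>\<gamma>\<in>Z. (- b \<gamma>) * RS (\<lambda>z. 1 / (\<gamma> - z)) P) = - Sg P"
    unfolding Sg_def sum_negf[symmetric] by (rule sum.cong) (use assms in \<open>auto simp: RS_logderiv\<close>)
  finally show ?thesis by simp
qed

text \<open>Leading coefficients are arbitrary because a shift by \<open>g * B\<close> can change
  them; by \<open>EE_smult\<close> each monic \<open>P\<close> is merely counted
  \<open>q - 1\<close> times. The condition on \<open>coeff P k\<close> says that \<open>P\<close>,
  as a form of degree \<open>k\<close>, does not vanish at a pole at infinity.\<close>

definition FK where "FK k = {P \<in> PD n (Suc k). (\<forall>\<gamma>\<in>Z. poly P \<gamma> \<noteq> 0) \<and> (degree g \<noteq> d \<longrightarrow> coeff P k \<noteq> 0)}"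

lemma FK_nz: "P \<in> FK k \<Longrightarrow> P \<noteq> 0"
  using Z_nonempty by (auto simp: FK_def)

lemma finite_FK: "finite (FK k)"
  unfolding FK_def using card_PD(2)[OF n_pos] by auto

lemma Sg_FF: assumes "P \<in> PO n" shows "Sg P \<in> FF n"
  unfolding Sg_def b_def
  by (rule sum_frob_FF[OF frob_Z])
    (simp add: PO_poly_frob assms PO_pderiv h_PO g_PO power_divide power_mult_distrib)

lemma EE_FF: assumes "P \<in> FK k" shows "EE k P \<in> FF n"
proof -
  have P: "P \<in> PO n" using assms by (simp add: FK_def PD_def)
  show ?thesis unfolding EE_def
    by (intro FF_diff FF_mult FF_divide FF_of_nat c_FF a_FF Sg_FF P PO_coeff[OF P])
qed

definition NK where "NK k = {P \<in> FK k. lead_coeff P = 1}"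

text \<open>If \<open>f\<close> is regular at infinity, a monic \<open>P\<close> of degree below
  \<open>k\<close> is a form with \<open>k - degree P\<close> zeros at infinity, each worth
  \<open>chr n c\<close>. These powers are the factors \<open>winf ^ (k - j)\<close> in
  \<open>Lk\<close>.\<close>

lemma Lk_NK: assumes "k > 0" shows "Lk k = (\<Sum>P\<in>NK k. chr n (EE k P))"
proof (cases "degree g = d")
  case True
  note A = caseA[OF True]
  have w: "winf = chr n c" using True caseA_iff by (simp add: winf_def)
  have fin: "finite (MP n j)" for j by (rule finite_MP[OF n_pos])
  have "Lk k = (\<Sum>j\<le>k. \<Sum>P\<in>MP n j. xi P * winf ^ (k - j))"
    by (simp add: Lk_def M_def sum_distrib_right)
  also have "\<dots> = (\<Sum>P\<in>(\<Union>j\<le>k. MP n j). xi P * winf ^ (k - degree P))"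
  proof -
    have "(\<Sum>P\<in>(\<Union>j\<le>k. MP n j). xi P * winf ^ (k - degree P)) = (\<Sum>j\<le>k. \<Sum>P\<in>MP n j. xi P * winf ^ (k - degree P))"
      by (rule sum.UNION_disjoint) (use fin in \<open>auto simp: MP_def\<close>)
    also have "\<dots> = (\<Sum>j\<le>k. \<Sum>P\<in>MP n j. xi P * winf ^ (k - j))"
      by (intro sum.cong refl) (auto simp: MP_def)
    finally show ?thesis ..
  qed
  also have "\<dots> = (\<Sum>P\<in>NK k. chr n (EE k P))"
  proof (rule sum.mono_neutral_cong_right)
    show "finite (\<Union>j\<le>k. MP n j)" using fin by auto
    show "NK k \<subseteq> (\<Union>j\<le>k. MP n j)" by (auto simp: NK_def FK_def PD_iff_degree MP_def)
    show "\<forall>P\<in>(\<Union>j\<le>k. MP n j) - NK k. xi P * winf ^ (k - degree P) = 0"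
      using True by (auto simp: NK_def FK_def PD_iff_degree MP_def xi_def Z_iff)
    fix P assume P: "P \<in> NK k"
    then have P': "P \<noteq> 0" "\<forall>\<gamma>\<in>Z. poly P \<gamma> \<noteq> 0" "degree P \<le> k" "P \<in> PO n" "lead_coeff P = 1"
      using FK_nz by (auto simp: NK_def FK_def PD_iff_degree)
    then have "xi P = chr n (of_nat (degree P) * c - Sg P)"
      using RS_f[OF P'(1,2)] A by (auto simp: xi_def Z_iff)
    then have "xi P * winf ^ (k - degree P) = chr n ((of_nat (degree P) * c - Sg P) + of_nat (k - degree P) * c)"
      unfolding w by (subst chr_add) (auto intro: FF_diff FF_mult FF_of_nat c_FF Sg_FF P' simp: chr_of_nat c_FF)
    also have "(of_nat (degree P) * c - Sg P) + of_nat (k - degree P) * c = EE k P"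
    proof -
      have "(of_nat k::'k) = of_nat (degree P) + of_nat (k - degree P)" using P'(3) by (simp flip: of_nat_add)
      then show ?thesis using A by (simp add: EE_def algebra_simps)
    qed
    finally show "xi P * winf ^ (k - degree P) = chr n (EE k P)" .
  qed
  finally show ?thesis .
next
  case False
  have w: "winf = 0" using False caseA_iff by (simp add: winf_def)
  have "Lk k = (\<Sum>j\<in>{k}. M j * winf ^ (k - j))"
    unfolding Lk_def by (rule sum.mono_neutral_right) (auto simp: w)
  then have "Lk k = (\<Sum>P\<in>MP n k. xi P)" by (simp add: M_def)
  also have "\<dots> = (\<Sum>P\<in>NK k. chr n (EE k P))"
  proof (rule sum.mono_neutral_cong_right)
    show "finite (MP n k)" by (rule finite_MP[OF n_pos])
    show "NK k \<subseteq> MP n k" using False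
      by (auto simp: NK_def FK_def PD_iff_degree MP_def dest: le_degree)
    show "\<forall>P\<in>MP n k - NK k. xi P = 0"
      by (auto simp: NK_def FK_def PD_iff_degree MP_def xi_def Z_iff)
    fix P assume P: "P \<in> NK k"
    then have P': "P \<noteq> 0" "\<forall>\<gamma>\<in>Z. poly P \<gamma> \<noteq> 0" "degree P \<le> k" "P \<in> PO n" "lead_coeff P = 1" "coeff P k \<noteq> 0"
      using FK_nz False by (auto simp: NK_def FK_def PD_iff_degree)
    then have deg: "degree P = k" by (simp add: le_antisym le_degree)
    then have "RS f P = EE k P"
      using RS_f[OF P'(1,2)] RS_ident[OF P'(1)] assms by (simp add: EE_def)
    then show "xi P = chr n (EE k P)" using P' by (auto simp: xi_def Z_iff)
  qed
  finally show ?thesis .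
qed

lemma smult_FK: "P \<in> FK k \<Longrightarrow> l \<in> FF n \<Longrightarrow> l \<noteq> 0 \<Longrightarrow> smult l P \<in> FK k"
  by (auto simp: FK_def PD_smult)

lemma EE_smult: "l \<noteq> 0 \<Longrightarrow> EE k (smult l P) = EE k P"
  by (simp add: EE_def Sg_def pderiv_smult)

lemma Lk_FK: assumes "k > 0" shows "of_nat (p ^ n - 1) * Lk k = (\<Sum>P\<in>FK k. chr n (EE k P))"
proof -
  have "(\<Sum>P\<in>FK k. chr n (EE k P)) = (\<Sum>(l, P)\<in>(FF n - {0}) \<times> NK k. chr n (EE k P))"
  proof (rule sum.reindex_bij_witness[where j = "\<lambda>P. (lead_coeff P, smult (inverse (lead_coeff P)) P)"
        and i = "\<lambda>(l, P). smult l P"])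
    fix P assume P: "P \<in> FK k"
    then have nz: "lead_coeff P \<noteq> 0" using FK_nz by auto
    have FF: "lead_coeff P \<in> FF n" "inverse (lead_coeff P) \<in> FF n"
      using P FF_divide[of 1 n "lead_coeff P"] by (auto simp: FK_def PD_def PO_coeff inverse_eq_divide)
    show "(case (lead_coeff P, smult (inverse (lead_coeff P)) P) of (l, P) \<Rightarrow> smult l P) = P" using nz by simp
    show "(lead_coeff P, smult (inverse (lead_coeff P)) P) \<in> (FF n - {0}) \<times> NK k"
      using smult_FK[OF P FF(2)] nz FF by (auto simp: NK_def)
    show "(case (lead_coeff P, smult (inverse (lead_coeff P)) P) of (l, P) \<Rightarrow> chr n (EE k P)) = chr n (EE k P)"
      using nz by (simp add: EE_smult)
  next
    fix x assume "x \<in> (FF n - {0}) \<times> NK k"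
    then obtain l P where x: "x = (l, P)" "l \<in> FF n" "l \<noteq> 0" "P \<in> FK k" "lead_coeff P = 1" by (auto simp: NK_def)
    show "(case x of (l, P) \<Rightarrow> smult l P) \<in> FK k" using x smult_FK by auto
    show "(lead_coeff (case x of (l, P) \<Rightarrow> smult l P), smult (inverse (lead_coeff (case x of (l, P) \<Rightarrow> smult l P)))
        (case x of (l, P) \<Rightarrow> smult l P)) = x" using x by simp
  qed
  also have "\<dots> = (\<Sum>l\<in>FF n - {0}. \<Sum>P\<in>NK k. chr n (EE k P))" by (rule sum.cartesian_product[symmetric])
  also have "\<dots> = of_nat (card (FF n - {0})) * Lk k" using Lk_NK[OF assms] by simp
  also have "card (FF n - {0}) = p ^ n - 1" using card_FF[OF n_pos] by (simp add: card_Diff_subset)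
  finally show ?thesis ..
qed

text \<open>\<open>EE k P\<close> decreases by this linear functional of \<open>B\<close> under the shift \<open>P + g * B\<close>. Only those \<open>P\<close> for which it vanishes
  identically contribute to the character sum.\<close>

definition Lam where "Lam k P B = (\<Sum>\<gamma>\<in>Z. poly h \<gamma> * poly B \<gamma> / poly P \<gamma>) + a * coeff B (k - d) / coeff P k"

lemma Lam_add: "Lam k P (A + B) = Lam k P A + Lam k P B"
  by (simp add: Lam_def distrib_left add_divide_distrib sum.distrib)

lemma Lam_smult: "Lam k P (smult l B) = l * Lam k P B"
  by (simp add: Lam_def distrib_left sum_distrib_left mult_ac)

lemma Lam_0 [simp]: "Lam k P 0 = 0" by (simp add: Lam_def)

lemma Lam_sum: "Lam k P (sum B A) = (\<Sum>i\<in>A. Lam k P (B i))"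
  by (induction A rule: infinite_finite_induct) (auto simp: Lam_add)

lemma Lam_FF: assumes "P \<in> FK k" "B \<in> PO n" shows "Lam k P B \<in> FF n"
proof -
  have P: "P \<in> PO n" using assms by (simp add: FK_def PD_def)
  have "(\<Sum>\<gamma>\<in>Z. poly h \<gamma> * poly B \<gamma> / poly P \<gamma>) \<in> FF n"
    by (rule sum_frob_FF[OF frob_Z])
      (simp add: PO_poly_frob assms P h_PO power_divide power_mult_distrib)
  then show ?thesis unfolding Lam_def
    by (intro FF_add FF_mult FF_divide a_FF PO_coeff[OF P] PO_coeff[OF assms(2)])
qed

text \<open>The bound \<open>k - d\<close>, rather than \<open>k - degree g\<close>, keeps
  \<open>g * B\<close> below degree \<open>k\<close> when \<open>degree g = d - 1\<close>: the
  coefficient of index \<open>k\<close> stays, and the next one changes by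
  \<open>coeff B (k - d)\<close>, the source of the second summand of \<open>Lam\<close>.\<close>

abbreviation VV where "VV k \<equiv> PD n (Suc (k - d))"

lemma coeff_gB_top: assumes "k \<ge> d" "degree g \<noteq> d" "degree B \<le> k - d"
  shows "coeff (g * B) k = 0" "coeff (g * B) (k - 1) = coeff B (k - d)"
proof -
  have gd: "degree g = d - 1" using g_deg assms by auto
  have "degree (g * B) \<le> (d - 1) + (k - d)" using degree_mult_le[of g B] gd assms by simp
  then show "coeff (g * B) k = 0" using assms d_ge by (intro coeff_eq_0) auto
  have "coeff (g * B) ((d - 1) + (k - d)) = coeff g (d - 1) * coeff B (k - d)"
    by (rule coeff_mult_top) (use gd assms in auto)
  moreover have "(d - 1) + (k - d) = k - 1" using assms d_ge by auto
  ultimately show "coeff (g * B) (k - 1) = coeff B (k - d)" using g_lead gd by simp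
qed

lemma shift_FK: assumes "k \<ge> d" "P \<in> FK k" "B \<in> VV k" shows "P + g * B \<in> FK k"
proof -
  have B: "B \<in> PO n" "degree B \<le> k - d" using assms by (auto simp: PD_iff_degree)
  have "degree (g * B) \<le> k" using degree_mult_le[of g B] g_deg B assms by auto
  then have "P + g * B \<in> PD n (Suc k)"
    using assms B g_PO by (auto simp: FK_def PD_iff_degree intro!: PO_add PO_mult degree_add_le)
  then show ?thesis using assms coeff_gB_top[OF assms(1) _ B(2)] by (auto simp: FK_def Z_iff)
qed

text \<open>Since \<open>g\<close> vanishes at the poles, the shift keeps the value of
  \<open>P\<close> there and adds \<open>g' * B\<close> to its derivative; this \<open>g'\<close>
  cancels against the one in the residue \<open>b\<close>.\<close>

lemma EE_shift: assumes "k \<ge> d" "P \<in> FK k" "B \<in> VV k" shows "EE k (P + g * B) = EE k P + - Lam k P B"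
proof -
  have B: "degree B \<le> k - d" using assms by (auto simp: PD_iff_degree)
  have "Sg (P + g * B) = (\<Sum>\<gamma>\<in>Z. b \<gamma> * poly (pderiv P) \<gamma> / poly P \<gamma> + poly h \<gamma> * poly B \<gamma> / poly P \<gamma>)"
    unfolding Sg_def
  proof (rule sum.cong[OF refl])
    fix \<gamma> assume z: "\<gamma> \<in> Z"
    then have nz: "poly P \<gamma> \<noteq> 0" "poly g \<gamma> = 0" "poly (pderiv g) \<gamma> \<noteq> 0"
      using assms g_simple by (auto simp: FK_def Z_iff)
    then show "b \<gamma> * poly (pderiv (P + g * B)) \<gamma> / poly (P + g * B) \<gamma> =
        b \<gamma> * poly (pderiv P) \<gamma> / poly P \<gamma> + poly h \<gamma> * poly B \<gamma> / poly P \<gamma>"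
      by (simp add: pderiv_add pderiv_mult b_def field_simps)
  qed
  then have S: "Sg (P + g * B) = Sg P + (\<Sum>\<gamma>\<in>Z. poly h \<gamma> * poly B \<gamma> / poly P \<gamma>)"
    by (simp add: sum.distrib Sg_def)
  show ?thesis
  proof (cases "degree g = d")
    case True
    then show ?thesis using S caseA by (simp add: EE_def Lam_def)
  next
    case False
    then show ?thesis using S coeff_gB_top[OF assms(1) False B]
      by (simp add: EE_def Lam_def add_divide_distrib distrib_left)
  qed
qed

definition good where "good k = {P \<in> FK k. \<forall>B\<in>VV k. Lam k P B = 0}"

lemma sum_good: assumes "k \<ge> d" shows "(\<Sum>P\<in>FK k. chr n (EE k P)) = (\<Sum>P\<in>good k. chr n (EE k P))"
proof -
  let ?S = "\<Sum>P\<in>FK k. chr n (EE k P)"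
  have finV: "finite (VV k)" "card (VV k) > 0" using card_PD[OF n_pos, of "Suc (k - d)"] pm_pos by auto
  have "of_nat (card (VV k)) * ?S = (\<Sum>B\<in>VV k. ?S)" by simp
  also have "\<dots> = (\<Sum>B\<in>VV k. \<Sum>P\<in>FK k. chr n (EE k (P + g * B)))"
  proof (rule sum.cong[OF refl])
    fix B assume B: "B \<in> VV k"
    then have mB: "- B \<in> VV k" using PD_diff[OF PD_0_mem B] by simp
    have "bij_betw (\<lambda>P. P + g * B) (FK k) (FK k)"
      by (rule bij_betw_byWitness[where f' = "\<lambda>P. P + g * (- B)"])
        (use shift_FK[OF assms _ B] shift_FK[OF assms _ mB] in auto)
    from sum.reindex_bij_betw[OF this, of "\<lambda>P. chr n (EE k P)"]
    show "?S = (\<Sum>P\<in>FK k. chr n (EE k (P + g * B)))" by simp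
  qed
  also have "\<dots> = (\<Sum>P\<in>FK k. \<Sum>B\<in>VV k. chr n (EE k (P + g * B)))" by (rule sum.swap)
  also have "\<dots> = (\<Sum>P\<in>FK k. if P \<in> good k then of_nat (card (VV k)) * chr n (EE k P) else 0)"
  proof (rule sum.cong[OF refl])
    fix P assume P: "P \<in> FK k"
    have "(\<Sum>B\<in>VV k. chr n (EE k (P + g * B))) = (\<Sum>B\<in>VV k. chr n (EE k P) * chr n (- Lam k P B))"
      by (intro sum.cong refl) (simp only: EE_shift[OF assms P], intro chr_add EE_FF Lam_FF PD_PO FF_minus P)
    also have "\<dots> = chr n (EE k P) * (\<Sum>B\<in>VV k. chr n (- Lam k P B))" by (simp add: sum_distrib_left)
    also have "\<dots> = (if P \<in> good k then of_nat (card (VV k)) * chr n (EE k P) else 0)"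
    proof (cases "P \<in> good k")
      case True
      then have "(\<Sum>B\<in>VV k. chr n (- Lam k P B)) = (\<Sum>B\<in>VV k. 1)"
        by (intro sum.cong refl) (simp add: good_def)
      then show ?thesis using True by simp
    next
      case False
      then obtain B0 where B0: "B0 \<in> VV k" "- Lam k P B0 \<noteq> 0" using P by (auto simp: good_def)
      have "(\<Sum>B\<in>VV k. chr n (- Lam k P B)) = 0"
        by (rule linear_char_sum_zero[where lam = "\<lambda>B. - Lam k P B", OF n_pos B0(1)])
          (use B0(2) in \<open>auto simp: Lam_add Lam_smult intro!: FF_minus Lam_FF P PD_add PD_diff PD_smult elim: PD_PO\<close>)
      then show ?thesis using False by simp
    qed
    finally show "(\<Sum>B\<in>VV k. chr n (EE k (P + g * B))) = (if P \<in> good k then of_nat (card (VV k)) * chr n (EE k P) else 0)" .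
  qed
  also have "\<dots> = (\<Sum>P\<in>good k. of_nat (card (VV k)) * chr n (EE k P))"
    by (rule sum.mono_neutral_cong_right) (use finite_FK in \<open>auto simp: good_def\<close>)
  finally show ?thesis using finV(2) by (simp flip: sum_distrib_left)
qed

text \<open>Linearity and the monomials carry the vanishing from coefficients in \<open>FF n\<close>
  to arbitrary ones. The test polynomials needed, products over some of the poles, are in general
  not rational over \<open>FF n\<close>.\<close>

lemma good_ext: assumes "P \<in> good k" "degree B \<le> k - d" shows "Lam k P B = 0"
proof -
  have "B = (\<Sum>i\<le>k - d. smult (coeff B i) (monom 1 i))"
    using poly_as_sum_of_monoms'[OF assms(2)] by (simp add: smult_monom)
  then have "Lam k P B = (\<Sum>i\<le>k - d. coeff B i * Lam k P (monom 1 i))"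
    by (metis (no_types, lifting) Lam_sum Lam_smult sum.cong)
  also have "\<dots> = 0"
    by (rule sum.neutral) (use assms in \<open>auto simp: good_def PD_iff_degree PO_monom degree_monom_eq\<close>)
  finally show ?thesis .
qed

lemma Lam_cofactor: assumes "\<gamma> \<in> Z"
  shows "Lam k P (PZ (Z - {\<gamma>})) = poly h \<gamma> * poly (pderiv g) \<gamma> / poly P \<gamma> + a * coeff (PZ (Z - {\<gamma>})) (k - d) / coeff P k"
proof -
  have "(\<Sum>w\<in>Z. poly h w * poly (PZ (Z - {\<gamma>})) w / poly P w) =
     (\<Sum>w\<in>{\<gamma>}. poly h w * poly (PZ (Z - {\<gamma>})) w / poly P w)"
    by (rule sum.mono_neutral_right) (use finite_Z assms in \<open>auto simp: PZ_root\<close>)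
  then show ?thesis using PZ_pderiv[OF finite_Z assms] g_eq by (simp add: Lam_def)
qed

lemma q_gt_1: "p ^ n > 1"
  using p_gt_1 n_pos one_less_power by blast

text \<open>From \<open>k = 2 * d - 1\<close> on, the product over all poles but one is an
  admissible test polynomial. It isolates the nonzero number \<open>h g' / P\<close> at the omitted
  pole, so no \<open>P\<close> is good.\<close>

lemma Lk_vanish: assumes "k \<ge> 2 * d - 1" shows "Lk k = 0"
proof -
  have "good k = {}"
  proof (rule ccontr)
    assume "good k \<noteq> {}"
    then obtain P where P: "P \<in> good k" by blast
    obtain \<gamma> where z: "\<gamma> \<in> Z" using Z_nonempty by blast
    have deg: "degree (PZ (Z - {\<gamma>})) = degree g - 1" using card_Z z finite_Z by simp
    then have "degree (PZ (Z - {\<gamma>})) \<le> k - d" using g_deg assms by auto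
    then have 0: "Lam k P (PZ (Z - {\<gamma>})) = 0" using good_ext[OF P] by blast
    have "a * coeff (PZ (Z - {\<gamma>})) (k - d) = 0"
    proof (cases "degree g = d")
      case False
      then have "degree (PZ (Z - {\<gamma>})) < k - d" using deg g_deg assms d_ge by auto
      then show ?thesis by (simp add: coeff_eq_0)
    qed (simp add: caseA)
    then have "poly h \<gamma> * poly (pderiv g) \<gamma> / poly P \<gamma> = 0" using 0 Lam_cofactor[OF z, of k P]
      by (metis add.right_neutral div_0)
    then show False using P z h_Z g_simple by (auto simp: good_def FK_def Z_iff)
  qed
  moreover have "k \<ge> d" "k > 0" using assms d_ge by auto
  ultimately have "of_nat (p ^ n - 1) * Lk k = 0" using Lk_FK sum_good by simp
  moreover have "of_nat (p ^ n - 1) \<noteq> (0::complex)" using q_gt_1 by (simp only: of_nat_eq_0_iff)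
  ultimately show ?thesis by simp
qed

section \<open>The leading coefficient of the L-function\<close>

abbreviation kt where "kt \<equiv> 2 * d - 2"

text \<open>Now test polynomials have degree at most \<open>d - 2\<close>. With \<open>d\<close>
  finite poles they must omit two of them, which shows only that \<open>h g' / P\<close> agrees at
  any two poles; with \<open>d - 1\<close> poles they may omit one, and its value is tied to the
  leading coefficient of \<open>P\<close>.\<close>

lemma good_char: assumes "P \<in> good kt"
  shows "\<exists>l\<in>FF n. l \<noteq> 0 \<and> (\<forall>\<gamma>\<in>Z. poly h \<gamma> * poly (pderiv g) \<gamma> = l * poly P \<gamma>) \<and> (degree g \<noteq> d \<longrightarrow> l * coeff P kt = - a)"
proof -
  have P: "P \<in> FK kt" "P \<in> PO n" "\<And>\<gamma>. \<gamma> \<in> Z \<Longrightarrow> poly P \<gamma> \<noteq> 0" using assms by (auto simp: good_def FK_def PD_def)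
  have hg: "poly h \<gamma> * poly (pderiv g) \<gamma> \<noteq> 0" if "\<gamma> \<in> Z" for \<gamma> using that h_Z g_simple by (auto simp: Z_iff)
  have kd: "kt - d = d - 2" by simp
  show ?thesis
  proof (cases "degree g = d")
    case True
    obtain \<gamma>0 where z0: "\<gamma>0 \<in> Z" using Z_nonempty by blast
    define q where "q \<gamma> = poly h \<gamma> * poly (pderiv g) \<gamma> / poly P \<gamma>" for \<gamma>
    have qeq: "q \<gamma> = q \<gamma>0" if z: "\<gamma> \<in> Z" for \<gamma>
    proof (cases "\<gamma> = \<gamma>0")
      case False
      let ?S = "Z - {\<gamma>} - {\<gamma>0}"
      have deg: "degree (PZ ?S) = d - 2" using card_Z z z0 False finite_Z True by simp
      have 1: "Lam kt P (PZ ?S) = 0" by (rule good_ext[OF assms]) (use deg kd in simp)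
      have "(\<Sum>w\<in>Z. poly h w * poly (PZ ?S) w / poly P w) =
        (\<Sum>w\<in>{\<gamma>, \<gamma>0}. poly h w * poly (PZ ?S) w / poly P w)"
        by (rule sum.mono_neutral_right) (use finite_Z z z0 in \<open>auto simp: PZ_root\<close>)
      then have 2: "poly h \<gamma> * poly (PZ ?S) \<gamma> / poly P \<gamma> + poly h \<gamma>0 * poly (PZ ?S) \<gamma>0 / poly P \<gamma>0 = 0"
        using 1 False True caseA by (simp add: Lam_def)
      have S1: "Z - {\<gamma>} = insert \<gamma>0 ?S" "Z - {\<gamma>0} = insert \<gamma> ?S" using z z0 False by auto
      have "PZ (Z - {\<gamma>}) = [:- \<gamma>0, 1:] * PZ ?S" by (subst S1(1), rule PZ_insert) (use finite_Z in auto)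
      moreover have "PZ (Z - {\<gamma>0}) = [:- \<gamma>, 1:] * PZ ?S" by (subst S1(2), rule PZ_insert) (use finite_Z in auto)
      ultimately have "poly (pderiv g) \<gamma> = (\<gamma> - \<gamma>0) * poly (PZ ?S) \<gamma>" "poly (pderiv g) \<gamma>0 = (\<gamma>0 - \<gamma>) * poly (PZ ?S) \<gamma>0"
        using PZ_pderiv[OF finite_Z z] PZ_pderiv[OF finite_Z z0] unfolding g_eq[symmetric]
        by (simp_all only: poly_mult) (simp_all add: algebra_simps)
      then have "q \<gamma> = (\<gamma> - \<gamma>0) * (poly h \<gamma> * poly (PZ ?S) \<gamma> / poly P \<gamma>)"
        "q \<gamma>0 = (\<gamma>0 - \<gamma>) * (poly h \<gamma>0 * poly (PZ ?S) \<gamma>0 / poly P \<gamma>0)" by (simp_all add: q_def)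
      then have "q \<gamma> - q \<gamma>0 = (\<gamma> - \<gamma>0) * (poly h \<gamma> * poly (PZ ?S) \<gamma> / poly P \<gamma> + poly h \<gamma>0 * poly (PZ ?S) \<gamma>0 / poly P \<gamma>0)"
        by (simp only:) (simp only: algebra_simps)
      then show ?thesis using 2 by simp
    qed simp
    \<comment> \<open>Frobenius permutes the poles, so it fixes the common value of
      \<open>q\<close>.\<close>
    have "q \<gamma>0 ^ (p ^ n) = q (\<gamma>0 ^ (p ^ n))"
      by (simp add: q_def PO_poly_frob P h_PO PO_pderiv g_PO power_divide power_mult_distrib)
    also have "\<dots> = q \<gamma>0" using qeq z0 frob_Z_iff by blast
    finally have "q \<gamma>0 \<in> FF n" by (simp add: FF_iff)
    moreover have "q \<gamma>0 \<noteq> 0" using z0 hg P by (simp add: q_def)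
    moreover have "poly h \<gamma> * poly (pderiv g) \<gamma> = q \<gamma>0 * poly P \<gamma>" if "\<gamma> \<in> Z" for \<gamma>
      using qeq[OF that] P(3)[OF that] by (simp add: q_def[of \<gamma>] field_simps)
    ultimately show ?thesis using True by blast
  next
    case False
    have ck: "coeff P kt \<noteq> 0" using False P(1) by (simp add: FK_def)
    define l where "l = - a / coeff P kt"
    have "l \<in> FF n" unfolding l_def by (intro FF_divide FF_minus a_FF PO_coeff P)
    moreover have "l \<noteq> 0" using caseB[OF False] ck by (simp add: l_def)
    moreover have "poly h \<gamma> * poly (pderiv g) \<gamma> = l * poly P \<gamma>" if z: "\<gamma> \<in> Z" for \<gamma>
    proof -
      have deg: "degree (PZ (Z - {\<gamma>})) = d - 2" using card_Z z finite_Z False g_deg by auto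
      have "Lam kt P (PZ (Z - {\<gamma>})) = 0" by (rule good_ext[OF assms]) (use deg kd in simp)
      moreover have "coeff (PZ (Z - {\<gamma>})) (kt - d) = 1" using PZ_lead[of "Z - {\<gamma>}"] unfolding deg kd .
      ultimately have "poly h \<gamma> * poly (pderiv g) \<gamma> / poly P \<gamma> + a / coeff P kt = 0"
        using Lam_cofactor[OF z] by simp
      then have "poly h \<gamma> * poly (pderiv g) \<gamma> / poly P \<gamma> = l" by (simp add: l_def eq_neg_iff_add_eq_0)
      then show ?thesis using P(3)[OF z] by (simp add: field_simps)
    qed
    ultimately show ?thesis using ck by (intro bexI[of _ l]) (auto simp: l_def)
  qed
qed

text \<open>The solution of the conditions in \<open>good_char\<close> with \<open>l = 1\<close>:
  the values \<open>h g'\<close> at the poles are taken modulo \<open>g\<close>, and for a pole at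
  infinity a multiple of \<open>g\<close> sets the top coefficient to \<open>- a\<close>.\<close>

definition P0 where "P0 = (h * pderiv g) mod g + (if degree g \<noteq> d then smult (- a) (g * monom 1 (d - 1)) else 0)"

lemma P0_Z: assumes "\<gamma> \<in> Z" shows "poly P0 \<gamma> = poly h \<gamma> * poly (pderiv g) \<gamma>"
proof -
  have "poly (h * pderiv g) \<gamma> = poly (g * ((h * pderiv g) div g) + (h * pderiv g) mod g) \<gamma>" by simp
  also have "\<dots> = poly ((h * pderiv g) mod g) \<gamma>" using assms by (simp only: poly_add poly_mult) (simp add: Z_iff)
  finally show ?thesis using assms by (simp add: P0_def Z_iff)
qed

lemma P0_PO: "P0 \<in> PO n"
proof -
  have "smult (- a) (g * monom 1 (d - 1)) \<in> PO n" by (intro PO_smult FF_minus a_FF PO_mult g_PO PO_monom FF_1)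
  then show ?thesis unfolding P0_def by (intro PO_add PO_mod PO_mult PO_pderiv h_PO g_PO g_nz) (simp split: if_split)
qed

lemma P0_deg: "degree P0 \<le> kt" "degree g \<noteq> d \<Longrightarrow> coeff P0 kt = - a"
proof -
  let ?R = "(h * pderiv g) mod g"
  have R: "?R = 0 \<or> degree ?R < degree g" using degree_mod_less g_nz by blast
  then have R': "degree ?R \<le> d - 1" using g_deg d_ge by auto
  have "degree (smult (- a) (g * monom 1 (d - 1))) \<le> degree g + (d - 1)"
    by (intro order.trans[OF degree_smult_le] order.trans[OF degree_mult_le]) (simp add: degree_monom_eq)
  then have "degree g \<noteq> d \<Longrightarrow> degree (smult (- a) (g * monom 1 (d - 1))) \<le> kt" using g_deg d_ge by auto
  moreover have "degree ?R \<le> kt" using R' by simp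
  ultimately show "degree P0 \<le> kt" unfolding P0_def by (intro degree_add_le) (simp_all split: if_split)
  assume False': "degree g \<noteq> d"
  then have gd: "degree g = d - 1" using g_deg by auto
  have kt: "kt = degree g + (d - 1)" using gd d_ge by simp
  have "coeff (g * monom 1 (d - 1)) (degree g + (d - 1)) = coeff g (degree g) * coeff (monom 1 (d - 1)) (d - 1)"
    by (rule coeff_mult_top) (auto simp: degree_monom_eq)
  then have 1: "coeff (g * monom 1 (d - 1)) kt = 1" using g_lead unfolding kt by simp
  have "coeff ?R kt = 0" using R gd d_ge by (auto simp: coeff_eq_0)
  then show "coeff P0 kt = - a" using False' 1 by (simp add: P0_def del: mult_minus_left)
qed

text \<open>At the poles \<open>h / P0 = 1 / g'\<close>, so \<open>euler_sum\<close> evaluates the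
  finite part of the functional as \<open>coeff B (degree g - 1)\<close>. This is 0 if
  \<open>degree g = d\<close> and cancels against the term at infinity otherwise.\<close>

lemma P0_good: "P0 \<in> good kt"
proof -
  have kd: "kt - d = d - 2" by simp
  have FK: "P0 \<in> FK kt"
    using P0_PO P0_deg P0_Z h_Z g_simple caseB by (auto simp: FK_def PD_iff_degree Z_iff)
  moreover have "Lam kt P0 B = 0" if B: "B \<in> VV kt" for B
  proof -
    have degB: "degree B \<le> d - 2" using B kd by (simp add: PD_iff_degree)
    have "(\<Sum>\<gamma>\<in>Z. poly h \<gamma> * poly B \<gamma> / poly P0 \<gamma>) = (\<Sum>\<gamma>\<in>Z. poly B \<gamma> / poly (pderiv g) \<gamma>)"
      by (rule sum.cong) (use h_Z in \<open>auto simp: P0_Z Z_iff\<close>)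
    also have "\<dots> = coeff B (card Z - 1)"
    proof -
      have "degree B < card Z \<or> B = 0" using degB g_deg d_ge card_Z by auto
      then show ?thesis using euler_sum[OF finite_Z, of B] unfolding g_eq[symmetric] by blast
    qed
    finally have 1: "Lam kt P0 B = coeff B (degree g - 1) + a * coeff B (d - 2) / coeff P0 kt"
      using kd card_Z by (simp add: Lam_def)
    show ?thesis
    proof (cases "degree g = d")
      case True
      then have "coeff B (degree g - 1) = 0" using degB d_ge by (intro coeff_eq_0) auto
      then show ?thesis using 1 True caseA by simp
    next
      case False
      then have "degree g - 1 = d - 2" using g_deg by auto
      then show ?thesis using 1 P0_deg(2)[OF False] caseB[OF False] by simp
    qed
  qed
  ultimately show ?thesis by (simp add: good_def)
qed

lemma good_shift: assumes "k \<ge> d" "P \<in> good k" "l \<in> FF n" "l \<noteq> 0" "B \<in> VV k"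
  shows "smult l P + g * B \<in> good k" "EE k (smult l P + g * B) = EE k P"
proof -
  have P: "P \<in> FK k" using assms by (simp add: good_def)
  note lP = smult_FK[OF P assms(3,4)]
  have L: "Lam k (smult l P) B' = Lam k P B' / l" for B'
    by (simp add: Lam_def add_divide_distrib sum_divide_distrib mult.commute)
  have "Lam k (smult l P + g * B) B' = Lam k (smult l P) B'" for B'
  proof -
    have "(\<Sum>\<gamma>\<in>Z. poly h \<gamma> * poly B' \<gamma> / poly (smult l P + g * B) \<gamma>) = (\<Sum>\<gamma>\<in>Z. poly h \<gamma> * poly B' \<gamma> / poly (smult l P) \<gamma>)"
      by (rule sum.cong) (auto simp: Z_iff)
    moreover have "a * x / coeff (smult l P + g * B) k = a * x / coeff (smult l P) k" for x
    proof (cases "degree g = d")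
      case False
      then show ?thesis using coeff_gB_top(1)[OF assms(1) False, of B] assms(5) by (simp add: PD_iff_degree)
    qed (simp add: caseA)
    ultimately show ?thesis by (simp only: Lam_def)
  qed
  then show "smult l P + g * B \<in> good k"
    using shift_FK[OF assms(1) lP assms(5)] L assms(2) by (simp add: good_def)
  show "EE k (smult l P + g * B) = EE k P"
    using EE_shift[OF assms(1) lP assms(5)] L assms by (simp add: EE_smult good_def)
qed

lemma good_eq: "bij_betw (\<lambda>(l, B). smult l P0 + g * B) ((FF n - {0}) \<times> VV kt) (good kt)"
proof -
  have kd: "kt \<ge> d" "kt - d = d - 2" using d_ge by auto
  have inj: "inj_on (\<lambda>(l, B). smult l P0 + g * B) ((FF n - {0}) \<times> VV kt)"
  proof (rule inj_onI, safe)
    fix l B l' B' assume eq: "smult l P0 + g * B = smult l' P0 + g * B'"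
    obtain \<gamma> where z: "\<gamma> \<in> Z" using Z_nonempty by blast
    have "poly (smult l P0 + g * B) \<gamma> = poly (smult l' P0 + g * B') \<gamma>" using eq by simp
    then have "l * poly P0 \<gamma> = l' * poly P0 \<gamma>" using z by (simp add: Z_iff)
    moreover have "poly P0 \<gamma> \<noteq> 0" using P0_Z[OF z] z h_Z g_simple by (auto simp: Z_iff)
    ultimately have "l = l'" by simp
    then show "l = l'" "B = B'" using eq g_nz by simp_all
  qed
  moreover have "(\<lambda>(l, B). smult l P0 + g * B) ` ((FF n - {0}) \<times> VV kt) = good kt"
  proof (intro equalityI subsetI)
    fix P assume "P \<in> (\<lambda>(l, B). smult l P0 + g * B) ` ((FF n - {0}) \<times> VV kt)"
    then obtain x where x: "P = (case x of (l, B) \<Rightarrow> smult l P0 + g * B)" "x \<in> (FF n - {0}) \<times> VV kt"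
      by (rule imageE)
    obtain l B where "x = (l, B)" by (cases x)
    with x have pl: "P = smult l P0 + g * B" "l \<in> FF n" "l \<noteq> 0" "B \<in> VV kt" by (simp_all only: prod.case) blast+
    show "P \<in> good kt" unfolding pl(1) by (rule good_shift(1)[OF kd(1) P0_good pl(2-4)])
  next
    fix P assume P: "P \<in> good kt"
    then obtain l where l: "l \<in> FF n" "l \<noteq> 0" "\<And>\<gamma>. \<gamma> \<in> Z \<Longrightarrow> poly h \<gamma> * poly (pderiv g) \<gamma> = l * poly P \<gamma>"
      "degree g \<noteq> d \<Longrightarrow> l * coeff P kt = - a" using good_char[OF P] by blast
    have PP: "P \<in> PO n" "degree P \<le> kt" using P by (auto simp: good_def FK_def PD_iff_degree)
    define m where "m = 1 / l"
    have m: "m \<in> FF n" "m \<noteq> 0" unfolding m_def using l FF_divide[of 1 n l] by auto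
    define R where "R = P - smult m P0"
    have "PZ Z dvd R" by (rule PZ_dvd[OF finite_Z]) (use l in \<open>auto simp: R_def m_def P0_Z\<close>)
    then have "g dvd R" by (subst g_eq)
    then obtain B where B: "R = g * B" by (elim dvdE)
    have RPO: "R \<in> PO n" unfolding R_def by (intro PO_diff PO_smult m PP P0_PO)
    then have BPO: "B \<in> PO n" using PO_quotient[of g B n] B g_PO g_nz by simp
    have degR: "degree R \<le> kt"
      unfolding R_def by (intro degree_diff_le PP order.trans[OF degree_smult_le] P0_deg)
    have "degree B \<le> d - 2"
    proof (cases "B = 0")
      case False
      have deg: "degree R = degree g + degree B" unfolding B by (rule degree_mult_eq) (use False g_nz in auto)
      show ?thesis
      proof (cases "degree g = d")
        case True then show ?thesis using deg degR by simp
      next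
        case gd: False
        have "coeff R kt = 0" using l(4)[OF gd] l(2) P0_deg(2)[OF gd] by (simp add: R_def m_def field_simps)
        moreover have "R \<noteq> 0" using B False g_nz by simp
        ultimately have "degree R \<noteq> kt" by (metis leading_coeff_0_iff)
        then show ?thesis using deg degR g_deg gd by auto
      qed
    qed simp
    then have "B \<in> VV kt" using BPO kd by (simp add: PD_iff_degree)
    moreover have "P = smult m P0 + g * B" using B by (simp add: R_def algebra_simps)
    ultimately show "P \<in> (\<lambda>(l, B). smult l P0 + g * B) ` ((FF n - {0}) \<times> VV kt)"
      using m by (intro image_eqI[of _ _ "(m, B)"]) (simp_all only: prod.case mem_Sigma_iff Diff_iff singleton_iff simp_thms)
  qed
  ultimately show ?thesis by (simp add: bij_betw_def)
qed

text \<open>By \<open>good_eq\<close> there are \<open>(q - 1) * q ^ (d - 1)\<close> good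
  polynomials, and by \<open>good_shift\<close> all carry the same character value; the factor
  \<open>q - 1\<close> is the one in \<open>Lk_FK\<close>.\<close>

lemma Lk_top: "norm (Lk kt) = real (p ^ n) ^ (d - 1)"
proof -
  have kd: "kt \<ge> d" "kt > 0" "Suc (kt - d) = d - 1" using d_ge by auto
  have q: "of_nat (p ^ n - 1) \<noteq> (0::complex)" using q_gt_1 by (simp only: of_nat_eq_0_iff)
  have "of_nat (p ^ n - 1) * Lk kt = (\<Sum>P\<in>good kt. chr n (EE kt P))"
    using Lk_FK[OF kd(2)] sum_good[OF kd(1)] by simp
  also have "\<dots> = (\<Sum>x\<in>(FF n - {0}) \<times> VV kt. chr n (EE kt ((\<lambda>(l, B). smult l P0 + g * B) x)))"
    by (rule sum.reindex_bij_betw[OF good_eq, symmetric])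
  also have "\<dots> = (\<Sum>x\<in>(FF n - {0}) \<times> VV kt. chr n (EE kt P0))"
  proof (rule sum.cong[OF refl])
    fix x assume "x \<in> (FF n - {0}) \<times> VV kt"
    then obtain l B where "x = (l, B)" "l \<in> FF n" "l \<noteq> 0" "B \<in> VV kt" by blast
    then show "chr n (EE kt (case x of (l, B) \<Rightarrow> smult l P0 + g * B)) = chr n (EE kt P0)"
      using good_shift(2)[OF kd(1) P0_good, of l B] by simp
  qed
  also have "\<dots> = of_nat (card (FF n - {0}) * card (VV kt)) * chr n (EE kt P0)" by (simp add: card_cartesian_product)
  also have "card (FF n - {0}) = p ^ n - 1" using card_FF[OF n_pos] by (simp add: card_Diff_subset)
  also have "card (VV kt) = (p ^ n) ^ (d - 1)" using card_PD(1)[OF n_pos, of "Suc (kt - d)"] kd(3) by metis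
  finally have "Lk kt = of_nat ((p ^ n) ^ (d - 1)) * chr n (EE kt P0)"
    using q by (metis (no_types, lifting) mult.assoc mult_left_cancel of_nat_mult)
  moreover have "norm (chr n (EE kt P0)) = 1" using P0_good by (intro chr_norm EE_FF) (simp add: good_def)
  ultimately show ?thesis by (simp add: norm_mult norm_power)
qed

lemma L_poly_coeff: "coeff (L_poly p n \<psi> h g) i = Lk i"
proof -
  define P where "P = (\<Sum>i\<le>kt. monom (Lk i) i)"
  have "coeff P i = Lk i" for i
  proof (cases "i \<le> kt")
    case False
    then have "Lk i = 0" by (intro Lk_vanish) auto
    then show ?thesis using False by (simp add: P_def coeff_sum)
  qed (simp add: P_def coeff_sum)
  then have P: "fps_of_poly P = L_fps p n \<psi> h g" and c: "coeff P i = Lk i"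
    by (auto simp: L_fps_eq fps_eq_iff)
  have "L_poly p n \<psi> h g = P" unfolding L_poly_def
    by (rule the_equality) (use P in \<open>auto simp: fps_of_poly_eq_iff[symmetric]\<close>)
  then show ?thesis using c by simp
qed

lemma L_poly_degree: "degree (L_poly p n \<psi> h g) = kt"
proof (rule antisym)
  show "degree (L_poly p n \<psi> h g) \<le> kt"
    by (rule degree_le) (auto simp: L_poly_coeff intro!: Lk_vanish)
  have "norm (Lk kt) > 0" unfolding Lk_top using p_gt_1 by simp
  then show "kt \<le> degree (L_poly p n \<psi> h g)" by (intro le_degree) (auto simp: L_poly_coeff)
qed

end

section \<open>Stepanov's method\<close>

text \<open>Among the terms with nonzero coefficient, exactly one has the least order at
  \<open>x\<close>; after division by that power of the linear factor it alone survives at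
  \<open>x\<close>.\<close>

lemma sum_distinct_orders_nz:
  fixes U :: "'i \<Rightarrow> 'a::field poly"
  assumes "finite I" "inj_on e I" "\<And>i. i \<in> I \<Longrightarrow> poly (U i) x \<noteq> 0" "i0 \<in> I" "v i0 \<noteq> 0"
  shows "(\<Sum>i\<in>I. smult (v i) ([:- x, 1:] ^ e i * U i)) \<noteq> 0"
proof
  assume 0: "(\<Sum>i\<in>I. smult (v i) ([:- x, 1:] ^ e i * U i)) = 0"
  let ?J = "{i\<in>I. v i \<noteq> 0}"
  have finJ: "finite ?J" "?J \<noteq> {}" using assms by auto
  define m where "m = Min (e ` ?J)"
  have "m \<in> e ` ?J" unfolding m_def using finJ by (intro Min_in) auto
  then obtain j where j: "j \<in> I" "v j \<noteq> 0" "e j = m" by auto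
  have le: "m \<le> e i" if "i \<in> ?J" for i unfolding m_def using finJ that by (intro Min_le) auto
  define R where "R = (\<Sum>i\<in>?J. smult (v i) ([:- x, 1:] ^ (e i - m) * U i))"
  have "(\<Sum>i\<in>I. smult (v i) ([:- x, 1:] ^ e i * U i)) = (\<Sum>i\<in>?J. smult (v i) ([:- x, 1:] ^ e i * U i))"
    by (rule sum.mono_neutral_right) (use assms in auto)
  also have "\<dots> = [:- x, 1:] ^ m * R"
    unfolding R_def sum_distrib_left
  proof (rule sum.cong[OF refl])
    fix i assume "i \<in> ?J"
    then have "[:- x, 1:] ^ e i = [:- x, 1:] ^ m * [:- x, 1:] ^ (e i - m)" using le by (simp flip: power_add)
    then show "smult (v i) ([:- x, 1:] ^ e i * U i) = [:- x, 1:] ^ m * smult (v i) ([:- x, 1:] ^ (e i - m) * U i)"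
      by (simp only: mult_smult_right mult.assoc)
  qed
  finally have "R = 0" using 0 by simp
  have "poly R x = (\<Sum>i\<in>?J. v i * (0 ^ (e i - m) * poly (U i) x))"
    unfolding R_def poly_sum poly_smult poly_mult poly_power by simp
  also have "\<dots> = (\<Sum>i\<in>{j}. v i * (0 ^ (e i - m) * poly (U i) x))"
  proof (rule sum.mono_neutral_right)
    show "\<forall>i\<in>?J - {j}. v i * (0 ^ (e i - m) * poly (U i) x) = 0"
    proof
      fix i assume i: "i \<in> ?J - {j}"
      then have "e i \<noteq> m" using assms(2) j by (auto simp: inj_on_def)
      then have "e i - m > 0" using le[of i] i by auto
      then show "v i * (0 ^ (e i - m) * poly (U i) x) = 0" by (simp add: power_0_left)
    qed
  qed (use finJ j in auto)
  finally show False using j assms(3)[OF j(1)] \<open>R = 0\<close> by simp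
qed

text \<open>Applying the difference operator with characteristic roots \<open>z ^ r0 \<noteq> z0 ^ r0\<close> to the power sums
  isolates the contribution of \<open>z0\<close>.\<close>

lemma power_sum_bound:
  fixes S :: "complex set" and m :: "complex \<Rightarrow> nat"
  assumes "finite S" "\<And>z. z \<in> S \<Longrightarrow> m z > 0" "B > 0"
    and bound: "\<And>s. s > 0 \<Longrightarrow> norm (\<Sum>z\<in>S. of_nat (m z) * (z ^ r0) ^ s) \<le> C * B ^ s" and "z0 \<in> S"
  shows "norm z0 ^ r0 \<le> B"
proof (rule ccontr)
  assume "\<not> ?thesis"
  then have gt: "norm z0 ^ r0 > B" by simp
  define b1 where "b1 = z0 ^ r0"
  define P where "P = (\<Prod>b\<in>(\<lambda>z. z ^ r0) ` S - {b1}. [:- b, 1:])"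
  have Pb: "poly P b = 0" if "b \<in> (\<lambda>z. z ^ r0) ` S - {b1}" for b
    unfolding P_def poly_prod using that assms(1) by (intro prod_zero) auto
  have Pb1: "poly P b1 \<noteq> 0" unfolding P_def poly_prod using assms(1) by auto
  define W where "W = (\<Sum>z | z \<in> S \<and> z ^ r0 = b1. m z)"
  have "W \<ge> 1"
  proof -
    have "m z0 \<le> W" unfolding W_def by (rule member_le_sum) (use assms b1_def in auto)
    then show ?thesis using assms(2)[OF assms(5)] by simp
  qed
  let ?c = "\<lambda>s. (\<Sum>z\<in>S. of_nat (m z) * (z ^ r0) ^ s)"
  have id: "(\<Sum>t\<le>degree P. coeff P t * ?c (s + t)) = of_nat W * b1 ^ s * poly P b1" for s
  proof -
    have "(\<Sum>t\<le>degree P. coeff P t * ?c (s + t)) =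
        (\<Sum>t\<le>degree P. \<Sum>z\<in>S. of_nat (m z) * (z ^ r0) ^ s * (coeff P t * (z ^ r0) ^ t))"
      by (simp add: sum_distrib_left power_add mult_ac)
    also have "\<dots> = (\<Sum>z\<in>S. \<Sum>t\<le>degree P. of_nat (m z) * (z ^ r0) ^ s * (coeff P t * (z ^ r0) ^ t))"
      by (rule sum.swap)
    also have "\<dots> = (\<Sum>z\<in>S. of_nat (m z) * (z ^ r0) ^ s * poly P (z ^ r0))"
      by (simp add: poly_altdef sum_distrib_left)
    also have "\<dots> = (\<Sum>z | z \<in> S \<and> z ^ r0 = b1. of_nat (m z) * (z ^ r0) ^ s * poly P (z ^ r0))"
      by (rule sum.mono_neutral_right) (use assms(1) Pb in auto)
    also have "\<dots> = (\<Sum>z | z \<in> S \<and> z ^ r0 = b1. of_nat (m z) * (b1 ^ s * poly P b1))"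
      by (rule sum.cong) auto
    also have "\<dots> = of_nat W * b1 ^ s * poly P b1"
      by (simp add: W_def sum_distrib_right mult.assoc)
    finally show ?thesis .
  qed
  define D where "D = (\<Sum>t\<le>degree P. norm (coeff P t) * \<bar>C\<bar> * B ^ t)"
  have "norm b1 ^ s * norm (poly P b1) \<le> D * B ^ s" if "s > 0" for s
  proof -
    have "norm b1 ^ s * norm (poly P b1) \<le> real W * (norm b1 ^ s * norm (poly P b1))"
      using \<open>W \<ge> 1\<close> mult_right_mono[of 1 "real W" "norm b1 ^ s * norm (poly P b1)"] by simp
    also have "\<dots> = norm (\<Sum>t\<le>degree P. coeff P t * ?c (s + t))"
      unfolding id by (simp add: norm_mult norm_power)
    also have "\<dots> \<le> (\<Sum>t\<le>degree P. norm (coeff P t * ?c (s + t)))" by (rule norm_sum)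
    also have "\<dots> \<le> (\<Sum>t\<le>degree P. norm (coeff P t) * \<bar>C\<bar> * B ^ t * B ^ s)"
    proof (rule sum_mono)
      fix t
      have "norm (?c (s + t)) \<le> C * B ^ (s + t)" using bound[of "s + t"] that by simp
      also have "\<dots> \<le> \<bar>C\<bar> * B ^ (s + t)" using assms(3) by (intro mult_right_mono) auto
      finally show "norm (coeff P t * ?c (s + t)) \<le> norm (coeff P t) * \<bar>C\<bar> * B ^ t * B ^ s"
        using mult_left_mono[of "norm (?c (s + t))" "\<bar>C\<bar> * B ^ (s + t)" "norm (coeff P t)"]
        unfolding norm_mult power_add[of B] by (simp only: mult_ac norm_ge_zero simp_thms)
    qed
    also have "\<dots> = D * B ^ s" by (simp add: D_def sum_distrib_right)
    finally show ?thesis .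
  qed
  then have bd: "(norm b1 / B) ^ s \<le> D / norm (poly P b1)" if "s > 0" for s
    using that Pb1 assms(3) by (simp add: field_simps power_divide)
  have "norm b1 / B > 1" using gt assms(3) by (simp add: b1_def norm_power)
  then obtain s where "D / norm (poly P b1) < (norm b1 / B) ^ s" using real_arch_pow by blast
  moreover have "(norm b1 / B) ^ s \<le> (norm b1 / B) ^ Suc s"
    using \<open>norm b1 / B > 1\<close> by (intro power_increasing) auto
  ultimately show False using bd[of "Suc s"] by simp
qed

lemma fps_logderiv_power:
  fixes A T :: "complex fps"
  assumes "fps_deriv A = A * T" shows "fps_deriv (A ^ k) = A ^ k * (of_nat k * T)"
  by (induction k) (simp_all add: assms algebra_simps)

text \<open>Newton's identities as generating series: each linear factor contributes a geometric
  series to the logarithmic derivative.\<close>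

lemma power_sums_from_logderiv:
  fixes S :: "complex set" and m :: "complex \<Rightarrow> nat"
  assumes "finite S"
  defines "F \<equiv> (\<Prod>z\<in>S. (1 - fps_const z * fps_X) ^ m z)"
  shows "fps_deriv F = F * Abs_fps (\<lambda>r. - (\<Sum>z\<in>S. of_nat (m z) * z ^ Suc r))"
  using assms(1) unfolding F_def
proof (induction S rule: finite_induct)
  case (insert z S)
  let ?T = "\<lambda>z. Abs_fps (\<lambda>r. - (z ^ Suc r)) :: complex fps"
  have 1: "fps_deriv (1 - fps_const z * fps_X) = (1 - fps_const z * fps_X) * ?T z"
  proof (rule fps_ext)
    fix k show "fps_nth (fps_deriv (1 - fps_const z * fps_X)) k = fps_nth ((1 - fps_const z * fps_X) * ?T z) k"
      by (cases k) (auto simp: left_diff_distrib mult.assoc)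
  qed
  have 2: "fps_deriv ((1 - fps_const z * fps_X) ^ k) = (1 - fps_const z * fps_X) ^ k * (of_nat k * ?T z)" for k
    by (rule fps_logderiv_power[OF 1])
  have 3: "Abs_fps (\<lambda>r. - (\<Sum>z\<in>insert z S. of_nat (m z) * z ^ Suc r)) =
      of_nat (m z) * ?T z + Abs_fps (\<lambda>r. - (\<Sum>z\<in>S. of_nat (m z) * z ^ Suc r))"
    by (rule fps_ext) (use insert in \<open>simp add: fps_of_nat[symmetric] del: of_nat_Suc\<close>)
  show ?case
    unfolding 3 prod.insert[OF insert(1,2)] fps_deriv_mult 2 insert.IH by (simp add: algebra_simps)
qed (simp add: fps_eq_iff)

lemma sum_lessThan_add:
  fixes f :: "nat \<Rightarrow> 'a::comm_monoid_add"
  shows "(\<Sum>j<a + b. f j) = (\<Sum>j<a. f j) + (\<Sum>j<b. f (a + j))"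
  by (induction b) (auto simp: add_ac)

text \<open>With \<open>u = p ^ (mu - 1)\<close>, the left side is the dimension of a space
  containing every \<open>Psi v\<close> and the right side the number of coefficients
  \<open>v\<close>. The difference is \<open>u * (2 * p - 1) + d * (u - 1) - 1\<close>.\<close>

lemma stepanov_arith:
  fixes p u d :: nat
  assumes "p > 1" "u > 0"
  shows "(u - 1) * (p * u) + (u + d) + (p - 1) * (d * u) + 1 < p * u * (u + d + 1)"
proof -
  obtain v where v: "u = Suc v" using assms gr0_conv_Suc by blast
  obtain w where w: "p = Suc (Suc w)" using assms(1) by (cases p; cases "p - 1") auto
  show ?thesis unfolding v w by (simp add: algebra_simps)
qed

section \<open>The auxiliary polynomial for one fibre of the trace\<close>

context ordAS
begin

context
  fixes mu :: nat and \<alpha> c0 :: 'k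
  assumes mu: "mu > 0" and n_dvd: "n dvd 2 * mu" and \<alpha>: "\<alpha> \<in> Z" "\<alpha> \<in> FF (2 * mu)" and c0: "c0 \<in> FF (Suc 0)"
begin

text \<open>On the points with \<open>tr (f x) = c0\<close> one has \<open>x ^ (PP * PP) = x\<close> and, for \<open>t = NN / GG\<close> the partial trace of
  \<open>f\<close>, \<open>t ^ PP = c0 - t\<close>. Hence \<open>WW v ^ PP\<close> agrees there with \<open>Psi v\<close> up to a unit. There are more
  coefficients \<open>v\<close> than values of \<open>Psi v\<close>, so \<open>Psi v = 0\<close> has a nontrivial solution, while \<open>WW v \<noteq> 0\<close> because
  its terms have distinct orders at the pole \<open>\<alpha>\<close>.\<close>

definition pp where "pp = p ^ (mu - 1)"
definition PP where "PP = p ^ mu"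
definition GG where "GG = g ^ pp"
definition NN where "NN = (\<Sum>j<mu. h ^ (p ^ j) * g ^ (pp - p ^ j))"
text \<open>The ranges of \<open>k\<close> and \<open>l\<close> make
  \<open>k + i * PP + pp * (p - 1 - l)\<close>, the order at the pole of a term of
  \<open>WW v\<close>, a mixed-radix expansion and thus injective on the indices. The range of
  \<open>i\<close> is chosen long enough for \<open>Dg_less\<close>.\<close>

definition Ix where "Ix = {..<pp} \<times> {..<pp + d + 1} \<times> {..<p}"
definition WW where "WW v = (\<Sum>(k, i, l)\<in>Ix. smult (v (k, i, l)) ([:- \<alpha>, 1:] ^ (k + i * PP) * NN ^ l * GG ^ (p - 1 - l)))"
definition Psi where "Psi v = (\<Sum>(k, i, l)\<in>Ix. smult (v (k, i, l) ^ PP) ([:- \<alpha>, 1:] ^ (k * PP + i) * (smult c0 GG - NN) ^ l * GG ^ (p - 1 - l)))"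

lemma PP_pp: "PP = p * pp" and pp_pos: "pp > 0" and PP_sq: "p ^ (2 * mu) = PP * PP" and PP_pos: "PP > 0"
proof -
  show "PP = p * pp" using mu by (simp add: PP_def pp_def power_eq_if)
  show "pp > 0" "PP > 0" using p_gt_1 by (simp_all add: pp_def PP_def)
  show "p ^ (2 * mu) = PP * PP" by (simp add: PP_def power_add mult_2)
qed

lemma pj_le: "j < mu \<Longrightarrow> p ^ j \<le> pp"
  unfolding pp_def using p_gt_1 by (intro power_increasing) auto

lemma deg_gh: "degree g \<le> d" "degree h \<le> d"
  using g_deg h_deg by auto

lemma deg_GG: "degree GG \<le> d * pp"
  unfolding GG_def using deg_gh by (metis degree_power_eq g_nz mult.commute mult_le_mono2)

lemma deg_NN: "degree NN \<le> d * pp"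
  unfolding NN_def
proof (rule degree_sum_le)
  fix j assume "j \<in> {..<mu}"
  then have le: "p ^ j \<le> pp" using pj_le by auto
  have "degree (h ^ (p ^ j) * g ^ (pp - p ^ j)) \<le> degree (h ^ (p ^ j)) + degree (g ^ (pp - p ^ j))" by (rule degree_mult_le)
  also have "\<dots> \<le> degree h * p ^ j + degree g * (pp - p ^ j)" by (intro add_mono degree_power_le)
  also have "\<dots> \<le> d * p ^ j + d * (pp - p ^ j)" using deg_gh by (intro add_mono mult_right_mono) auto
  also have "\<dots> = d * pp" using le by (simp flip: distrib_left)
  finally show "degree (h ^ (p ^ j) * g ^ (pp - p ^ j)) \<le> d * pp" .
qed simp

lemma term_deg:
  assumes "degree A \<le> d * pp" "l < p"
  shows "degree ([:- \<alpha>, 1:] ^ e * A ^ l * GG ^ (p - 1 - l)) \<le> e + (p - 1) * (d * pp)"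
proof -
  have "degree ([:- \<alpha>, 1:] ^ e * A ^ l * GG ^ (p - 1 - l)) \<le> degree ([:- \<alpha>, 1:] ^ e) + degree (A ^ l) + degree (GG ^ (p - 1 - l))"
    by (intro order.trans[OF degree_mult_le] add_mono degree_mult_le order.refl)
  also have "\<dots> \<le> 1 * e + (d * pp) * l + (d * pp) * (p - 1 - l)"
    by (intro add_mono order.trans[OF degree_power_le] mult_right_mono assms deg_GG) auto
  also have "\<dots> = e + (d * pp) * (l + (p - 1 - l))" by (simp add: distrib_left)
  also have "l + (p - 1 - l) = p - 1" using assms by simp
  finally show ?thesis by (simp add: mult.commute)
qed

lemma finite_Ix: "finite Ix" and card_Ix: "card Ix = PP * (pp + d + 1)"
  by (auto simp: Ix_def PP_pp card_cartesian_product algebra_simps)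

lemma deg_WW: "degree (WW v) \<le> pp * PP + (2 * d + 1) * PP"
  unfolding WW_def
proof (rule degree_sum_le[OF finite_Ix], clarify)
  fix k i l assume "(k, i, l) \<in> Ix"
  then have ix: "k < pp" "i \<le> pp + d" "l < p" by (auto simp: Ix_def)
  have "degree (smult (v (k, i, l)) ([:- \<alpha>, 1:] ^ (k + i * PP) * NN ^ l * GG ^ (p - 1 - l))) \<le> (k + i * PP) + (p - 1) * (d * pp)"
    by (intro order.trans[OF degree_smult_le] term_deg deg_NN ix)
  also have "\<dots> \<le> (PP + (pp + d) * PP) + p * (d * pp)"
  proof -
    have "pp \<le> PP" using PP_pp p_gt_1 by simp
    then show ?thesis using ix by (intro add_mono mult_right_mono) auto
  qed
  also have "\<dots> = pp * PP + (2 * d + 1) * PP" by (simp add: PP_pp algebra_simps)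
  finally show "degree (smult (v (k, i, l)) ([:- \<alpha>, 1:] ^ (k + i * PP) * NN ^ l * GG ^ (p - 1 - l))) \<le> pp * PP + (2 * d + 1) * PP" .
qed

definition Dg where "Dg = (pp - 1) * PP + (pp + d) + (p - 1) * (d * pp) + 1"

lemma Psi_PD: assumes "\<And>x. x \<in> Ix \<Longrightarrow> v x \<in> FF (2 * mu)" shows "Psi v \<in> PD (2 * mu) Dg"
proof -
  have gh: "g \<in> PO (2 * mu)" "h \<in> PO (2 * mu)" using g_PO h_PO n_dvd PO_mono by auto
  have c0': "c0 \<in> FF (2 * mu)" using c0 FF_mono by (metis One_nat_def one_dvd)
  have "Psi v \<in> PO (2 * mu)" unfolding Psi_def
  proof (rule PO_sum, clarify)
    fix k i l assume "(k, i, l) \<in> Ix"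
    then show "smult (v (k, i, l) ^ PP) ([:- \<alpha>, 1:] ^ (k * PP + i) * (smult c0 GG - NN) ^ l * GG ^ (p - 1 - l)) \<in> PO (2 * mu)"
      unfolding GG_def NN_def
      by (intro PO_smult FF_power assms PO_mult PO_power PO_linear \<alpha> PO_diff c0' PO_sum gh)
  qed
  moreover have "degree (Psi v) \<le> Dg - 1" unfolding Psi_def
  proof (rule degree_sum_le[OF finite_Ix], clarify)
    fix k i l assume "(k, i, l) \<in> Ix"
    then have ix: "k \<le> pp - 1" "i \<le> pp + d" "l < p" by (auto simp: Ix_def)
    have dd: "degree (smult c0 GG - NN) \<le> d * pp"
      by (intro degree_diff_le deg_NN order.trans[OF degree_smult_le] deg_GG)
    have "degree (smult (v (k, i, l) ^ PP) ([:- \<alpha>, 1:] ^ (k * PP + i) * (smult c0 GG - NN) ^ l * GG ^ (p - 1 - l))) \<le> (k * PP + i) + (p - 1) * (d * pp)"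
      by (intro order.trans[OF degree_smult_le] term_deg dd ix)
    also have "\<dots> \<le> Dg - 1" unfolding Dg_def using ix by (simp add: add_mono)
    finally show "degree (smult (v (k, i, l) ^ PP) ([:- \<alpha>, 1:] ^ (k * PP + i) * (smult c0 GG - NN) ^ l * GG ^ (p - 1 - l))) \<le> Dg - 1" .
  qed
  ultimately show ?thesis by (intro PD_I) (auto simp: Dg_def)
qed

lemma Dg_less: "Dg < card Ix"
  unfolding card_Ix Dg_def PP_pp by (rule stepanov_arith[OF p_gt_1 pp_pos])

lemma Psi_diff: "Psi (\<lambda>x. v x - w x) = Psi v - Psi w"
  unfolding Psi_def sum_subtractf[symmetric]
  by (intro sum.cong refl) (auto simp: frob_diff PP_def smult_diff_left)

text \<open>\<open>Psi\<close> is additive but raises coefficients to the power \<open>PP\<close>,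
  so it is only semilinear; the kernel element therefore comes from counting, as the difference of
  two coefficient vectors with equal image.\<close>

lemma exists_kernel: "\<exists>u. Psi u = 0 \<and> (\<exists>x\<in>Ix. u x \<noteq> 0)"
proof -
  let ?V = "PiE Ix (\<lambda>_. FF (2 * mu))"
  have m2: "2 * mu > 0" using mu by simp
  have card_V: "card ?V = (p ^ (2 * mu)) ^ card Ix"
    using card_PiE[OF finite_Ix, of "\<lambda>_. FF (2 * mu)"] card_FF[OF m2] by simp
  have "Psi ` ?V \<subseteq> PD (2 * mu) Dg" using Psi_PD by (auto simp: PiE_iff)
  then have "card (Psi ` ?V) \<le> (p ^ (2 * mu)) ^ Dg" using card_PD[OF m2] card_mono by metis
  also have "\<dots> < (p ^ (2 * mu)) ^ card Ix"
    using p_gt_1 m2 one_less_power[of p "2 * mu"] by (intro power_strict_increasing Dg_less)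
  finally have "\<not> inj_on Psi ?V" using card_V by (metis card_image nless_le)
  then obtain v w where vw: "v \<in> ?V" "w \<in> ?V" "Psi v = Psi w" "v \<noteq> w" unfolding inj_on_def by blast
  then obtain x where x: "x \<in> Ix" "v x \<noteq> w x" by (meson PiE_ext)
  have "Psi (\<lambda>x. v x - w x) = 0" using vw Psi_diff by simp
  then show ?thesis using x by (intro exI[of _ "\<lambda>x. v x - w x"]) auto
qed

text \<open>As \<open>g\<close> has a simple zero at \<alpha>, \<open>GG\<close> has order
  \<open>pp\<close> there, whereas the last summand of \<open>NN\<close> is free of \<open>g\<close>
  and makes \<open>NN\<close> nonzero. Hence the terms have the pairwise distinct orders
  \<open>?e\<close>.\<close>

lemma WW_nz: assumes "x \<in> Ix" "u x \<noteq> 0" shows "WW u \<noteq> 0"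
proof -
  define g1 where "g1 = PZ (Z - {\<alpha>})"
  have gf: "g = [:- \<alpha>, 1:] * g1" unfolding g1_def by (subst g_eq, rule PZ_remove[OF finite_Z \<alpha>(1)])
  have g1: "poly g1 \<alpha> \<noteq> 0" unfolding g1_def using finite_Z by (simp add: PZ_root)
  have N: "poly NN \<alpha> \<noteq> 0"
  proof -
    have "poly NN \<alpha> = (\<Sum>j<mu. poly h \<alpha> ^ (p ^ j) * 0 ^ (pp - p ^ j))"
      using \<alpha>(1) by (simp add: NN_def poly_sum Z_iff)
    also have "\<dots> = (\<Sum>j\<in>{mu - 1}. poly h \<alpha> ^ (p ^ j) * 0 ^ (pp - p ^ j))"
    proof (rule sum.mono_neutral_right)
      show "\<forall>j\<in>{..<mu} - {mu - 1}. poly h \<alpha> ^ (p ^ j) * 0 ^ (pp - p ^ j) = 0"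
      proof
        fix j assume "j \<in> {..<mu} - {mu - 1}"
        then have "j < mu - 1" by auto
        then have "p ^ j < pp" unfolding pp_def using p_gt_1 by (intro power_strict_increasing) auto
        then show "poly h \<alpha> ^ (p ^ j) * 0 ^ (pp - p ^ j) = 0" by (simp add: power_0_left)
      qed
    qed (use mu in auto)
    finally show ?thesis using h_Z \<alpha>(1) by (simp add: pp_def Z_iff)
  qed
  let ?e = "\<lambda>(k, i, l). k + i * PP + pp * (p - 1 - l)"
  let ?U = "\<lambda>(k, i, l). NN ^ l * g1 ^ (pp * (p - 1 - l))"
  have "WW u = (\<Sum>x\<in>Ix. smult (u x) ([:- \<alpha>, 1:] ^ ?e x * ?U x))"
    unfolding WW_def
  proof (rule sum.cong[OF refl], clarify)
    fix k i l :: nat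
    have "GG = [:- \<alpha>, 1:] ^ pp * g1 ^ pp"
      using arg_cong[OF gf, of "\<lambda>x. x ^ pp"] by (simp only: GG_def power_mult_distrib)
    then have "GG ^ (p - 1 - l) = [:- \<alpha>, 1:] ^ (pp * (p - 1 - l)) * g1 ^ (pp * (p - 1 - l))"
      by (simp only: power_mult power_mult_distrib)
    then have "[:- \<alpha>, 1:] ^ (k + i * PP) * NN ^ l * GG ^ (p - 1 - l) =
       [:- \<alpha>, 1:] ^ (k + i * PP + pp * (p - 1 - l)) * (NN ^ l * g1 ^ (pp * (p - 1 - l)))"
      by (simp only: power_add mult_ac)
    then show "smult (u (k, i, l)) ([:- \<alpha>, 1:] ^ (k + i * PP) * NN ^ l * GG ^ (p - 1 - l)) =
      smult (u (k, i, l)) ([:- \<alpha>, 1:] ^ (k + i * PP + pp * (p - 1 - l)) * (NN ^ l * g1 ^ (pp * (p - 1 - l))))" by (simp only:)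
  qed
  also have "\<dots> \<noteq> 0"
  proof (rule sum_distinct_orders_nz[where v = u and ?i0.0 = x, OF finite_Ix _ _ assms])
    show "poly (?U i) \<alpha> \<noteq> 0" for i using N g1 by (auto split: prod.splits)
    show "inj_on ?e Ix"
    proof (rule inj_onI)
      fix y y' assume y: "y \<in> Ix" "y' \<in> Ix" and eqy: "?e y = ?e y'"
      obtain k i l where y1: "y = (k, i, l)" by (cases y)
      obtain k' i' l' where y2: "y' = (k', i', l')" by (cases y')
      have eq: "k + i * PP + pp * (p - 1 - l) = k' + i' * PP + pp * (p - 1 - l')"
        using eqy unfolding y1 y2 prod.case .
      have b: "k < pp" "k' < pp" "l < p" "l' < p" using y by (auto simp: Ix_def y1 y2)
      have e1: "k + pp * (i * p + (p - 1 - l)) = k' + pp * (i' * p + (p - 1 - l'))"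
        using eq by (simp add: PP_pp algebra_simps)
      have k: "k = k'" using arg_cong[OF e1, of "\<lambda>x. x mod pp"] b by simp
      then have e2: "i * p + (p - 1 - l) = i' * p + (p - 1 - l')" using e1 pp_pos by simp
      have m: "(j * p + y) mod p = y" if "y < p" for j y using that by simp
      have "p - 1 - l < p" "p - 1 - l' < p" using b by linarith+
      then have "p - 1 - l = p - 1 - l'" using m e2 by metis
      then have "l = l'" using b by linarith
      then have "i * p = i' * p" using e2 by simp
      then have "i = i'" using p_gt_1 by simp
      then show "y = y'" using k \<open>l = l'\<close> by (simp add: y1 y2)
    qed
  qed
  finally show ?thesis .
qed

lemma tr_double: "tr p (2 * mu) (x::'k) = tr p mu x + tr p mu x ^ PP"
proof -
  have "tr p (2 * mu) x = (\<Sum>j<mu + mu. x ^ (p ^ j))" by (simp add: tr_def mult_2)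
  also have "\<dots> = (\<Sum>j<mu. x ^ (p ^ j)) + (\<Sum>j<mu. x ^ (p ^ (mu + j)))"
    by (rule sum_lessThan_add)
  also have "(\<Sum>j<mu. x ^ (p ^ (mu + j))) = tr p mu x ^ PP"
  proof -
    have "tr p mu x ^ PP = (\<Sum>j<mu. (x ^ (p ^ j)) ^ (p ^ mu))" unfolding tr_def PP_def by (rule frob_sum)
    then show ?thesis by (simp add: power_add mult.commute flip: power_mult)
  qed
  finally show ?thesis by (simp add: tr_def)
qed

lemma WW_zero:
  assumes "Psi u = 0" "x \<in> FF (2 * mu)" "poly g x \<noteq> 0" "tr p (2 * mu) (f x) = c0"
  shows "poly (WW u) x = 0"
proof -
  define t where "t = tr p mu (f x)"
  define G where "G = poly GG x"
  have G: "G \<noteq> 0" using assms(3) by (simp add: G_def GG_def)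
  have tP: "t ^ PP = c0 - t" using tr_double[of "f x"] assms(4) by (simp add: t_def)
  have N: "poly NN x = t * G"
  proof -
    have "poly NN x = (\<Sum>j<mu. poly h x ^ (p ^ j) * poly g x ^ (pp - p ^ j))" by (simp add: NN_def poly_sum)
    also have "\<dots> = (\<Sum>j<mu. f x ^ (p ^ j) * G)"
    proof (rule sum.cong[OF refl])
      fix j assume "j \<in> {..<mu}"
      then have "p ^ j \<le> pp" using pj_le by auto
      then have "G = poly g x ^ (p ^ j) * poly g x ^ (pp - p ^ j)" by (simp add: G_def GG_def flip: power_add)
      then show "poly h x ^ (p ^ j) * poly g x ^ (pp - p ^ j) = f x ^ (p ^ j) * G"
        using assms(3) by (simp add: f_def power_divide)
    qed
    finally show ?thesis by (simp add: t_def tr_def sum_distrib_right)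
  qed
  have xa: "(x - \<alpha>) ^ (PP * PP) = x - \<alpha>" using FF_diff[OF assms(2) \<alpha>(2)] by (simp add: FF_iff PP_sq)
  have psi: "(\<Sum>(k, i, l)\<in>Ix. u (k, i, l) ^ PP * ((x - \<alpha>) ^ (k * PP + i) * (c0 - t) ^ l)) = 0" (is "?S = 0")
  proof -
    have "0 = poly (Psi u) x" using assms(1) by simp
    also have "\<dots> = (\<Sum>(k, i, l)\<in>Ix. u (k, i, l) ^ PP * ((x - \<alpha>) ^ (k * PP + i) * (c0 * G - t * G) ^ l * G ^ (p - 1 - l)))"
      unfolding Psi_def poly_sum by (intro sum.cong refl) (auto simp: N G_def)
    also have "\<dots> = (\<Sum>(k, i, l)\<in>Ix. G ^ (p - 1) * (u (k, i, l) ^ PP * ((x - \<alpha>) ^ (k * PP + i) * (c0 - t) ^ l)))"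
    proof (rule sum.cong[OF refl], clarify)
      fix k i l assume "(k, i, l) \<in> Ix"
      then have "l + (p - 1 - l) = p - 1" by (auto simp: Ix_def)
      then have "G ^ (p - 1) = G ^ l * G ^ (p - 1 - l)" by (metis power_add)
      moreover have "(c0 * G - t * G) ^ l = (c0 - t) ^ l * G ^ l" by (simp flip: power_mult_distrib left_diff_distrib)
      ultimately show "u (k, i, l) ^ PP * ((x - \<alpha>) ^ (k * PP + i) * (c0 * G - t * G) ^ l * G ^ (p - 1 - l)) =
        G ^ (p - 1) * (u (k, i, l) ^ PP * ((x - \<alpha>) ^ (k * PP + i) * (c0 - t) ^ l))" by (simp only: mult_ac)
    qed
    also have "\<dots> = G ^ (p - 1) * ?S" by (simp add: sum_distrib_left split_def)
    finally show ?thesis using G by simp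
  qed
  have "poly (WW u) x = (\<Sum>(k, i, l)\<in>Ix. G ^ (p - 1) * (u (k, i, l) * ((x - \<alpha>) ^ (k + i * PP) * t ^ l)))"
    unfolding WW_def poly_sum
  proof (rule sum.cong[OF refl], clarify)
    fix k i l assume "(k, i, l) \<in> Ix"
    then have "l + (p - 1 - l) = p - 1" by (auto simp: Ix_def)
    then have "G ^ (p - 1) = G ^ l * G ^ (p - 1 - l)" by (metis power_add)
    then show "poly (smult (u (k, i, l)) ([:- \<alpha>, 1:] ^ (k + i * PP) * NN ^ l * GG ^ (p - 1 - l))) x =
      G ^ (p - 1) * (u (k, i, l) * ((x - \<alpha>) ^ (k + i * PP) * t ^ l))"
      by (simp add: N power_mult_distrib flip: G_def)
  qed
  then have "poly (WW u) x ^ PP = (\<Sum>(k, i, l)\<in>Ix. (G ^ (p - 1) * (u (k, i, l) * ((x - \<alpha>) ^ (k + i * PP) * t ^ l))) ^ PP)"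
    unfolding PP_def by (simp add: frob_sum split_def)
  also have "\<dots> = (\<Sum>(k, i, l)\<in>Ix. (G ^ (p - 1)) ^ PP * (u (k, i, l) ^ PP * ((x - \<alpha>) ^ (k * PP + i) * (c0 - t) ^ l)))"
  proof (rule sum.cong[OF refl], clarify)
    fix k i l :: nat
    \<comment> \<open>The exponent \<open>PP * PP\<close> acts trivially on
      \<open>x - \<alpha>\<close>, so the power \<open>PP\<close> exchanges the roles of
      \<open>k\<close> and \<open>i\<close>. This collapse of \<open>i * PP\<close> to
      \<open>i\<close> keeps the degree of \<open>Psi v\<close> below the number of
      coefficients.\<close>
    have "((x - \<alpha>) ^ (k + i * PP)) ^ PP = (x - \<alpha>) ^ (k * PP) * ((x - \<alpha>) ^ (PP * PP)) ^ i"
      by (simp add: power_add power_mult_distrib algebra_simps flip: power_mult)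
    moreover have "(t ^ l) ^ PP = (c0 - t) ^ l" unfolding tP[symmetric] by (simp add: mult.commute flip: power_mult)
    ultimately show "(G ^ (p - 1) * (u (k, i, l) * ((x - \<alpha>) ^ (k + i * PP) * t ^ l))) ^ PP =
      (G ^ (p - 1)) ^ PP * (u (k, i, l) ^ PP * ((x - \<alpha>) ^ (k * PP + i) * (c0 - t) ^ l))"
      unfolding power_mult_distrib xa by (simp add: power_add)
  qed
  also have "\<dots> = (G ^ (p - 1)) ^ PP * ?S" by (simp add: sum_distrib_left split_def)
  finally show ?thesis using psi PP_pos by simp
qed

text \<open>With \<open>Q = p ^ (2 * mu)\<close> the bound is \<open>Q / p\<close>, the expected
  size of a fibre, plus a multiple of the square root of \<open>Q\<close>.\<close>

lemma stepanov: "card {x \<in> FF (2 * mu). poly g x \<noteq> 0 \<and> tr p (2 * mu) (f x) = c0} \<le> p ^ (mu - 1) * p ^ mu + (2 * d + 1) * p ^ mu"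
proof -
  obtain u x0 where u: "Psi u = 0" "x0 \<in> Ix" "u x0 \<noteq> 0" using exists_kernel by blast
  have nz: "WW u \<noteq> 0" using WW_nz u by blast
  have "card {x \<in> FF (2 * mu). poly g x \<noteq> 0 \<and> tr p (2 * mu) (f x) = c0} \<le> card {x. poly (WW u) x = 0}"
    by (rule card_mono[OF poly_roots_finite[OF nz]]) (use WW_zero[OF u(1)] in blast)
  also have "\<dots> \<le> degree (WW u)" by (rule card_poly_roots_bound[OF nz])
  also have "\<dots> \<le> pp * PP + (2 * d + 1) * PP" by (rule deg_WW)
  finally show ?thesis unfolding pp_def PP_def .
qed

end

end

section \<open>The Riemann hypothesis\<close>

lemma prod_power_le_imp_eq:
  fixes x :: "'a \<Rightarrow> real"
  assumes "finite S" "\<And>z. z \<in> S \<Longrightarrow> 0 \<le> x z \<and> x z \<le> 1" "\<And>z. z \<in> S \<Longrightarrow> m z > 0" "(\<Prod>z\<in>S. x z ^ m z) = 1" "w \<in> S"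
  shows "x w = 1"
proof (rule ccontr)
  assume "x w \<noteq> 1"
  then have lt: "x w < 1" using assms(2)[OF assms(5)] by simp
  have "(\<Prod>z\<in>S. x z ^ m z) = x w ^ m w * (\<Prod>z\<in>S - {w}. x z ^ m z)"
    by (rule prod.remove) (use assms in auto)
  also have "\<dots> \<le> x w ^ m w"
    by (intro mult_left_le prod_le_1) (use assms in \<open>auto intro: power_le_one\<close>)
  also have "x w ^ m w \<le> x w ^ 1" using lt assms(2,3)[OF assms(5)] by (intro power_decreasing) auto
  also have "\<dots> < 1" using lt by simp
  finally show False using assms(4) by simp
qed

context ordAS
begin

lemma sum_psi: "(\<Sum>c\<in>FF (Suc 0). \<psi> c) = 0"
proof -
  obtain c1 where c1: "c1 \<in> FF (Suc 0)" "\<psi> c1 \<noteq> 1" using psi_nontrivial by blast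
  show ?thesis
  proof (rule sum_shift_zero[where s = "\<lambda>x. x + c1" and w = "\<psi> c1"])
    show "bij_betw (\<lambda>x. x + c1) (FF (Suc 0)) (FF (Suc 0))"
      by (rule bij_betw_byWitness[where f' = "\<lambda>x. x - c1"]) (use c1 FF_add FF_diff in auto)
  qed (use c1 psi_add in auto)
qed

text \<open>Stepanov bounds each fibre only from above, but the fibres together make up all points.
  As \<open>\<psi>\<close> sums to 0, the common bound \<open>B\<close> may be subtracted from every
  \<open>N c\<close>, and the nonnegative defects \<open>B - N c\<close> add up to only
  \<open>O(p ^ mu)\<close>.\<close>

lemma char_sum_bound:
  assumes mu: "mu > 0" and nr: "n * r = 2 * mu" and \<alpha>: "\<alpha> \<in> Z" "\<alpha> \<in> FF (2 * mu)"
  shows "norm (char_sum p n \<psi> h g r) \<le> real (p * (2 * d + 1) + d + 1) * real (p ^ mu)"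
proof -
  define X where "X = {x \<in> FF (2 * mu). poly g x \<noteq> 0}"
  define N where "N c = real (card {x \<in> X. tr p (2 * mu) (f x) = c})" for c
  define B where "B = real (p ^ (mu - 1) * p ^ mu + (2 * d + 1) * p ^ mu)"
  have m2: "2 * mu > 0" using mu by simp
  have ndvd: "n dvd 2 * mu" using nr by (metis dvd_triv_left)
  have r0: "r > 0" using nr mu by (metis gr0I mult_0_right mult_eq_0_iff zero_neq_numeral nat_less_le)
  have finX: "finite X" unfolding X_def using card_FF(2)[OF m2] by auto
  have gh: "g \<in> PO (2 * mu)" "h \<in> PO (2 * mu)" using g_PO h_PO ndvd PO_mono by auto
  have trF: "tr p (2 * mu) (f x) \<in> FF (Suc 0)" if "x \<in> X" for x
    using that gh unfolding X_def f_def by (auto intro!: tr_in_FF FF_divide PO_poly)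
  have NB: "N c \<le> B" if "c \<in> FF (Suc 0)" for c
  proof -
    have "{x \<in> X. tr p (2 * mu) (f x) = c} = {x \<in> FF (2 * mu). poly g x \<noteq> 0 \<and> tr p (2 * mu) (f x) = c}"
      by (auto simp: X_def)
    then show ?thesis unfolding N_def B_def using stepanov[OF mu ndvd \<alpha> that] by (simp only: of_nat_le_iff)
  qed
  have fin1: "finite (FF (Suc 0))" "card (FF (Suc 0)) = p" using card_FF[of "Suc 0"] by auto
  have sumN: "(\<Sum>c\<in>FF (Suc 0). N c) = real (card X)"
  proof -
    have "(\<Sum>c\<in>FF (Suc 0). \<Sum>x\<in>{x \<in> X. tr p (2 * mu) (f x) = c}. 1) = (\<Sum>x\<in>X. 1::real)"
      by (rule sum.group) (use finX fin1 trF in auto)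
    then show ?thesis by (simp add: N_def)
  qed
  have "(\<Sum>x\<in>X. \<psi> (tr p (2 * mu) (f x))) = (\<Sum>c\<in>FF (Suc 0). \<Sum>x\<in>{x \<in> X. tr p (2 * mu) (f x) = c}. \<psi> (tr p (2 * mu) (f x)))"
    by (rule sum.group[symmetric]) (use finX fin1 trF in auto)
  also have "\<dots> = (\<Sum>c\<in>FF (Suc 0). of_real (N c) * \<psi> c)"
    by (rule sum.cong) (auto simp: N_def)
  also have "\<dots> = (\<Sum>c\<in>FF (Suc 0). of_real (N c - B) * \<psi> c)"
    using sum_psi by (simp add: left_diff_distrib sum_subtractf flip: sum_distrib_left)
  also have "norm \<dots> \<le> (\<Sum>c\<in>FF (Suc 0). B - N c)"
  proof (rule order.trans[OF norm_sum sum_mono])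
    fix c assume c: "c \<in> FF (Suc 0)"
    have "norm (complex_of_real (N c - B) * \<psi> c) = \<bar>N c - B\<bar>" using psi_norm[OF c] by (simp only: norm_mult norm_of_real mult_1_right)
    then show "norm (complex_of_real (N c - B) * \<psi> c) \<le> B - N c" using NB[OF c] by simp
  qed
  also have "\<dots> = real p * B - real (card X)" using fin1 sumN by (simp add: sum_subtractf)
  also have "\<dots> \<le> real (p * (2 * d + 1) + d) * real (p ^ mu)"
  proof -
    have "X = FF (2 * mu) - Z" by (auto simp: X_def Z_iff)
    then have "card X \<ge> p ^ (2 * mu) - d"
      using card_FF[OF m2] diff_card_le_card_Diff[OF finite_Z, of "FF (2 * mu)"] card_Z g_deg by auto
    then have "real (card X) \<ge> real (p ^ (2 * mu)) - real d" by linarith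
    moreover have "p ^ (2 * mu) = p * (p ^ (mu - 1) * p ^ mu)"
      using mu by (cases mu) (auto simp: power_add mult_2)
    then have "real p * B = real (p ^ (2 * mu)) + real (p * (2 * d + 1)) * real (p ^ mu)"
      by (simp add: B_def algebra_simps)
    moreover have "real d * 1 \<le> real d * real (p ^ mu)" by (intro mult_left_mono) (use p_gt_1 in \<open>auto simp: one_le_power\<close>)
    ultimately show ?thesis unfolding of_nat_add distrib_right by linarith
  qed
  finally have 1: "norm (\<Sum>x\<in>X. \<psi> (tr p (2 * mu) (f x))) \<le> real (p * (2 * d + 1) + d) * real (p ^ mu)" .
  have cs: "char_sum p n \<psi> h g r = (\<Sum>x\<in>X. \<psi> (tr p (2 * mu) (f x))) + winf ^ r"
  proof -
    have "char_sum p n \<psi> h g r - winf ^ r = Sfin r" using char_sum_eq[OF r0] by simp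
    moreover have "Sfin r = (\<Sum>x\<in>X. \<psi> (tr p (2 * mu) (f x)))"
      using Sfin_alt[OF r0] unfolding nr X_def .
    ultimately show ?thesis by (simp add: algebra_simps)
  qed
  have "norm (winf ^ r) \<le> 1"
    using chr_norm[OF c_FF] r0 by (auto simp: winf_def norm_power power_0_left)
  also have "1 \<le> real (p ^ mu)" using p_gt_1 by (simp add: one_le_power)
  finally have 2: "norm (winf ^ r) \<le> real (p ^ mu)" .
  have "norm (char_sum p n \<psi> h g r) \<le> norm (\<Sum>x\<in>X. \<psi> (tr p (2 * mu) (f x))) + norm (winf ^ r)"
    unfolding cs by (rule norm_triangle_ineq)
  also have "\<dots> \<le> real (p * (2 * d + 1) + d) * real (p ^ mu) + real (p ^ mu)" using 1 2 by simp
  finally show ?thesis by (simp add: algebra_simps)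
qed

section \<open>Inverse roots of the L-function and their power sums\<close>

definition LL where "LL = L_poly p n \<psi> h g"
definition RR where "RR = reflect_poly LL"

lemma LL0: "coeff LL 0 = 1"
proof -
  have "fps_nth (L_fps p n \<psi> h g) 0 = 1" by (simp add: L_fps_def)
  then show ?thesis using L_fps_eq by (simp add: LL_def L_poly_coeff)
qed

lemma LL_nz: "LL \<noteq> 0" using LL0 by auto

lemma RR_degree: "degree RR = kt" and RR_lead: "lead_coeff RR = 1" and RR_nz: "RR \<noteq> 0"
proof -
  show "degree RR = kt" using LL0 L_poly_degree by (simp add: RR_def LL_def)
  show "lead_coeff RR = 1" using LL0 by (simp add: RR_def coeff_reflect_poly)
  show "RR \<noteq> 0" using LL_nz by (simp add: RR_def)
qed

lemma RR_decomp: "RR = (\<Prod>z | poly RR z = 0. [:- z, 1:] ^ order z RR)"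
  using complex_poly_decompose[of RR] RR_lead by simp

lemma RR_root_nz: "poly RR z = 0 \<Longrightarrow> z \<noteq> 0"
  using LL_nz by (auto simp: RR_def)

lemma sum_order_RR: "(\<Sum>z | poly RR z = 0. order z RR) = kt"
proof -
  have "degree RR = (\<Sum>z | poly RR z = 0. degree ([:- z, 1:] ^ order z RR))"
    by (subst RR_decomp) (subst degree_prod_eq_sum_degree, auto)
  then show ?thesis by (simp add: RR_degree degree_power_eq)
qed

lemma LL_fps: "fps_of_poly LL = (\<Prod>z | poly RR z = 0. (1 - fps_const z * fps_X) ^ order z RR)"
proof -
  have "LL = reflect_poly RR" using LL0 by (simp add: RR_def)
  also have "\<dots> = (\<Prod>z | poly RR z = 0. reflect_poly [:- z, 1:] ^ order z RR)"
    by (subst RR_decomp) (simp add: reflect_poly_prod reflect_poly_power)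
  also have "\<dots> = (\<Prod>z | poly RR z = 0. [:1, - z:] ^ order z RR)"
    by (rule prod.cong[OF refl]) (use RR_root_nz in \<open>auto simp: reflect_poly_pCons\<close>)
  finally have "LL = (\<Prod>z | poly RR z = 0. [:1, - z:] ^ order z RR)" .
  then have "fps_of_poly LL = fps_of_poly (\<Prod>z | poly RR z = 0. [:1, - z:] ^ order z RR)" by simp
  also have "\<dots> = (\<Prod>z | poly RR z = 0. fps_of_poly [:1, - z:] ^ order z RR)"
    by (simp add: fps_of_poly_prod fps_of_poly_power)
  also have "\<dots> = (\<Prod>z | poly RR z = 0. (1 - fps_const z * fps_X) ^ order z RR)"
    by (rule prod.cong[OF refl]) (simp add: fps_of_poly_pCons fps_const_neg[symmetric] del: fps_const_neg)
  finally show ?thesis .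
qed

text \<open>The logarithmic derivative of the L-function is computed twice: from its definition as
  an exponential and from the factorization \<open>LL_fps\<close>.\<close>

lemma newton_power_sum: assumes "r > 0"
  shows "(\<Sum>z | poly RR z = 0. of_nat (order z RR) * z ^ r) = - char_sum p n \<psi> h g r"
proof -
  define A where "A = Abs_fps (\<lambda>r. if r = 0 then 0 else char_sum p n \<psi> h g r / of_nat r)"
  have L: "fps_of_poly LL = fps_exp 1 oo A"
    unfolding A_def L_fps_def[symmetric] L_fps_eq by (simp add: fps_eq_iff LL_def L_poly_coeff)
  have "fps_nth A 0 = 0" by (simp add: A_def)
  then have 1: "fps_deriv (fps_of_poly LL) = fps_of_poly LL * fps_deriv A" unfolding L by (simp add: fps_compose_deriv)
  have 2: "fps_deriv (fps_of_poly LL) = fps_of_poly LL * Abs_fps (\<lambda>r. - (\<Sum>z | poly RR z = 0. of_nat (order z RR) * z ^ Suc r))"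
    unfolding LL_fps by (rule power_sums_from_logderiv) (rule poly_roots_finite[OF RR_nz])
  have 3: "fps_of_poly LL \<noteq> 0" using LL_nz by simp
  have "fps_deriv A = Abs_fps (\<lambda>r. - (\<Sum>z | poly RR z = 0. of_nat (order z RR) * z ^ Suc r))"
    by (rule mult_left_cancel[OF 3, THEN iffD1]) (rule trans[OF 1[symmetric] 2])
  then have "fps_nth (fps_deriv A) (r - 1) = - (\<Sum>z | poly RR z = 0. of_nat (order z RR) * z ^ Suc (r - 1))" by simp
  then show ?thesis using assms by (simp add: A_def del: of_nat_Suc power_Suc)
qed

text \<open>\<open>char_sum_bound\<close> asks for an even degree over the prime field and for a
  pole rational over the field, so only the extension degrees \<open>2 * r1 * s\<close> are used;
  \<open>power_sum_bound\<close> then removes the constant.\<close>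

lemma riemann_upper: assumes "poly RR z = 0" shows "norm z \<le> sqrt (real (p ^ n))"
proof -
  obtain \<alpha> where \<alpha>: "\<alpha> \<in> Z" using Z_nonempty by blast
  then obtain r1 where r1: "r1 > 0" "\<alpha> \<in> FF (n * r1)" using roots_in_FF[OF g_PO g_nz _ n_pos] by (auto simp: Z_iff)
  define C where "C = real (p * (2 * d + 1) + d + 1)"
  have "norm z ^ (2 * r1) \<le> real (p ^ n) ^ r1"
  proof (rule power_sum_bound[where S = "{z. poly RR z = 0}" and m = "\<lambda>z. order z RR" and C = C])
    show "finite {z. poly RR z = 0}" by (rule poly_roots_finite[OF RR_nz])
    show "order w RR > 0" if "w \<in> {z. poly RR z = 0}" for w using that RR_nz by (simp add: order_gt_0_iff)
    show "real (p ^ n) ^ r1 > 0" using p_gt_1 by simp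
    show "z \<in> {z. poly RR z = 0}" using assms by simp
    fix s :: nat assume s: "s > 0"
    have "norm (char_sum p n \<psi> h g (2 * r1 * s)) \<le> C * real (p ^ (n * r1 * s))"
      unfolding C_def
    proof (rule char_sum_bound[OF _ _ \<alpha>])
      show "n * r1 * s > 0" using n_pos r1 s by simp
      show "\<alpha> \<in> FF (2 * (n * r1 * s))" using r1(2) by (rule FF_mono) simp
    qed simp
    moreover have "(\<Sum>z | poly RR z = 0. of_nat (order z RR) * (z ^ (2 * r1)) ^ s) = - char_sum p n \<psi> h g (2 * r1 * s)"
      using newton_power_sum[of "2 * r1 * s"] r1 s by (simp add: power_mult)
    ultimately show "norm (\<Sum>z\<in>{z. poly RR z = 0}. of_nat (order z RR) * (z ^ (2 * r1)) ^ s) \<le> C * (real (p ^ n) ^ r1) ^ s"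
      by (simp add: power_mult)
  qed
  also have "real (p ^ n) ^ r1 = sqrt (real (p ^ n)) ^ (2 * r1)" by (simp only: power_mult real_sqrt_pow2 of_nat_0_le_iff)
  finally show ?thesis using r1 by (simp add: power_mono_iff)
qed

lemma riemann: assumes "poly RR z = 0" shows "norm z = sqrt (real (p ^ n))"
proof -
  let ?s = "sqrt (real (p ^ n))"
  have s: "?s > 0" using p_gt_1 by simp
  have fin: "finite {z. poly RR z = 0}" by (rule poly_roots_finite[OF RR_nz])
  have "norm (poly RR 0) = real (p ^ n) ^ (d - 1)"
    using Lk_top L_poly_degree L_poly_coeff by (simp add: RR_def LL_def)
  also have "\<dots> = ?s ^ kt"
  proof -
    have "kt = 2 * (d - 1)" by simp
    then show ?thesis by (simp only: power_mult real_sqrt_pow2 of_nat_0_le_iff)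
  qed
  finally have 1: "norm (poly RR 0) = ?s ^ kt" .
  have "poly RR 0 = (\<Prod>z | poly RR z = 0. (- z) ^ order z RR)"
    by (subst RR_decomp) (simp add: poly_prod)
  then have "norm (poly RR 0) = (\<Prod>z | poly RR z = 0. norm z ^ order z RR)"
    by (simp add: norm_power prod_norm[symmetric])
  moreover have "?s ^ kt = (\<Prod>z | poly RR z = 0. ?s ^ order z RR)"
    by (subst sum_order_RR[symmetric]) (rule power_sum)
  ultimately have "(\<Prod>z | poly RR z = 0. norm z ^ order z RR) = (\<Prod>z | poly RR z = 0. ?s ^ order z RR)" using 1 by simp
  then have "(\<Prod>z | poly RR z = 0. (norm z / ?s) ^ order z RR) = 1"
    using s fin p_gt_1 by (simp add: power_divide prod_dividef)
  then have "norm z / ?s = 1"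
    using prod_power_le_imp_eq[OF fin, of "\<lambda>z. norm z / ?s" "\<lambda>z. order z RR" z] riemann_upper s assms RR_nz
      RR_root_nz[OF assms] by (simp add: order_gt_0_iff)
  then show ?thesis using s by simp
qed

end

section \<open>Counting polynomials whose derivative has prescribed factors\<close>

context ffield
begin

definition degs :: "'k poly set \<Rightarrow> nat set" where "degs W = {degree P |P. P \<in> W \<and> P \<noteq> 0}"

lemma PD_Suc_coeff_0: "P \<in> PD n (Suc k) \<Longrightarrow> coeff P k = 0 \<Longrightarrow> P \<in> PD n k"
  unfolding PD_def by auto (metis Suc_leI le_neq_implies_less)

text \<open>Echelon form: elements of equal degree are proportional modulo lower degree, so each
  degree that occurs contributes one dimension.\<close>

lemma card_subspace:
  assumes n: "n > 0" and W: "W \<subseteq> PO n" "0 \<in> W" "\<And>P Q. P \<in> W \<Longrightarrow> Q \<in> W \<Longrightarrow> P + Q \<in> W"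
    "\<And>P Q. P \<in> W \<Longrightarrow> Q \<in> W \<Longrightarrow> P - Q \<in> W" "\<And>y P. y \<in> FF n \<Longrightarrow> P \<in> W \<Longrightarrow> smult y P \<in> W"
  shows "card (W \<inter> PD n k) = (p ^ n) ^ card (degs W \<inter> {..<k})"
proof (induction k)
  case 0
  have "W \<inter> PD n 0 = {0}" using W by (auto simp: PD_0)
  then show ?case by simp
next
  case (Suc k)
  show ?case
  proof (cases "k \<in> degs W")
    case True
    then obtain P1 where P1: "P1 \<in> W" "P1 \<noteq> 0" "degree P1 = k" by (auto simp: degs_def)
    have c1: "coeff P1 k \<noteq> 0" "coeff P1 k \<in> FF n" using P1 W(1) PO_coeff by auto
    have P1D: "P1 \<in> PD n (Suc k)" using P1 W(1) by (auto simp: PD_iff_degree)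
    have ck: "coeff P k \<in> FF n" if "P \<in> PD n (Suc k)" for P using that PO_coeff by (auto simp: PD_def)
    have "bij_betw (\<lambda>(y, P). smult y P1 + P) (FF n \<times> (W \<inter> PD n k)) (W \<inter> PD n (Suc k))"
    proof (rule bij_betw_byWitness[where f' = "\<lambda>P. (coeff P k / coeff P1 k, P - smult (coeff P k / coeff P1 k) P1)"])
      show "\<forall>x\<in>FF n \<times> (W \<inter> PD n k). (\<lambda>P. (coeff P k / coeff P1 k, P - smult (coeff P k / coeff P1 k) P1)) ((\<lambda>(y, P). smult y P1 + P) x) = x"
        using c1 by (auto simp: PD_def)
      show "\<forall>P\<in>W \<inter> PD n (Suc k). (\<lambda>(y, P). smult y P1 + P) (coeff P k / coeff P1 k, P - smult (coeff P k / coeff P1 k) P1) = P"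
        by auto
      show "(\<lambda>(y, P). smult y P1 + P) ` (FF n \<times> (W \<inter> PD n k)) \<subseteq> W \<inter> PD n (Suc k)"
        using P1 P1D W by (auto intro!: PD_add PD_smult) (auto simp: PD_def)
      show "(\<lambda>P. (coeff P k / coeff P1 k, P - smult (coeff P k / coeff P1 k) P1)) ` (W \<inter> PD n (Suc k)) \<subseteq> FF n \<times> (W \<inter> PD n k)"
      proof (intro image_subsetI)
        fix P assume P: "P \<in> W \<inter> PD n (Suc k)"
        let ?y = "coeff P k / coeff P1 k"
        have y: "?y \<in> FF n" using P ck c1 by (auto intro: FF_divide)
        have "P - smult ?y P1 \<in> PD n (Suc k)" using P P1D y by (auto intro: PD_diff PD_smult)
        moreover have "coeff (P - smult ?y P1) k = 0" using c1 by simp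
        ultimately have "P - smult ?y P1 \<in> PD n k" by (rule PD_Suc_coeff_0)
        then show "(?y, P - smult ?y P1) \<in> FF n \<times> (W \<inter> PD n k)" using y P P1 W by auto
      qed
    qed
    then have "card (W \<inter> PD n (Suc k)) = p ^ n * card (W \<inter> PD n k)"
      using bij_betw_same_card card_FF[OF n] by (metis card_cartesian_product)
    moreover have "degs W \<inter> {..<Suc k} = insert k (degs W \<inter> {..<k})" using True by (auto simp: lessThan_Suc)
    ultimately show ?thesis using Suc by simp
  next
    case False
    have "P \<in> PD n k" if "P \<in> W" "P \<in> PD n (Suc k)" for P
    proof (cases "P = 0")
      case nz: False
      have "degree P \<noteq> k" using False that nz by (auto simp: degs_def)
      then have "degree P < k" using that by (auto simp: PD_iff_degree)
      then show ?thesis using that by (auto intro: PD_I PD_PO)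
    qed simp
    then have "W \<inter> PD n (Suc k) = W \<inter> PD n k" by (auto simp: PD_def)
    moreover have "degs W \<inter> {..<Suc k} = degs W \<inter> {..<k}" using False by (auto simp: lessThan_Suc)
    ultimately show ?thesis using Suc by simp
  qed
qed

end

lemma card_block_le:
  fixes A :: "nat set"
  assumes "\<And>j. j < m \<Longrightarrow> card (A \<inter> {p * j..<p * Suc j}) \<le> c j"
  shows "card (A \<inter> {..<p * m}) \<le> (\<Sum>j<m. c j)"
  using assms
proof (induction m)
  case (Suc m)
  have "A \<inter> {..<p * Suc m} = (A \<inter> {..<p * m}) \<union> (A \<inter> {p * m..<p * Suc m})" by auto
  then have "card (A \<inter> {..<p * Suc m}) \<le> card (A \<inter> {..<p * m}) + card (A \<inter> {p * m..<p * Suc m})"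
    by (simp only: card_Un_le)
  also have "\<dots> \<le> (\<Sum>j<m. c j) + c m" using Suc by (intro add_mono) auto
  finally show ?case by simp
qed simp

lemma card_multiples_block:
  fixes A :: "nat set"
  assumes "p > 0" "\<And>e. e \<in> A \<Longrightarrow> e < p * Suc j \<Longrightarrow> p dvd e"
  shows "card (A \<inter> {p * j..<p * Suc j}) \<le> 1"
proof -
  have "A \<inter> {p * j..<p * Suc j} \<subseteq> {p * j}"
  proof
    fix e assume e: "e \<in> A \<inter> {p * j..<p * Suc j}"
    then obtain t where "e = p * t" using assms(2) by (auto elim!: dvdE)
    then have "p * j \<le> p * t" "p * t < p * Suc j" using e by auto
    then have "t = j" using assms(1) by (simp only: mult_le_cancel1 mult_less_cancel1) auto
    then show "e \<in> {p * j}" using \<open>e = p * t\<close> by simp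
  qed
  then show ?thesis by (metis card.empty card_insert_disjoint card_mono empty_iff finite.intros One_nat_def)
qed

text \<open>\<open>A\<close> is the set of degrees of a module over the polynomials in \<open>x ^ p\<close>: as soon as
  one block of length \<open>p\<close> is full, all later degrees occur.\<close>

lemma card_degrees_dichotomy:
  fixes A :: "nat set"
  assumes p: "p > 0" and step: "\<And>e. e \<in> A \<Longrightarrow> e + p \<in> A" and small: "\<And>e. e \<in> A \<Longrightarrow> e \<le> N \<Longrightarrow> p dvd e"
    and big: "\<And>k. k \<ge> 2 * N \<Longrightarrow> card (A \<inter> {..<k}) + N \<le> k" and N: "N < p * m"
  shows "card (A \<inter> {..<p * m}) + N \<le> p * m \<or> card (A \<inter> {..<p * m}) \<le> N div p + (m - N div p) * (p - 1)"
proof (cases "\<exists>j<m. {p * j..<p * Suc j} \<subseteq> A")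
  case True
  then obtain j where j: "j < m" "{p * j..<p * Suc j} \<subseteq> A" by blast
  have all: "e \<in> A" if "e \<ge> p * j" for e
    using that
  proof (induction e rule: less_induct)
    case (less e)
    show ?case
    proof (cases "e < p * Suc j")
      case True
      then show ?thesis using less j by auto
    next
      case False
      then have "e - p \<in> A" using less p by (intro less.IH) auto
      then show ?thesis using step[of "e - p"] False p by auto
    qed
  qed
  \<comment> \<open>All degrees from \<open>p * j\<close> on occur, so the window of length
    \<open>2 * N\<close> above \<open>p * m\<close> is full. It makes \<open>big\<close> applicable
    at \<open>?K\<close>, and the \<open>N\<close> missing degrees must then lie below
    \<open>p * m\<close>.\<close>
  let ?K = "p * m + 2 * N"
  have "A \<inter> {..<?K} = (A \<inter> {..<p * m}) \<union> {p * m..<?K}"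
  proof -
    have "p * j \<le> p * m" using j by simp
    then have "x \<in> A" if "p * m \<le> x" for x using all[OF order.trans[OF _ that]] by blast
    then show ?thesis by auto
  qed
  then have "card (A \<inter> {..<?K}) = card ((A \<inter> {..<p * m}) \<union> {p * m..<?K})" by (rule arg_cong)
  also have "\<dots> = card (A \<inter> {..<p * m}) + card {p * m..<?K}" by (rule card_Un_disjoint) auto
  finally have "card (A \<inter> {..<?K}) = card (A \<inter> {..<p * m}) + 2 * N" by simp
  then show ?thesis using big[of ?K] by auto
next
  case False
  let ?a = "N div p"
  have a: "?a \<le> m" using less_mult_imp_div_less[of N m p] N by (simp add: mult.commute)
  \<comment> \<open>No block is full. A block that ends at or before \<open>N\<close> holds at most
    its multiple of \<open>p\<close>, every other block misses at least one degree.\<close>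
  have "card (A \<inter> {..<p * m}) \<le> (\<Sum>j<m. if j < ?a then 1 else p - 1)"
  proof (rule card_block_le)
    fix j assume j: "j < m"
    show "card (A \<inter> {p * j..<p * Suc j}) \<le> (if j < ?a then 1 else p - 1)"
    proof (cases "j < ?a")
      case True
      have "p * Suc j \<le> p * ?a" using True by (intro mult_le_mono2) simp
      also have "\<dots> \<le> N" by simp
      finally have "p dvd e" if "e \<in> A" "e < p * Suc j" for e using small that by auto
      then show ?thesis using True card_multiples_block[OF p] by simp
    next
      case notlt: False
      have "\<not> {p * j..<p * Suc j} \<subseteq> A" using False j by blast
      then have "A \<inter> {p * j..<p * Suc j} \<subset> {p * j..<p * Suc j}" by blast
      then have "card (A \<inter> {p * j..<p * Suc j}) < card {p * j..<p * Suc j}" by (intro psubset_card_mono) auto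
      then show ?thesis using notlt by simp
    qed
  qed
  also have "\<dots> = (\<Sum>j\<in>{..<?a}. 1) + (\<Sum>j\<in>{?a..<m}. p - 1)"
  proof -
    have "{..<m} = {..<?a} \<union> {?a..<m}" using a by auto
    then have "(\<Sum>j<m. if j < ?a then 1 else p - 1) = (\<Sum>j\<in>{..<?a} \<union> {?a..<m}. if j < ?a then 1 else p - 1)" by simp
    also have "\<dots> = (\<Sum>j\<in>{..<?a}. if j < ?a then 1 else p - 1) + (\<Sum>j\<in>{?a..<m}. if j < ?a then 1 else p - 1)"
      by (rule sum.union_disjoint) auto
    finally show ?thesis by simp
  qed
  finally show ?thesis by simp
qed

section \<open>Polynomials whose derivative is divisible by a given product\<close>

context ffield
begin

text \<open>Since \<open>x ^ p\<close> has derivative 0, both are modules over the polynomials in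
  \<open>x ^ p\<close> with coefficients in \<open>FF n\<close>; \<open>W0\<close> consists of these
  polynomials themselves.\<close>

definition WD :: "nat \<Rightarrow> 'k set \<Rightarrow> 'k poly set" where "WD n S = {P \<in> PO n. PZ S dvd pderiv P}"
definition W0 :: "nat \<Rightarrow> 'k poly set" where "W0 n = {P \<in> PO n. pderiv P = 0}"

lemma WD_subspace: "WD n S \<subseteq> PO n" "0 \<in> WD n S" "P \<in> WD n S \<Longrightarrow> Q \<in> WD n S \<Longrightarrow> P + Q \<in> WD n S"
    "P \<in> WD n S \<Longrightarrow> Q \<in> WD n S \<Longrightarrow> P - Q \<in> WD n S" "y \<in> FF n \<Longrightarrow> P \<in> WD n S \<Longrightarrow> smult y P \<in> WD n S"
  by (auto simp: WD_def pderiv_add pderiv_diff pderiv_smult PO_add PO_diff PO_smult dvd_smult)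

lemma W0_subspace: "W0 n \<subseteq> PO n" "0 \<in> W0 n" "P \<in> W0 n \<Longrightarrow> Q \<in> W0 n \<Longrightarrow> P + Q \<in> W0 n"
    "P \<in> W0 n \<Longrightarrow> Q \<in> W0 n \<Longrightarrow> P - Q \<in> W0 n" "y \<in> FF n \<Longrightarrow> P \<in> W0 n \<Longrightarrow> smult y P \<in> W0 n"
  by (auto simp: W0_def pderiv_add pderiv_diff pderiv_smult PO_add PO_diff PO_smult)

lemma pderiv_0_degree: assumes "pderiv P = 0" shows "p dvd degree (P::'k poly)"
proof (cases "degree P")
  case (Suc k)
  have "coeff (pderiv P) k = of_nat (Suc k) * coeff P (Suc k)" by (rule coeff_pderiv)
  then have "of_nat (Suc k) * lead_coeff P = 0" using assms Suc by simp
  moreover have "lead_coeff P \<noteq> 0" using Suc by (metis degree_0 leading_coeff_0_iff nat.distinct(1))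
  ultimately have "of_nat (degree P) = (0::'k)" unfolding Suc by (simp only: mult_eq_0_iff) auto
  then show ?thesis using char_k of_nat_eq_0_iff_char_dvd by blast
qed simp

lemma degree_pderiv_less: "pderiv P \<noteq> 0 \<Longrightarrow> degree (pderiv P) < degree (P::'k poly)"
proof -
  assume nz: "pderiv P \<noteq> 0"
  then have pos: "degree P > 0" by (metis degree_eq_zeroE gr0I pderiv_singleton)
  have "degree (pderiv P) \<le> degree P - 1"
    by (rule degree_le) (auto simp: coeff_pderiv coeff_eq_0)
  then show ?thesis using pos by simp
qed

lemma card_W0: assumes "n > 0" shows "card (W0 n \<inter> PD n (p * m)) \<le> (p ^ n) ^ m"
proof -
  have "card (degs (W0 n) \<inter> {..<p * m}) \<le> (\<Sum>j<m. 1)"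
    by (intro card_block_le card_multiples_block) (use p_gt_1 pderiv_0_degree in \<open>auto simp: degs_def W0_def\<close>)
  then have "(p ^ n) ^ card (degs (W0 n) \<inter> {..<p * m}) \<le> (p ^ n) ^ m"
    using pm_pos by (intro power_increasing) (auto simp: Suc_le_eq)
  then show ?thesis using card_subspace[OF assms W0_subspace] by simp
qed

text \<open>Multiplication by \<open>x ^ p\<close> is the step for
  \<open>card_degrees_dichotomy\<close>, and a degree of at most \<open>card S\<close> leaves no
  room for a nonzero derivative. The codimension \<open>card S\<close> for large \<open>k\<close>
  comes from the multiples \<open>PZ S * C\<close> with \<open>degree C < card S\<close>, which are
  independent modulo \<open>WD\<close>: on \<open>S\<close> the derivative of
  \<open>PZ S * E\<close> is \<open>(PZ S)' * E\<close>, so \<open>E\<close> would vanish on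
  \<open>S\<close>.\<close>

lemma card_WD: assumes n: "n > 0" and S: "finite S" "PZ S \<in> PO n" and N: "card S < p * m"
  defines "u \<equiv> card (degs (WD n S) \<inter> {..<p * m})"
  shows "card (WD n S \<inter> PD n (p * m)) = (p ^ n) ^ u"
    "u + card S \<le> p * m \<or> u \<le> card S div p + (m - card S div p) * (p - 1)"
proof -
  let ?N = "card S"
  have cs: "card (WD n S \<inter> PD n k) = (p ^ n) ^ card (degs (WD n S) \<inter> {..<k})" for k
    by (rule card_subspace[OF n WD_subspace])
  then show "card (WD n S \<inter> PD n (p * m)) = (p ^ n) ^ u" by (simp add: u_def)
  show "u + ?N \<le> p * m \<or> u \<le> ?N div p + (m - ?N div p) * (p - 1)"
    unfolding u_def
  proof (rule card_degrees_dichotomy[OF _ _ _ _ N])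
    show "p > 0" using p_gt_1 by simp
    fix e assume "e \<in> degs (WD n S)"
    then obtain P where P: "P \<in> PO n" "PZ S dvd pderiv P" "P \<noteq> 0" "e = degree P" by (auto simp: degs_def WD_def)
    have "pderiv (monom (1::'k) p) = 0" by (simp add: pderiv_monom)
    then have "pderiv (P * monom 1 p) = pderiv P * monom 1 p" by (simp add: pderiv_mult)
    then have "P * monom 1 p \<in> WD n S" using P by (auto simp: WD_def intro!: PO_mult PO_monom)
    moreover have "degree (P * monom 1 p) = e + p" using P by (subst degree_mult_eq) (auto simp: degree_monom_eq)
    moreover have "P * monom 1 p \<noteq> 0" using P by simp
    ultimately show "e + p \<in> degs (WD n S)" unfolding degs_def by force
    assume e: "e \<le> ?N"
    have "pderiv P = 0"
    proof (rule ccontr)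
      assume nz: "pderiv P \<noteq> 0"
      then have "?N \<le> degree (pderiv P)" using dvd_imp_degree_le[OF P(2)] by simp
      then show False using degree_pderiv_less[OF nz] e P(4) by simp
    qed
    then show "p dvd e" using pderiv_0_degree P(4) by simp
  next
    fix k assume k: "k \<ge> 2 * ?N"
    let ?A = "(WD n S \<inter> PD n k) \<times> PD n ?N"
    have "inj_on (\<lambda>(P, C). P + PZ S * C) ?A"
    proof (rule inj_onI)
      fix x y assume xy: "x \<in> ?A" "y \<in> ?A" "(\<lambda>(P, C). P + PZ S * C) x = (\<lambda>(P, C). P + PZ S * C) y"
      obtain P C where x: "x = (P, C)" by (cases x)
      obtain P' C' where y: "y = (P', C')" by (cases y)
      have mem: "PZ S dvd pderiv P" "PZ S dvd pderiv P'" "C \<in> PD n ?N" "C' \<in> PD n ?N"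
        using xy by (auto simp: x y WD_def)
      define E where "E = C' - C"
      have eq: "P - P' = PZ S * E" using xy(3) by (simp add: x y E_def algebra_simps)
      have "PZ S dvd pderiv P - pderiv P'" using mem by (intro dvd_diff)
      also have "pderiv P - pderiv P' = pderiv (PZ S * E)" by (simp flip: eq add: pderiv_diff)
      finally have dvd: "PZ S dvd pderiv (PZ S * E)" .
      have E0: "poly E z = 0" if z: "z \<in> S" for z
      proof -
        have r: "poly (PZ S) z = 0" using z S by (simp add: PZ_root)
        then have "poly (pderiv (PZ S * E)) z = 0" using dvd by (metis dvdE mult_zero_left poly_mult)
        then have "poly (pderiv (PZ S)) z * poly E z = 0" using r by (auto simp: pderiv_mult)
        then show ?thesis using PZ_pderiv_nz[OF S(1) z] by simp
      qed
      have "E = 0"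
      proof (rule ccontr)
        assume nz: "E \<noteq> 0"
        have "PZ S dvd E" by (rule PZ_dvd[OF S(1) E0])
        then have "?N \<le> degree E" using dvd_imp_degree_le[of "PZ S" E] nz by simp
        moreover have "E \<in> PD n ?N" unfolding E_def using mem by (intro PD_diff)
        ultimately show False using PD_degree_less[of E n ?N] nz by auto
      qed
      then show "x = y" using eq by (simp add: x y E_def)
    qed
    moreover have "(\<lambda>(P, C). P + PZ S * C) ` ?A \<subseteq> PD n k"
    proof (intro image_subsetI)
      fix x assume x: "x \<in> ?A"
      obtain P C where xx: "x = (P, C)" by (cases x)
      have mem: "P \<in> PD n k" "C \<in> PD n ?N" using x by (auto simp: xx)
      have "PZ S * C \<in> PD n k"
      proof (cases "C = 0")
        case False
        then have "degree C < ?N" using PD_degree_less[OF mem(2)] by simp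
        moreover have "degree (PZ S * C) = ?N + degree C" using False by (subst degree_mult_eq) auto
        ultimately show ?thesis using k S mem by (intro PD_I PO_mult) (auto intro: PD_PO)
      qed simp
      then show "(case x of (P, C) \<Rightarrow> P + PZ S * C) \<in> PD n k" using mem by (simp add: xx PD_add)
    qed
    ultimately have "card ?A \<le> card (PD n k)" using card_PD(2)[OF n] by (rule card_inj_on_le)
    then have "(p ^ n) ^ (card (degs (WD n S) \<inter> {..<k}) + ?N) \<le> (p ^ n) ^ k"
      by (simp add: card_cartesian_product cs card_PD(1)[OF n] power_add)
    then show "card (degs (WD n S) \<inter> {..<k}) + ?N \<le> k"
      using power_le_imp_le_exp[of "p ^ n"] p_gt_1 n one_less_power by blast
  qed
qed

end

text \<open>Write \<open>k = p * m\<close> and \<open>x = 1 / p\<close>. The first alternative gives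
  at most \<open>k - D\<close>. The second gives about \<open>k - x * k + 2 * x * D - D\<close>,
  which is below the target by \<open>(1 - 2 * x - 1 / 3) * (D - k / 2)\<close>, nonnegative because
  \<open>p \<ge> 3\<close> and \<open>k \<le> 2 * D\<close>. The summand \<open>p\<close> absorbs
  the rounding in \<open>N div p\<close>.\<close>

lemma exponent_bound:
  fixes p N D m u :: nat
  assumes "p > 2" "N \<le> D" "p * m \<le> 2 * D" "N < p * m"
    and "u + N \<le> p * m \<or> u \<le> N div p + (m - N div p) * (p - 1)"
  shows "real N + real u - real D \<le> real (p * m) / 2 - (real D - real (p * m) / 2) / 3 + real p"
  using assms(5)
proof
  assume "u + N \<le> p * m"
  then have "real u + real N \<le> real (p * m)" by (metis of_nat_add of_nat_le_iff)
  moreover have "real (p * m) \<le> 2 * real D" using assms(3) by (metis of_nat_le_iff of_nat_mult of_nat_numeral)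
  ultimately show ?thesis by (simp add: field_simps)
next
  assume u: "u \<le> N div p + (m - N div p) * (p - 1)"
  let ?a = "real (N div p)"
  have am: "N div p \<le> m" using less_mult_imp_div_less[of N m p] assms(4) by (simp add: mult.commute)
  have "real u \<le> ?a + (real m - ?a) * (real p - 1)"
  proof -
    have "real u \<le> real (N div p + (m - N div p) * (p - 1))" using u by (simp only: of_nat_le_iff)
    also have "\<dots> = ?a + (real m - ?a) * (real p - 1)" using am assms(1) by (simp add: of_nat_diff)
    finally show ?thesis .
  qed
  then have u': "real u \<le> real (p * m) - real m - ?a * (real p - 2)" by (simp add: algebra_simps)
  have "real N = real p * ?a + real (N mod p)"
    by (metis mult_div_mod_eq of_nat_add of_nat_mult)
  moreover have "real (N mod p) \<le> real p - 1" using assms(1) mod_less_divisor[of p N] by linarith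
  ultimately have na: "real p * ?a \<ge> real N - (real p - 1)" by simp
  define x where "x = 1 / real p"
  have px: "real p * x = 1" using assms(1) by (simp add: x_def)
  have x0: "x > 0" "x \<le> 1 / 3" using assms(1) by (auto simp: x_def field_simps)
  have mk: "real m = x * real (p * m)" using px by (simp add: mult_ac)
  have a': "?a \<ge> x * real N - 1"
  proof -
    have "x * (real p * ?a) \<ge> x * (real N - (real p - 1))" using na x0 by (intro mult_left_mono) auto
    moreover have "x * (real p * ?a) = ?a" using px by (metis mult.assoc mult.commute mult_1)
    ultimately have "?a \<ge> x * real N - (x * real p) + x" by (simp add: algebra_simps)
    then show ?thesis using px x0 by (simp add: mult.commute)
  qed
  have "?a * (real p - 2) \<ge> (x * real N - 1) * (real p - 2)" using a' assms(1) by (intro mult_right_mono) auto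
  also have "(x * real N - 1) * (real p - 2) = real N - 2 * x * real N - real p + 2"
  proof -
    have "(x * real N - 1) * (real p - 2) = (real p * x) * real N - 2 * x * real N - real p + 2"
      by (simp add: algebra_simps)
    then show ?thesis using px by simp
  qed
  finally have a'': "?a * (real p - 2) \<ge> real N - 2 * x * real N - real p + 2" .
  have "2 * x * real N \<le> 2 * x * real D" using x0 assms(2) by (intro mult_left_mono) auto
  then have 1: "real N + real u - real D \<le> real (p * m) - x * real (p * m) + 2 * x * real D - real D + real p"
    using u' a'' mk by linarith
  have "(1 - 2 * x - 1 / 3) * (real D - real (p * m) / 2) \<ge> 0"
  proof -
    have "real (p * m) \<le> 2 * real D" using assms(3) by (metis of_nat_le_iff of_nat_mult of_nat_numeral)
    then show ?thesis using x0 by (intro mult_nonneg_nonneg) auto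
  qed
  then have "real (p * m) - x * real (p * m) + 2 * x * real D - real D \<le> real (p * m) / 2 - (real D - real (p * m) / 2) / 3"
  proof -
    have "(k / 2 - (y - k / 2) / 3) - (k - x * k + 2 * x * y - y) = (1 - 2 * x - 1 / 3) * (y - k / 2)" for k y :: real
      by (simp add: field_simps)
    from this[of "real (p * m)" "real D"] \<open>(1 - 2 * x - 1 / 3) * (real D - real (p * m) / 2) \<ge> 0\<close>
    show ?thesis by linarith
  qed
  then show ?thesis using 1 by linarith
qed

section \<open>Averages over the ordinary family\<close>

context ffield
begin

text \<open>\<open>FF n\<close> is perfect: a double root of \<open>g\<close> has conjugates of the
  same order, so the square of its minimal polynomial \<open>cpoly\<close> divides
  \<open>g\<close>.\<close>

lemma simple_of_sqfree:
  assumes "g \<in> PO n" "n > 0" "g \<noteq> 0" "sqfree_over (FF n) g" "poly g z = 0"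
  shows "poly (pderiv g) z \<noteq> 0"
proof
  assume d0: "poly (pderiv g) z = 0"
  obtain r0 where r0: "r0 > 0" "z \<in> FF (n * r0)" using roots_in_FF[OF assms(1,3,5,2)] by blast
  obtain u where u: "g = [:- z, 1:] * u" using assms(5) poly_eq_0_iff_dvd by blast
  have "poly (pderiv ([:- z, 1:] * u)) z = poly u z"
    by (simp only: pderiv_mult poly_add poly_mult) (simp add: pderiv_pCons)
  then have "poly u z = 0" using d0 u by simp
  then have "[:- z, 1:] dvd u" using poly_eq_0_iff_dvd by blast
  then have "[:- z, 1:] * [:- z, 1:] dvd g" unfolding u by (rule mult_dvd_mono[OF dvd_refl])
  then have "[:- z, 1:] ^ 2 dvd g" by (simp only: power2_eq_square)
  then have "2 \<le> order z g" using assms(3) by (simp add: order_divides)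
  then have "cpoly n (odeg n z) z ^ 2 dvd g" using cpoly_odeg_dvd_iff[OF r0(2,1) assms(1,3)] by blast
  then have "cpoly n (odeg n z) z * cpoly n (odeg n z) z dvd g" by (simp only: power2_eq_square)
  then have "degree (cpoly n (odeg n z) z) = 0"
    using assms(4) cpoly_PO[OF odeg(2)[OF r0(2,1)]] unfolding sqfree_over_def by blast
  then show False using odeg(1)[OF r0(2,1)] by simp
qed

lemma coprime_over_iff:
  assumes "g \<in> PO n" "h \<in> PO n" "n > 0" "g \<noteq> 0"
  shows "coprime_over (FF n) h g \<longleftrightarrow> (\<forall>z. poly g z = 0 \<longrightarrow> poly h z \<noteq> 0)"
proof (intro iffI allI impI notI)
  fix z assume cop: "coprime_over (FF n) h g" and z: "poly g z = 0" "poly h z = 0"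
  obtain r0 where r0: "r0 > 0" "z \<in> FF (n * r0)" using roots_in_FF[OF assms(1,4) z(1) assms(3)] by blast
  let ?c = "cpoly n (odeg n z) z"
  have "?c dvd P" if "P \<in> PO n" "poly P z = 0" for P
  proof (cases "P = 0")
    case False
    then have "1 \<le> order z P" using that by (simp add: Suc_le_eq order_gt_0_iff)
    then show ?thesis using cpoly_odeg_dvd_iff[OF r0(2,1) that(1) False, of 1] by simp
  qed simp
  then have "degree ?c = 0" using cop assms z cpoly_PO[OF odeg(2)[OF r0(2,1)]] unfolding coprime_over_def by blast
  then show False using odeg(1)[OF r0(2,1)] by simp
next
  assume *: "\<forall>z. poly g z = 0 \<longrightarrow> poly h z \<noteq> 0"
  show "coprime_over (FF n) h g" unfolding coprime_over_def
  proof (intro ballI impI)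
    fix D assume "D \<in> PO n" "D dvd h \<and> D dvd g"
    show "degree D = 0"
    proof (rule ccontr)
      assume "degree D \<noteq> 0"
      then obtain x where "poly D x = 0" using has_root[of D] by auto
      then have "poly h x = 0" "poly g x = 0" using \<open>D dvd h \<and> D dvd g\<close> by (auto elim!: dvdE)
      then show False using * by blast
    qed
  qed
qed

lemma card_alpha_le:
  assumes "k > 0" "X \<subseteq> FF (n * k)" "finite Y" "\<And>\<alpha>. \<alpha> \<in> X \<Longrightarrow> cpoly n k \<alpha> \<in> Y" "Y \<subseteq> MP n k"
  shows "card X \<le> k * card Y"
proof -
  have nz: "F \<noteq> 0" "degree F = k" if "F \<in> Y" for F using that assms(5) by (auto simp: MP_def)
  have "X \<subseteq> (\<Union>F\<in>Y. {z. poly F z = 0})" using assms(4) cpoly_root[OF assms(1)] by blast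
  moreover have "finite (\<Union>F\<in>Y. {z. poly F z = 0})" using assms(3) nz poly_roots_finite by blast
  ultimately have "card X \<le> card (\<Union>F\<in>Y. {z. poly F z = 0})" by (rule card_mono[rotated])
  also have "\<dots> \<le> (\<Sum>F\<in>Y. card {z. poly F z = 0})" by (rule card_UN_le[OF assms(3)])
  also have "\<dots> \<le> (\<Sum>F\<in>Y. k)" by (rule sum_mono) (use nz card_poly_roots_bound in fastforce)
  finally show ?thesis by (simp add: mult.commute)
qed

lemma card_monic_le:
  assumes n: "n > 0" and "\<And>P Q. P \<in> W \<Longrightarrow> Q \<in> W \<Longrightarrow> P - Q \<in> W"
  shows "card (MP n k \<inter> W) \<le> card (W \<inter> PD n k)"
proof (cases "MP n k \<inter> W = {}")
  case False
  then obtain F1 where F1: "F1 \<in> MP n k" "F1 \<in> W" by blast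
  show ?thesis
  proof (rule card_inj_on_le[where f = "\<lambda>F. F - F1"])
    show "(\<lambda>F. F - F1) ` (MP n k \<inter> W) \<subseteq> W \<inter> PD n k"
    proof (intro image_subsetI IntI)
      fix F assume F: "F \<in> MP n k \<inter> W"
      then show "F - F1 \<in> W" using F1 assms(2) by blast
      show "F - F1 \<in> PD n k"
      proof (rule PD_Suc_coeff_0)
        have "F \<in> PD n (Suc k)" "F1 \<in> PD n (Suc k)" using F F1 by (auto simp: MP_def PD_iff_degree)
        then show "F - F1 \<in> PD n (Suc k)" by (rule PD_diff)
        show "coeff (F - F1) k = 0" using F F1 by (auto simp: MP_def)
      qed
    qed
  qed (use card_PD(2)[OF n] in \<open>auto simp: inj_on_def\<close>)
qed simp

end

section \<open>The family of numerators and its parametrization\<close>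

context ordg
begin

abbreviation HH where "HH \<equiv> AS_ord_g p n d g"

lemma HH_iff: "h \<in> HH \<longleftrightarrow> h \<in> PO n \<and> (\<forall>z\<in>Z. poly h z \<noteq> 0) \<and>
    ((degree g = d \<and> degree h \<le> d) \<or> (degree g = d - 1 \<and> degree h = d))"
  unfolding AS_ord_g_def using coprime_over_iff[OF g_PO _ n_pos g_nz] by (auto simp: Z_iff)

lemma char_sum_HH: assumes "h \<in> HH"
  shows "char_sum p n \<psi> h g k = (\<Sum>\<alpha>\<in>FF (n * k) - Z. chr (n * k) (poly h \<alpha> / poly g \<alpha>))
    + (if degree g = d then chr (n * k) (coeff h d) else 0)"
proof -
  have "{\<alpha> \<in> FF (n * k). poly g \<alpha> \<noteq> 0} = FF (n * k) - Z" by (auto simp: Z_iff)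
  moreover have "degree h \<le> degree g \<longleftrightarrow> degree g = d" using assms d_ge by (auto simp: HH_iff)
  moreover have "(if degree h = degree g then lead_coeff h / lead_coeff g else 0) = coeff h d" if "degree g = d"
    using that g_lead assms d_ge by (auto simp: HH_iff coeff_eq_0)
  ultimately show ?thesis by (simp add: char_sum_def chr_def)
qed

lemma val_FF: "h \<in> PO n \<Longrightarrow> \<alpha> \<in> FF (n * k) \<Longrightarrow> poly h \<alpha> / poly g \<alpha> \<in> FF (n * k)"
  using PO_mono[of h n "n * k"] PO_mono[OF g_PO, of "n * k"] by (intro FF_divide PO_poly) auto

lemma chr_base: "y \<in> FF n \<Longrightarrow> chr (n * k) y = chr n (of_nat k * y)"
  by (simp add: chr_tower Trq_def frob_iter)

lemma avg_zero: assumes "k > 0" "\<not> p dvd k" shows "(\<Sum>h\<in>HH. char_sum p n \<psi> h g k) = 0"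
proof -
  have "of_nat k \<noteq> (0::'k)" using assms(2) char_k of_nat_eq_0_iff_char_dvd by metis
  then obtain y where y: "y \<in> FF n" "chr n (y * of_nat k) \<noteq> 1" using chr_nontrivial[OF n_pos FF_of_nat] by blast
  have yk: "y \<in> FF (n * k)" using FF_mono[OF y(1)] by simp
  have closed: "h + smult x g \<in> HH" if "h \<in> HH" "x \<in> FF n" for h x
  proof -
    have sg: "degree (smult x g) \<le> degree g" by (rule degree_smult_le)
    have "degree (h + smult x g) = d" if "degree g = d - 1" "degree h = d"
      using that sg d_ge by (subst degree_add_eq_left) auto
    moreover have "degree (h + smult x g) \<le> d" if "degree g = d" "degree h \<le> d"
      using that sg by (intro degree_add_le) auto
    ultimately show ?thesis using that g_PO by (auto simp: HH_iff Z_iff PO_add PO_smult)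
  qed
  show ?thesis
  proof (rule sum_shift_zero[where s = "\<lambda>h. h + smult y g" and w = "chr (n * k) y"])
    have my: "- y \<in> FF n" using y(1) by (rule FF_minus)
    show "bij_betw (\<lambda>h. h + smult y g) HH HH"
      by (rule bij_betw_byWitness[where f' = "\<lambda>h. h + smult (- y) g"]) (use closed[OF _ y(1)] closed[OF _ my] in auto)
    show "chr (n * k) y \<noteq> 1" using y chr_base[OF y(1), of k] by (simp add: mult.commute)
    fix h assume h: "h \<in> HH"
    have hPO: "h \<in> PO n" using h by (simp add: HH_iff)
    have 1: "chr (n * k) (poly (h + smult y g) \<alpha> / poly g \<alpha>) = chr (n * k) y * chr (n * k) (poly h \<alpha> / poly g \<alpha>)"
      if "\<alpha> \<in> FF (n * k) - Z" for \<alpha>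
    proof -
      have "poly (h + smult y g) \<alpha> / poly g \<alpha> = y + poly h \<alpha> / poly g \<alpha>"
        using that by (simp add: Z_iff field_simps)
      then show ?thesis using chr_add[OF yk val_FF[OF hPO]] that by simp
    qed
    have 2: "chr (n * k) (coeff (h + smult y g) d) = chr (n * k) y * chr (n * k) (coeff h d)" if "degree g = d"
    proof -
      have "coeff (h + smult y g) d = y + coeff h d" using g_lead that by simp
      moreover have "coeff h d \<in> FF (n * k)" using FF_mono[OF PO_coeff[OF hPO]] by simp
      ultimately show ?thesis using chr_add[OF yk] by (simp only:)
    qed
    show "char_sum p n \<psi> (h + smult y g) g k = chr (n * k) y * char_sum p n \<psi> h g k"
      unfolding char_sum_HH[OF h] char_sum_HH[OF closed[OF h y(1)]]
      using 1 2 by (simp add: sum_distrib_left distrib_left)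
  qed
qed

text \<open>In \<open>f = \<tau> + P / g\<close>, \<open>UU\<close> supplies representatives
  \<open>P\<close> of the units modulo \<open>g\<close>, and \<open>TT\<close> the polynomial parts,
  constant or of exact degree 1 according to the behaviour at infinity.\<close>

definition UU where "UU = {P \<in> PD n (degree g). \<forall>z\<in>Z. poly P z \<noteq> 0}"
definition TT where "TT = {\<tau> \<in> PO n. degree \<tau> = (if degree g = d then 0 else 1)}"

lemma finite_Un: "finite UU" unfolding UU_def using card_PD(2)[OF n_pos] by auto

lemma degg_pos: "degree g > 0" using g_deg d_ge by auto

lemma Un_nonempty: "card UU > 0"
proof -
  have "1 \<in> UU" unfolding UU_def using degg_pos by (auto intro!: PD_I)
  then show ?thesis using finite_Un by (auto simp: card_gt_0_iff)
qed

lemma Un_deg: "P \<in> UU \<Longrightarrow> degree P < degree g"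
  using PD_degree_less[of P n "degree g"] degg_pos by (auto simp: UU_def)

lemma HH_bij: "bij_betw (\<lambda>(\<tau>, P). g * \<tau> + P) (TT \<times> UU) HH"
proof (rule bij_betw_byWitness[where f' = "\<lambda>h. (h div g, h mod g)"])
  show "\<forall>x\<in>TT \<times> UU. (\<lambda>h. (h div g, h mod g)) ((\<lambda>(\<tau>, P). g * \<tau> + P) x) = x"
  proof
    fix x assume "x \<in> TT \<times> UU"
    then obtain \<tau> P where x: "x = (\<tau>, P)" "P \<in> UU" by blast
    have "P div g = 0" "P mod g = P" using Un_deg[OF x(2)] by (auto simp: div_poly_less mod_poly_less)
    then show "(\<lambda>h. (h div g, h mod g)) ((\<lambda>(\<tau>, P). g * \<tau> + P) x) = x" using g_nz by (simp add: x)
  qed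
  show "\<forall>h\<in>HH. (\<lambda>(\<tau>, P). g * \<tau> + P) (h div g, h mod g) = h" by simp
  show "(\<lambda>(\<tau>, P). g * \<tau> + P) ` (TT \<times> UU) \<subseteq> HH"
  proof (intro image_subsetI)
    fix x assume "x \<in> TT \<times> UU"
    then obtain \<tau> P where x: "x = (\<tau>, P)" "\<tau> \<in> TT" "P \<in> UU" by blast
    have PP: "P \<in> PO n" "\<forall>z\<in>Z. poly P z \<noteq> 0" using x by (auto simp: UU_def PD_PO)
    have dP: "degree P < degree g" by (rule Un_deg[OF x(3)])
    have "g * \<tau> + P \<in> PO n" using x PP g_PO by (auto simp: TT_def intro: PO_add PO_mult)
    moreover have "degree (g * \<tau> + P) \<le> d" if "degree g = d"
      using that x dP degree_mult_le[of g \<tau>] by (intro degree_add_le) (auto simp: TT_def)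
    moreover have "degree (g * \<tau> + P) = d" if "degree g = d - 1"
    proof -
      have t: "degree \<tau> = 1" using that x d_ge by (auto simp: TT_def)
      then have "\<tau> \<noteq> 0" by auto
      then have "degree (g * \<tau>) = d" using t that d_ge g_nz by (subst degree_mult_eq) auto
      then show ?thesis using dP that by (subst degree_add_eq_left) auto
    qed
    ultimately show "(\<lambda>(\<tau>, P). g * \<tau> + P) x \<in> HH" using PP g_deg by (auto simp: HH_iff x(1) Z_iff)
  qed
  show "(\<lambda>h. (h div g, h mod g)) ` HH \<subseteq> TT \<times> UU"
  proof (intro image_subsetI)
    fix h assume h: "h \<in> HH"
    interpret AS: ordAS p K \<psi> n d g h
      by unfold_locales (use h in \<open>auto simp: HH_iff Z_iff\<close>)
    have "h div g \<in> TT" using AS.hdiv_PO AS.degree_hdiv h d_ge by (auto simp: TT_def HH_iff)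
    moreover have "poly (h mod g) z \<noteq> 0" if "z \<in> Z" for z
    proof -
      have "poly h z = poly (g * (h div g) + h mod g) z" by simp
      also have "\<dots> = poly (h mod g) z" using that by (simp only: poly_add poly_mult) (simp add: Z_iff)
      finally show ?thesis using h that by (auto simp: HH_iff)
    qed
    then have "h mod g \<in> UU" using AS.hdiv_PO AS.hmod_deg by (auto simp: UU_def intro: PD_I)
    ultimately show "(h div g, h mod g) \<in> TT \<times> UU" by simp
  qed
qed

lemma card_HH: "card HH = card TT * card UU"
  using bij_betw_same_card[OF HH_bij] by (simp add: card_cartesian_product)

lemma finite_TT: "finite TT"
  by (rule finite_subset[OF _ card_PD(2)[OF n_pos, of 2]]) (auto simp: TT_def numeral_2_eq_2 PD_iff_degree split: if_splits)

lemma card_HH_pos: "card HH > 0"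
proof -
  have "(if degree g = d then 1 else [:0, 1:]) \<in> TT"
    using PO_linear[OF FF_0] by (auto simp: TT_def)
  then have "card TT > 0" using finite_TT by (auto simp: card_gt_0_iff)
  then show ?thesis using Un_nonempty by (simp add: card_HH)
qed

definition AA where "AA k \<alpha> = norm (\<Sum>P\<in>UU. chr (n * k) (poly P \<alpha> / poly g \<alpha>))"

text \<open>The sum over the polynomial parts splits off as a factor and is bounded trivially, as is
  the point at infinity; all cancellation comes from the units, in \<open>AA\<close>.\<close>

lemma avg_le: assumes "k > 0"
  shows "norm (\<Sum>h\<in>HH. char_sum p n \<psi> h g k) \<le> real (card TT) * (\<Sum>\<alpha>\<in>FF (n * k) - Z. AA k \<alpha>) + real (card HH)"
proof -
  have fin: "finite (FF (n * k))" using card_FF(2)[of "n * k"] n_pos assms by simp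
  let ?I = "\<lambda>h. if degree g = d then chr (n * k) (coeff h d) else 0"
  have "(\<Sum>h\<in>HH. char_sum p n \<psi> h g k) = (\<Sum>h\<in>HH. (\<Sum>\<alpha>\<in>FF (n * k) - Z. chr (n * k) (poly h \<alpha> / poly g \<alpha>)) + ?I h)"
    by (rule sum.cong[OF refl char_sum_HH])
  also have "\<dots> = (\<Sum>\<alpha>\<in>FF (n * k) - Z. \<Sum>h\<in>HH. chr (n * k) (poly h \<alpha> / poly g \<alpha>)) + (\<Sum>h\<in>HH. ?I h)"
    unfolding sum.distrib by (subst sum.swap) (rule refl)
  finally have "norm (\<Sum>h\<in>HH. char_sum p n \<psi> h g k) \<le>
      norm (\<Sum>\<alpha>\<in>FF (n * k) - Z. \<Sum>h\<in>HH. chr (n * k) (poly h \<alpha> / poly g \<alpha>)) + norm (\<Sum>h\<in>HH. ?I h)"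
    by (simp only: norm_triangle_ineq)
  also have "\<dots> \<le> (\<Sum>\<alpha>\<in>FF (n * k) - Z. real (card TT) * AA k \<alpha>) + real (card HH)"
  proof (rule add_mono)
    have "norm (\<Sum>\<alpha>\<in>FF (n * k) - Z. \<Sum>h\<in>HH. chr (n * k) (poly h \<alpha> / poly g \<alpha>))
        \<le> (\<Sum>\<alpha>\<in>FF (n * k) - Z. norm (\<Sum>h\<in>HH. chr (n * k) (poly h \<alpha> / poly g \<alpha>)))"
      by (rule norm_sum)
    also have "\<dots> \<le> (\<Sum>\<alpha>\<in>FF (n * k) - Z. real (card TT) * AA k \<alpha>)"
    proof (rule sum_mono)
      fix \<alpha> assume \<alpha>: "\<alpha> \<in> FF (n * k) - Z"
      have "(\<Sum>h\<in>HH. chr (n * k) (poly h \<alpha> / poly g \<alpha>)) = (\<Sum>x\<in>TT \<times> UU. chr (n * k) (poly ((\<lambda>(\<tau>, P). g * \<tau> + P) x) \<alpha> / poly g \<alpha>))"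
        using sum.reindex_bij_betw[OF HH_bij, of "\<lambda>h. chr (n * k) (poly h \<alpha> / poly g \<alpha>)"] by (rule sym)
      also have "\<dots> = (\<Sum>(\<tau>, P)\<in>TT \<times> UU. chr (n * k) (poly \<tau> \<alpha>) * chr (n * k) (poly P \<alpha> / poly g \<alpha>))"
      proof (rule sum.cong[OF refl])
        fix x assume "x \<in> TT \<times> UU"
        then obtain \<tau> P where x: "x = (\<tau>, P)" "\<tau> \<in> PO n" "P \<in> PO n" by (auto simp: TT_def UU_def PD_PO)
        have "poly (g * \<tau> + P) \<alpha> / poly g \<alpha> = poly \<tau> \<alpha> + poly P \<alpha> / poly g \<alpha>"
          using \<alpha> by (simp add: Z_iff field_simps)
        moreover have "poly \<tau> \<alpha> \<in> FF (n * k)" using PO_mono[OF x(2), of "n * k"] \<alpha> by (intro PO_poly) auto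
        moreover have "poly P \<alpha> / poly g \<alpha> \<in> FF (n * k)" using \<alpha> by (intro val_FF x(3)) auto
        ultimately show "chr (n * k) (poly ((\<lambda>(\<tau>, P). g * \<tau> + P) x) \<alpha> / poly g \<alpha>) =
          (case x of (\<tau>, P) \<Rightarrow> chr (n * k) (poly \<tau> \<alpha>) * chr (n * k) (poly P \<alpha> / poly g \<alpha>))"
          by (simp add: x(1) chr_add)
      qed
      also have "\<dots> = (\<Sum>\<tau>\<in>TT. chr (n * k) (poly \<tau> \<alpha>)) * (\<Sum>P\<in>UU. chr (n * k) (poly P \<alpha> / poly g \<alpha>))"
        by (simp only: sum_product sum.cartesian_product)
      finally have "norm (\<Sum>h\<in>HH. chr (n * k) (poly h \<alpha> / poly g \<alpha>)) = norm (\<Sum>\<tau>\<in>TT. chr (n * k) (poly \<tau> \<alpha>)) * AA k \<alpha>"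
        by (simp only: AA_def norm_mult)
      moreover have "norm (\<Sum>\<tau>\<in>TT. chr (n * k) (poly \<tau> \<alpha>)) \<le> (\<Sum>\<tau>\<in>TT. 1)"
      proof (rule order.trans[OF norm_sum sum_mono])
        fix \<tau> assume "\<tau> \<in> TT"
        then have "poly \<tau> \<alpha> \<in> FF (n * k)" using PO_mono[of \<tau> n "n * k"] \<alpha> by (intro PO_poly) (auto simp: TT_def)
        then show "norm (chr (n * k) (poly \<tau> \<alpha>)) \<le> 1" using chr_norm by simp
      qed
      ultimately show "norm (\<Sum>h\<in>HH. chr (n * k) (poly h \<alpha> / poly g \<alpha>)) \<le> real (card TT) * AA k \<alpha>"
        by (simp add: AA_def mult_right_mono)
    qed
    finally show "norm (\<Sum>\<alpha>\<in>FF (n * k) - Z. \<Sum>h\<in>HH. chr (n * k) (poly h \<alpha> / poly g \<alpha>)) \<le> (\<Sum>\<alpha>\<in>FF (n * k) - Z. real (card TT) * AA k \<alpha>)" .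
    have "norm (\<Sum>h\<in>HH. ?I h) \<le> (\<Sum>h\<in>HH. 1)"
    proof (rule order.trans[OF norm_sum sum_mono])
      fix h assume "h \<in> HH"
      then have "coeff h d \<in> FF (n * k)" using FF_mono[OF PO_coeff[of h n d], of "n * k"] by (auto simp: HH_iff)
      then show "norm (?I h) \<le> 1" using chr_norm by simp
    qed
    then show "norm (\<Sum>h\<in>HH. ?I h) \<le> real (card HH)" by simp
  qed
  finally show ?thesis by (simp add: sum_distrib_left)
qed

section \<open>Frobenius orbits of the poles and inclusion-exclusion\<close>

definition orb :: "'k \<Rightarrow> 'k set" where "orb x = range (\<lambda>j. x ^ (p ^ (n * j)))"
text \<open>Stands for the set of irreducible factors of \<open>g\<close> over \<open>FF n\<close>.
  A union of orbits is stable under Frobenius, so \<open>PZ\<close> of it is a divisor of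
  \<open>g\<close> with coefficients in \<open>FF n\<close>.\<close>

definition Ob where "Ob = orb ` Z"

lemma orb_self: "x \<in> orb x"
proof -
  have "x = x ^ (p ^ (n * 0))" by simp
  then show ?thesis unfolding orb_def by (rule range_eqI)
qed

lemma orb_subset: "x \<in> Z \<Longrightarrow> orb x \<subseteq> Z"
  unfolding orb_def Z_def using PO_poly_frob_iter[OF g_PO] pm_pos by auto

lemma finite_Ob: "finite Ob" unfolding Ob_def using finite_Z by simp

lemma Ob_Union_subset: "T \<subseteq> Ob \<Longrightarrow> \<Union>T \<subseteq> Z"
  unfolding Ob_def using orb_subset by auto

lemma orb_vanish: "P \<in> PO n \<Longrightarrow> y \<in> orb x \<Longrightarrow> poly P y = 0 \<longleftrightarrow> poly P x = 0"
  unfolding orb_def using PO_poly_frob_iter[of P n] pm_pos by auto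

lemma frob_orb: assumes "y \<in> orb x" shows "y ^ (p ^ n) \<in> orb x"
proof -
  obtain j where j: "y = x ^ (p ^ (n * j))" using assms by (auto simp: orb_def)
  have "p ^ (n * Suc j) = p ^ (n * j) * p ^ n" by (simp add: power_add)
  then have "y ^ (p ^ n) = x ^ (p ^ (n * Suc j))" unfolding j by (simp only: power_mult)
  then show ?thesis unfolding orb_def by (rule range_eqI)
qed

lemma frob_bij_Union: assumes "T \<subseteq> Ob"
  shows "bij_betw (\<lambda>z. z ^ (p ^ n)) (\<Union>T) (\<Union>T)" "bij_betw (\<lambda>z. z ^ (p ^ n)) (Z - \<Union>T) (Z - \<Union>T)"
proof -
  have fin: "finite (\<Union>T)" by (rule finite_subset[OF Ob_Union_subset[OF assms] finite_Z])
  have inj: "inj_on (\<lambda>z. z ^ (p ^ n)) X" for X :: "'k set" by (auto simp: inj_on_def frob_inj)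
  have "(\<lambda>z. z ^ (p ^ n)) ` (\<Union>T) \<subseteq> \<Union>T"
  proof (intro image_subsetI)
    fix z assume "z \<in> \<Union>T"
    then obtain x where "x \<in> Z" "orb x \<in> T" "z \<in> orb x" using assms by (auto simp: Ob_def)
    then show "z ^ (p ^ n) \<in> \<Union>T" using frob_orb by blast
  qed
  then have eq: "(\<lambda>z. z ^ (p ^ n)) ` (\<Union>T) = \<Union>T" by (rule endo_inj_surj[OF fin _ inj])
  then show "bij_betw (\<lambda>z. z ^ (p ^ n)) (\<Union>T) (\<Union>T)" using inj by (simp add: bij_betw_def)
  have eqZ: "(\<lambda>z. z ^ (p ^ n)) ` Z = Z" using frob_Z by (simp add: bij_betw_def)
  have "(\<lambda>z. z ^ (p ^ n)) ` (Z - \<Union>T) = Z - \<Union>T"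
    using image_set_diff[OF inj[of UNIV], of Z "\<Union>T"] eq eqZ by (simp only:)
  then show "bij_betw (\<lambda>z. z ^ (p ^ n)) (Z - \<Union>T) (Z - \<Union>T)" using inj by (simp add: bij_betw_def)
qed

text \<open>A polynomial over \<open>FF n\<close> that vanishes at one point vanishes on the whole
  orbit, so inclusion-exclusion can run over the \<open>2 ^ card Ob\<close> sets of orbits instead
  of all sets of poles.\<close>

lemma unit_indicator: assumes "P \<in> PO n"
  shows "(if \<forall>z\<in>Z. poly P z \<noteq> 0 then 1 else 0 :: complex) =
    (\<Sum>T\<in>Pow Ob. (-1) ^ card T * (if \<forall>z\<in>\<Union>T. poly P z = 0 then 1 else 0))"
proof -
  let ?e = "\<lambda>O'. if \<forall>z\<in>O'. poly P z = 0 then 1 else 0 :: complex"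
  have "(if \<forall>z\<in>Z. poly P z \<noteq> 0 then 1 else 0 :: complex) = (\<Prod>O'\<in>Ob. 1 - ?e O')"
  proof (cases "\<forall>z\<in>Z. poly P z \<noteq> 0")
    case True
    have "?e O' = 0" if "O' \<in> Ob" for O' using that True orb_self by (auto simp: Ob_def)
    then show ?thesis using True by simp
  next
    case False
    then obtain z where z: "z \<in> Z" "poly P z = 0" by blast
    then have "?e (orb z) = 1" using orb_vanish[OF assms] by auto
    then have "\<exists>O'\<in>Ob. 1 - ?e O' = 0" using z(1) by (intro bexI[of _ "orb z"]) (auto simp: Ob_def)
    then have "(\<Prod>O'\<in>Ob. 1 - ?e O') = 0" using finite_Ob by (intro prod_zero) auto
    then show ?thesis using False by simp
  qed
  also have "\<dots> = (\<Sum>T\<in>Pow Ob. (-1) ^ card T * (\<Prod>O'\<in>T. ?e O') * (\<Prod>O'\<in>Ob - T. 1))"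
    by (rule prod_diff_conv_sum[OF finite_Ob])
  also have "\<dots> = (\<Sum>T\<in>Pow Ob. (-1) ^ card T * (if \<forall>z\<in>\<Union>T. poly P z = 0 then 1 else 0))"
  proof (rule sum.cong[OF refl])
    fix T assume "T \<in> Pow Ob"
    then have fin: "finite T" using finite_Ob finite_subset by blast
    have "(\<Prod>O'\<in>T. ?e O') = (if \<forall>z\<in>\<Union>T. poly P z = 0 then 1 else 0)"
    proof (cases "\<forall>z\<in>\<Union>T. poly P z = 0")
      case False
      then have "\<exists>O'\<in>T. ?e O' = 0" by auto
      then have "(\<Prod>O'\<in>T. ?e O') = 0" using fin by (intro prod_zero)
      then show ?thesis using False by simp
    qed simp
    then show "(-1) ^ card T * (\<Prod>O'\<in>T. ?e O') * (\<Prod>O'\<in>Ob - T. 1) = (-1) ^ card T * (if \<forall>z\<in>\<Union>T. poly P z = 0 then 1 else 0)"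
      by simp
  qed
  finally show ?thesis .
qed

definition VT where "VT S = {P \<in> PD n (degree g). \<forall>z\<in>S. poly P z = 0}"

lemma VT_multiple: assumes "S \<subseteq> Z" "PZ S \<in> PO n" "P \<in> VT S" shows "\<exists>B\<in>PD n (card (Z - S)). P = PZ S * B"
proof -
  have finS: "finite S" by (rule finite_subset[OF assms(1) finite_Z])
  have "PZ S dvd P" by (rule PZ_dvd[OF finS]) (use assms(3) in \<open>auto simp: VT_def\<close>)
  then obtain B where B: "P = PZ S * B" by (elim dvdE)
  have PPO: "P \<in> PO n" using assms(3) by (auto simp: VT_def PD_PO)
  then have BPO: "B \<in> PO n" using PO_quotient[of "PZ S" B n] B assms(2) by simp
  have "card (Z - S) = degree g - card S" using assms(1) finS by (simp add: card_Diff_subset card_Z)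
  moreover have "B = 0 \<or> card S + degree B < degree g"
  proof (cases "B = 0")
    case False
    then have "degree P = card S + degree B" unfolding B by (subst degree_mult_eq) auto
    moreover have "P \<noteq> 0" using False B by simp
    ultimately show ?thesis using PD_degree_less[of P n "degree g"] assms(3) by (auto simp: VT_def)
  qed simp
  ultimately show ?thesis using B BPO by (intro bexI[of _ B] PD_I) auto
qed

lemma multiple_VT: assumes "S \<subseteq> Z" "PZ S \<in> PO n" "B \<in> PO n" "degree B < card (Z - S)" shows "PZ S * B \<in> VT S"
proof -
  have finS: "finite S" by (rule finite_subset[OF assms(1) finite_Z])
  have "card (Z - S) = degree g - card S" using assms(1) finS by (simp add: card_Diff_subset card_Z)
  then have "degree (PZ S * B) < degree g" using degree_mult_le[of "PZ S" B] assms(4) by simp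
  then show ?thesis using assms finS by (auto simp: VT_def PZ_root intro!: PD_I PO_mult)
qed

text \<open>The summands are character values of a linear functional \<open>lam\<close> on an
  \<open>FF n\<close>-space, so the sum vanishes unless \<open>lam\<close> does. In that case,
  testing with a multiple of \<open>PZ (\<Union>T)\<close> that vanishes at all poles but one,
  \<gamma>, gives 0 for the sum of \<open>1 / (\<gamma> - z)\<close> over the conjugates
  \<open>z\<close> of \<alpha>, the logarithmic derivative of \<open>cpoly n k \<alpha>\<close> at
  \<gamma>.\<close>

lemma VT_sum_bound:
  assumes T: "T \<subseteq> Ob" and \<alpha>: "\<alpha> \<in> FF (n * k) - Z" and k: "k > 0"
  shows "norm (\<Sum>P\<in>VT (\<Union>T). chr (n * k) (poly P \<alpha> / poly g \<alpha>)) \<le>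
    (if PZ (Z - \<Union>T) dvd pderiv (cpoly n k \<alpha>) then real (p ^ n) ^ card (Z - \<Union>T) else 0)"
proof -
  let ?S = "\<Union>T" and ?N = "card (Z - \<Union>T)"
  have S: "?S \<subseteq> Z" by (rule Ob_Union_subset[OF T])
  have finS: "finite ?S" by (rule finite_subset[OF S finite_Z])
  have SPO: "PZ ?S \<in> PO n" by (rule PZ_PO[OF frob_bij_Union(1)[OF T]])
  define aj where "aj j = \<alpha> ^ (p ^ (n * j))" for j
  have ajZ: "aj j \<notin> Z" for j using \<alpha> pm_pos by (auto simp: aj_def Z_iff PO_poly_frob_iter[OF g_PO])
  define lam where "lam P = (\<Sum>j<k. poly P (aj j) / poly g (aj j))" for P
  have lamTr: "Trq n k (poly P \<alpha> / poly g \<alpha>) = lam P" if "P \<in> PO n" for P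
    using that by (simp add: Trq_def lam_def aj_def PO_poly_frob_iter g_PO power_divide)
  have VTPO: "P \<in> PO n" if "P \<in> VT ?S" for P using that by (auto simp: VT_def PD_def)
  have chr_lam: "chr (n * k) (poly P \<alpha> / poly g \<alpha>) = chr n (lam P)" if "P \<in> VT ?S" for P
    using that lamTr[OF VTPO[OF that]] by (simp only: chr_tower)
  have lamFF: "lam P \<in> FF n" if "P \<in> PO n" for P
  proof -
    have "lam P = RS (\<lambda>z. poly P z / poly g z) (cpoly n k \<alpha>)" by (simp add: lam_def aj_def RS_cpoly)
    also have "\<dots> \<in> FF n"
      by (rule RS_FF) (use \<alpha> that in \<open>auto simp: cpoly_PO PO_poly_frob g_PO power_divide\<close>)
    finally show ?thesis .
  qed
  have lam_add: "lam (P + Q) = lam P + lam Q" for P Q by (simp add: lam_def add_divide_distrib sum.distrib)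
  have lam_smult: "lam (smult y P) = y * lam P" for y P by (simp add: lam_def sum_distrib_left)
  have sum_eq: "(\<Sum>P\<in>VT ?S. chr (n * k) (poly P \<alpha> / poly g \<alpha>)) = (\<Sum>P\<in>VT ?S. chr n (lam P))"
    by (rule sum.cong[OF refl chr_lam])
  have card_VT: "real (card (VT ?S)) \<le> real (p ^ n) ^ ?N"
  proof -
    have "VT ?S \<subseteq> (\<lambda>B. PZ ?S * B) ` PD n ?N" using VT_multiple[OF S SPO] by blast
    then have "card (VT ?S) \<le> card (PD n ?N)"
      using card_PD(2)[OF n_pos] surj_card_le by blast
    then show ?thesis using card_PD(1)[OF n_pos, of ?N] by (metis of_nat_le_iff of_nat_power)
  qed
  show ?thesis
  proof (cases "\<exists>P0\<in>VT ?S. lam P0 \<noteq> 0")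
    case True
    then obtain P0 where P0: "P0 \<in> VT ?S" "lam P0 \<noteq> 0" by blast
    have "(\<Sum>P\<in>VT ?S. chr n (lam P)) = 0"
      by (rule linear_char_sum_zero[where lam = lam, OF n_pos P0(1)])
        (use P0(2) lamFF VTPO lam_add lam_smult in \<open>auto simp: VT_def intro: PD_add PD_diff PD_smult\<close>)
    then show ?thesis using sum_eq by simp
  next
    case False
    have "norm (\<Sum>P\<in>VT ?S. chr (n * k) (poly P \<alpha> / poly g \<alpha>)) \<le> (\<Sum>P\<in>VT ?S. 1)"
      unfolding sum_eq by (rule order.trans[OF norm_sum sum_mono]) (use lamFF VTPO chr_norm in auto)
    then have bd: "norm (\<Sum>P\<in>VT ?S. chr (n * k) (poly P \<alpha> / poly g \<alpha>)) \<le> real (p ^ n) ^ ?N" using card_VT by simp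
    have g_split: "poly g x = poly (PZ ?S) x * poly (PZ (Z - ?S)) x" for x
    proof -
      have "g = PZ ?S * PZ (Z - ?S)"
        by (subst g_eq, subst PZ_union[symmetric]) (use finS finite_Z S in \<open>auto intro!: arg_cong[of _ _ PZ]\<close>)
      then show ?thesis by (metis poly_mult)
    qed
    have nzS: "poly (PZ ?S) (aj j) \<noteq> 0" "poly (PZ (Z - ?S)) (aj j) \<noteq> 0" for j
      using ajZ[of j] S finS finite_Z by (auto simp: PZ_root)
    have mono0: "(\<Sum>j<k. aj j ^ i / poly (PZ (Z - ?S)) (aj j)) = 0" if "i < ?N" for i
    proof -
      have "PZ ?S * monom 1 i \<in> VT ?S" by (rule multiple_VT[OF S SPO]) (use that in \<open>auto simp: PO_monom degree_monom_eq\<close>)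
      then have "lam (PZ ?S * monom 1 i) = 0" using False by blast
      moreover have "lam (PZ ?S * monom 1 i) = (\<Sum>j<k. aj j ^ i / poly (PZ (Z - ?S)) (aj j))"
        unfolding lam_def by (rule sum.cong) (use nzS in \<open>auto simp: g_split poly_monom\<close>)
      ultimately show ?thesis by simp
    qed
    have "poly (pderiv (cpoly n k \<alpha>)) \<gamma> = 0" if \<gamma>: "\<gamma> \<in> Z - ?S" for \<gamma>
    proof -
      let ?B = "PZ (Z - ?S - {\<gamma>})"
      have finZS: "finite (Z - ?S)" using finite_Z by simp
      have degB: "degree ?B < ?N"
      proof -
        have "card (Z - ?S - {\<gamma>}) < card (Z - ?S)" using \<gamma> finZS by (intro psubset_card_mono) auto
        then show ?thesis by simp
      qed
      \<comment> \<open>\<open>?B\<close> need not be rational over \<open>FF n\<close>, so it is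
        expanded into monomials, to which \<open>mono0\<close> applies.\<close>
      have "(\<Sum>j<k. poly ?B (aj j) / poly (PZ (Z - ?S)) (aj j)) =
          (\<Sum>j<k. \<Sum>i\<le>degree ?B. coeff ?B i * (aj j ^ i / poly (PZ (Z - ?S)) (aj j)))"
        by (simp add: poly_altdef[of ?B] sum_divide_distrib)
      also have "\<dots> = (\<Sum>i\<le>degree ?B. coeff ?B i * (\<Sum>j<k. aj j ^ i / poly (PZ (Z - ?S)) (aj j)))"
        by (subst sum.swap) (simp add: sum_distrib_left)
      also have "\<dots> = 0" by (rule sum.neutral) (use mono0 degB in auto)
      finally have s0: "(\<Sum>j<k. poly ?B (aj j) / poly (PZ (Z - ?S)) (aj j)) = 0" .
      have "poly ?B (aj j) / poly (PZ (Z - ?S)) (aj j) = - (1 / (\<gamma> - aj j))" for j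
      proof -
        have "poly (PZ (Z - ?S)) (aj j) = (aj j - \<gamma>) * poly ?B (aj j)"
          by (subst PZ_remove[OF finZS \<gamma>]) (simp add: algebra_simps)
        moreover have "poly ?B (aj j) \<noteq> 0" using ajZ[of j] finZS by (auto simp: PZ_root)
        ultimately have "poly ?B (aj j) / poly (PZ (Z - ?S)) (aj j) = 1 / (aj j - \<gamma>)" by simp
        then show ?thesis by (metis minus_diff_eq minus_divide_right)
      qed
      then have "(\<Sum>j<k. 1 / (\<gamma> - aj j)) = 0" using s0 by (simp add: sum_negf)
      moreover have nz: "poly (cpoly n k \<alpha>) \<gamma> \<noteq> 0"
        using ajZ \<gamma> by (auto simp: cpoly_def poly_prod aj_def)
      ultimately have "poly (pderiv (cpoly n k \<alpha>)) \<gamma> / poly (cpoly n k \<alpha>) \<gamma> = 0"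
        using RS_logderiv[OF cpoly_nz nz] by (simp add: RS_cpoly aj_def)
      then show ?thesis using nz by simp
    qed
    then have "PZ (Z - ?S) dvd pderiv (cpoly n k \<alpha>)" by (intro PZ_dvd) (use finite_Z in auto)
    then show ?thesis using bd by simp
  qed
qed

text \<open>The first bound is weak when \<open>cpoly n k \<alpha>\<close> has derivative 0, since
  then every \<open>T\<close> contributes; the trivial second bound serves that case.\<close>

lemma AA_le: assumes \<alpha>: "\<alpha> \<in> FF (n * k) - Z" and k: "k > 0"
  shows "AA k \<alpha> \<le> (\<Sum>T\<in>Pow Ob. if PZ (Z - \<Union>T) dvd pderiv (cpoly n k \<alpha>) then real (p ^ n) ^ card (Z - \<Union>T) else 0)"
    "AA k \<alpha> \<le> real (card UU)"
proof -
  let ?c = "\<lambda>P. chr (n * k) (poly P \<alpha> / poly g \<alpha>)"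
  have fin: "finite (PD n (degree g))" by (rule card_PD(2)[OF n_pos])
  have "(\<Sum>P\<in>UU. ?c P) = (\<Sum>P\<in>PD n (degree g). (if \<forall>z\<in>Z. poly P z \<noteq> 0 then 1 else 0) * ?c P)"
    by (rule sum.mono_neutral_cong_left) (use fin in \<open>auto simp: UU_def\<close>)
  also have "\<dots> = (\<Sum>P\<in>PD n (degree g). \<Sum>T\<in>Pow Ob. (-1) ^ card T * ((if \<forall>z\<in>\<Union>T. poly P z = 0 then 1 else 0) * ?c P))"
    by (rule sum.cong[OF refl]) (simp only: unit_indicator[OF PD_PO] sum_distrib_right mult.assoc)
  also have "\<dots> = (\<Sum>T\<in>Pow Ob. \<Sum>P\<in>PD n (degree g). (-1) ^ card T * ((if \<forall>z\<in>\<Union>T. poly P z = 0 then 1 else 0) * ?c P))"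
    by (rule sum.swap)
  also have "\<dots> = (\<Sum>T\<in>Pow Ob. (-1) ^ card T * (\<Sum>P\<in>VT (\<Union>T). ?c P))"
    unfolding sum_distrib_left[symmetric]
    by (intro sum.cong refl arg_cong2[of _ _ _ _ "(*)"] sum.mono_neutral_cong_right) (use fin in \<open>auto simp: VT_def\<close>)
  finally have "AA k \<alpha> = norm (\<Sum>T\<in>Pow Ob. (-1) ^ card T * (\<Sum>P\<in>VT (\<Union>T). ?c P))" by (simp add: AA_def)
  also have "\<dots> \<le> (\<Sum>T\<in>Pow Ob. norm ((-1) ^ card T * (\<Sum>P\<in>VT (\<Union>T). ?c P)))" by (rule norm_sum)
  also have "\<dots> \<le> (\<Sum>T\<in>Pow Ob. if PZ (Z - \<Union>T) dvd pderiv (cpoly n k \<alpha>) then real (p ^ n) ^ card (Z - \<Union>T) else 0)"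
  proof (rule sum_mono)
    fix T assume "T \<in> Pow Ob"
    then show "norm ((-1) ^ card T * (\<Sum>P\<in>VT (\<Union>T). ?c P)) \<le> (if PZ (Z - \<Union>T) dvd pderiv (cpoly n k \<alpha>) then real (p ^ n) ^ card (Z - \<Union>T) else 0)"
      using VT_sum_bound[OF _ \<alpha> k, of T] by (simp add: norm_mult norm_power)
  qed
  finally show "AA k \<alpha> \<le> (\<Sum>T\<in>Pow Ob. if PZ (Z - \<Union>T) dvd pderiv (cpoly n k \<alpha>) then real (p ^ n) ^ card (Z - \<Union>T) else 0)" .
  have "AA k \<alpha> \<le> (\<Sum>P\<in>UU. 1)"
    unfolding AA_def by (rule order.trans[OF norm_sum sum_mono])
      (use val_FF \<alpha> chr_norm in \<open>auto simp: UU_def PD_PO\<close>)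
  then show "AA k \<alpha> \<le> real (card UU)" by simp
qed

text \<open>Adding the product of the linear factors at the nonzeros of \<open>P\<close> turns \<open>P\<close> into a unit modulo \<open>g\<close>;
  \<open>P\<close> is recovered from the result and its set of zero orbits.\<close>

lemma card_Un_lower: "(p ^ n) ^ degree g \<le> 2 ^ card Ob * card UU"
proof -
  define zo where "zo P = {O'\<in>Ob. \<forall>z\<in>O'. poly P z = 0}" for P :: "'k poly"
  define sh where "sh P = P + (if zo P = {} then 0 else PZ (Z - \<Union>(zo P)))" for P
  have "inj_on (\<lambda>P. (zo P, sh P)) (PD n (degree g))" by (auto simp: inj_on_def sh_def)
  moreover have "(\<lambda>P. (zo P, sh P)) ` PD n (degree g) \<subseteq> Pow Ob \<times> UU"
  proof (intro image_subsetI)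
    fix P assume P: "P \<in> PD n (degree g)"
    have T: "zo P \<subseteq> Ob" by (auto simp: zo_def)
    have z1: "poly P z = 0 \<longleftrightarrow> z \<in> \<Union>(zo P)" if "z \<in> Z" for z
    proof
      assume "poly P z = 0"
      then have "orb z \<in> zo P" using that orb_vanish[OF PD_PO[OF P]] by (auto simp: zo_def Ob_def)
      then show "z \<in> \<Union>(zo P)" using orb_self by blast
    qed (auto simp: zo_def)
    have "sh P \<in> UU"
    proof (cases "zo P = {}")
      case True
      then show ?thesis using P z1 by (auto simp: sh_def UU_def)
    next
      case False
      then have "\<Union>(zo P) \<noteq> {}" using T orb_self by (auto simp: Ob_def)
      then have "Z - \<Union>(zo P) \<subset> Z" using Ob_Union_subset[OF T] by blast
      then have "card (Z - \<Union>(zo P)) < degree g" using card_Z finite_Z by (metis psubset_card_mono)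
      then have "PZ (Z - \<Union>(zo P)) \<in> PD n (degree g)"
        by (intro PD_I PZ_PO frob_bij_Union(2) T) auto
      then have "sh P \<in> PD n (degree g)" using P False by (simp add: sh_def PD_add)
      moreover have "poly (sh P) z \<noteq> 0" if "z \<in> Z" for z
      proof (cases "z \<in> \<Union>(zo P)")
        case True
        then have "poly P z = 0" using z1[OF that] by blast
        moreover have "poly (PZ (Z - \<Union>(zo P))) z \<noteq> 0" using True finite_Z by (subst PZ_root) auto
        ultimately show ?thesis using False by (simp add: sh_def)
      next
        case nin: False
        then have "poly P z \<noteq> 0" using z1[OF that] by blast
        moreover have "poly (PZ (Z - \<Union>(zo P))) z = 0" using nin that finite_Z by (subst PZ_root) auto
        ultimately show ?thesis using False by (simp add: sh_def)
      qed
      ultimately show ?thesis by (simp add: UU_def)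
    qed
    then show "(zo P, sh P) \<in> Pow Ob \<times> UU" using T by simp
  qed
  moreover have "finite (Pow Ob \<times> UU)" using finite_Ob finite_Un by simp
  ultimately have "card (PD n (degree g)) \<le> card (Pow Ob \<times> UU)" by (rule card_inj_on_le)
  then show ?thesis using card_PD(1)[OF n_pos] finite_Ob by (simp add: card_cartesian_product card_Pow)
qed

text \<open>Points with zero derivative number at most \<open>k * q ^ m\<close> and get the trivial
  bound. For the others each \<open>T\<close> costs \<open>q ^ card (Z - \<Union>T)\<close> times
  the count from \<open>card_WD\<close>. Of the factor 4 per orbit, one 2 comes from the choice of
  \<open>T\<close> and one from replacing \<open>q ^ degree g\<close> by \<open>card UU\<close> in
  \<open>card_Un_lower\<close>.\<close>

lemma sum_AA:
  assumes p2: "p > 2" and m: "m > 0" and k: "k = p * m" "k \<le> 2 * degree g"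
  shows "(\<Sum>\<alpha>\<in>FF (n * k) - Z. AA k \<alpha>) \<le> real (card UU) *
     (real k * real (p ^ n) ^ m + real k * 4 ^ card Ob *
       real (p ^ n) powr (real k / 2 - (real (degree g) - real k / 2) / 3 + real p))"
proof -
  let ?q = "real (p ^ n)" and ?D = "degree g"
  let ?e = "real k / 2 - (real (degree g) - real k / 2) / 3 + real p"
  let ?X = "FF (n * k) - Z"
  let ?XA = "{\<alpha>\<in>?X. pderiv (cpoly n k \<alpha>) = 0}" and ?XB = "{\<alpha>\<in>?X. pderiv (cpoly n k \<alpha>) \<noteq> 0}"
  have q1: "?q > 1" using p_gt_1 n_pos by (metis of_nat_1 of_nat_less_iff one_less_power)
  have pw: "?q ^ j = ?q powr real j" for j by (rule powr_realpow[symmetric]) (use q1 in linarith)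
  have kpos: "k > 0" using k m p2 by simp
  have fin: "finite ?X" using card_FF(2)[of "n * k"] n_pos kpos by simp
  have finX1: "finite ?XA" "finite ?XB" by (rule finite_subset[OF _ fin], auto)+
  have mem: "cpoly n k \<alpha> \<in> MP n k" if "\<alpha> \<in> ?X" for \<alpha> using that by (simp add: cpoly_MP)
  have finMP: "finite (MP n k \<inter> W)" for W using finite_MP[OF n_pos] by simp
  have "card ?XA \<le> k * card (MP n k \<inter> W0 n)"
    by (rule card_alpha_le[OF kpos]) (use mem finMP in \<open>auto simp: W0_def MP_def\<close>)
  also have "\<dots> \<le> k * card (W0 n \<inter> PD n k)"
    by (intro mult_le_mono2 card_monic_le[OF n_pos] W0_subspace(4))
  also have "\<dots> \<le> k * (p ^ n) ^ m" unfolding k(1) by (intro mult_le_mono2 card_W0[OF n_pos])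
  finally have "card ?XA \<le> k * (p ^ n) ^ m" .
  from of_nat_mono[OF this, where 'a = real] have X0: "real (card ?XA) \<le> real k * ?q ^ m"
    by (simp only: of_nat_mult of_nat_power)
  have TX: "(\<Sum>\<alpha>\<in>?XB. if PZ (Z - \<Union>T) dvd pderiv (cpoly n k \<alpha>) then ?q ^ card (Z - \<Union>T) else 0) \<le> real k * ?q powr (real ?D + ?e)"
    if T: "T \<in> Pow Ob" for T
  proof -
    let ?S = "Z - \<Union>T" and ?N = "card (Z - \<Union>T)"
    let ?Y = "{\<alpha>\<in>?XB. PZ ?S dvd pderiv (cpoly n k \<alpha>)}"
    have S: "finite ?S" "PZ ?S \<in> PO n" using finite_Z PZ_PO[OF frob_bij_Union(2)[of T]] T by (simp, blast)
    have ND: "?N \<le> ?D" using card_Z finite_Z by (metis Diff_subset card_mono)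
    have "(\<Sum>\<alpha>\<in>?XB. if PZ ?S dvd pderiv (cpoly n k \<alpha>) then ?q ^ ?N else 0) = (\<Sum>\<alpha>\<in>?Y. ?q ^ ?N)"
      by (rule sum.mono_neutral_cong_right[OF finX1(2)]) auto
    also have "\<dots> = real (card ?Y) * ?q ^ ?N" by simp
    also have "\<dots> \<le> real k * ?q powr (real ?D + ?e)"
    proof (cases "?N < k")
      case False
      \<comment> \<open>A nonzero derivative of a polynomial of degree \<open>k\<close> has degree
        below \<open>k\<close> and so no divisor of degree \<open>?N \<ge> k\<close>.\<close>
      have "?Y = {}"
      proof (rule ccontr)
        assume "?Y \<noteq> {}"
        then obtain \<alpha> where a: "pderiv (cpoly n k \<alpha>) \<noteq> 0" "PZ ?S dvd pderiv (cpoly n k \<alpha>)" by auto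
        then have "?N \<le> degree (pderiv (cpoly n k \<alpha>))" using dvd_imp_degree_le[OF a(2,1)] by simp
        also have "\<dots> < k" using degree_pderiv_less[OF a(1)] by simp
        finally show False using False by simp
      qed
      then have "card ?Y = 0" by (simp only: card.empty)
      then show ?thesis by (simp only: of_nat_0 mult_zero_left) simp
    next
      case True
      define u where "u = card (degs (WD n ?S) \<inter> {..<p * m})"
      note W = card_WD[OF n_pos S, of m, folded u_def]
      have "card ?Y \<le> k * card (MP n k \<inter> WD n ?S)"
        by (rule card_alpha_le[OF kpos]) (use mem finMP in \<open>auto simp: WD_def MP_def\<close>)
      also have "\<dots> \<le> k * card (WD n ?S \<inter> PD n k)"
        by (intro mult_le_mono2 card_monic_le[OF n_pos] WD_subspace(4))
      also have "\<dots> = k * (p ^ n) ^ u" using W(1) True unfolding k(1) by simp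
      finally have "card ?Y \<le> k * (p ^ n) ^ u" .
      from of_nat_mono[OF this, where 'a = real] have "real (card ?Y) \<le> real k * ?q ^ u"
        by (simp only: of_nat_mult of_nat_power)
      then have "real (card ?Y) * ?q ^ ?N \<le> real k * ?q ^ u * ?q ^ ?N" by (intro mult_right_mono) auto
      also have "\<dots> = real k * ?q powr (real u + real ?N)" by (simp only: powr_add pw mult.assoc)
      also have "\<dots> \<le> real k * ?q powr (real ?D + ?e)"
      proof -
        have "real ?N + real u - real ?D \<le> ?e"
          using exponent_bound[OF p2 ND, of m u] k True W(2) unfolding k(1) by blast
        then show ?thesis using q1 by (intro mult_left_mono powr_mono) auto
      qed
      finally show ?thesis .
    qed
    finally show ?thesis .
  qed
  have "(\<Sum>\<alpha>\<in>?X. AA k \<alpha>) = (\<Sum>\<alpha>\<in>?XA. AA k \<alpha>) + (\<Sum>\<alpha>\<in>?XB. AA k \<alpha>)"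
    by (subst sum.union_disjoint[OF finX1, symmetric]) (auto intro!: sum.cong)
  also have "\<dots> \<le> (\<Sum>\<alpha>\<in>?XA. real (card UU)) + (\<Sum>\<alpha>\<in>?XB. \<Sum>T\<in>Pow Ob. if PZ (Z - \<Union>T) dvd pderiv (cpoly n k \<alpha>) then ?q ^ card (Z - \<Union>T) else 0)"
    by (intro add_mono sum_mono AA_le kpos) auto
  also have "\<dots> \<le> real (card UU) * (real k * ?q ^ m) + real (2 ^ card Ob) * (real k * ?q powr (real ?D + ?e))"
  proof (rule add_mono)
    show "(\<Sum>\<alpha>\<in>?XA. real (card UU)) \<le> real (card UU) * (real k * ?q ^ m)"
      using X0 by (simp add: mult.commute mult_left_mono)
    have "(\<Sum>\<alpha>\<in>?XB. \<Sum>T\<in>Pow Ob. if PZ (Z - \<Union>T) dvd pderiv (cpoly n k \<alpha>) then ?q ^ card (Z - \<Union>T) else 0)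
      = (\<Sum>T\<in>Pow Ob. \<Sum>\<alpha>\<in>?XB. if PZ (Z - \<Union>T) dvd pderiv (cpoly n k \<alpha>) then ?q ^ card (Z - \<Union>T) else 0)"
      by (rule sum.swap)
    also have "\<dots> \<le> (\<Sum>T\<in>Pow Ob. real k * ?q powr (real ?D + ?e))" by (rule sum_mono[OF TX])
    also have "\<dots> = real (2 ^ card Ob) * (real k * ?q powr (real ?D + ?e))" using finite_Ob by (simp add: card_Pow)
    finally show "(\<Sum>\<alpha>\<in>?XB. \<Sum>T\<in>Pow Ob. if PZ (Z - \<Union>T) dvd pderiv (cpoly n k \<alpha>) then ?q ^ card (Z - \<Union>T) else 0) \<le> \<dots>" .
  qed
  finally have main: "(\<Sum>\<alpha>\<in>?X. AA k \<alpha>) \<le> real (card UU) * (real k * ?q ^ m) + real (2 ^ card Ob) * (real k * ?q powr (real ?D + ?e))" .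
  have "real (2 ^ card Ob) * (real k * ?q powr (real ?D + ?e)) \<le> real (card UU) * (real k * 4 ^ card Ob * ?q powr ?e)"
  proof -
    have "?q powr (real ?D + ?e) = real ((p ^ n) ^ ?D) * ?q powr ?e"
      by (simp only: powr_add of_nat_power[of "p ^ n" "degree g"] pw)
    also have "\<dots> \<le> real (2 ^ card Ob * card UU) * ?q powr ?e"
      using card_Un_lower by (intro mult_right_mono) (simp_all only: of_nat_le_iff, simp)
    finally have "real (2 ^ card Ob) * (real k * ?q powr (real ?D + ?e)) \<le> real (2 ^ card Ob) * (real k * (real (2 ^ card Ob * card UU) * ?q powr ?e))"
      by (intro mult_left_mono) auto
    also have "\<dots> = real (card UU) * (real k * (2 ^ card Ob * 2 ^ card Ob) * ?q powr ?e)" by (simp add: mult_ac)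
    also have "\<dots> = real (card UU) * (real k * 4 ^ card Ob * ?q powr ?e)" by (simp flip: power_mult_distrib)
    finally show ?thesis .
  qed
  then show ?thesis using main unfolding distrib_left by linarith
qed

lemma avg_bound:
  assumes p2: "p > 2" and m: "m > 0" and k: "k = p * m" "k \<le> 2 * degree g"
  shows "norm (\<Sum>h\<in>HH. char_sum p n \<psi> h g k) \<le> real (card HH) * (1 + real k * real (p ^ n) ^ m + real k * 4 ^ card Ob *
       real (p ^ n) powr (real k / 2 - (real (degree g) - real k / 2) / 3 + real p))"
proof -
  have kpos: "k > 0" using k m p2 by simp
  have "norm (\<Sum>h\<in>HH. char_sum p n \<psi> h g k) \<le> real (card TT) * (\<Sum>\<alpha>\<in>FF (n * k) - Z. AA k \<alpha>) + real (card HH)"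
    by (rule avg_le[OF kpos])
  also have "\<dots> \<le> real (card TT) * (real (card UU) *
     (real k * real (p ^ n) ^ m + real k * 4 ^ card Ob *
       real (p ^ n) powr (real k / 2 - (real (degree g) - real k / 2) / 3 + real p))) + real (card HH)"
    by (intro add_right_mono mult_left_mono sum_AA assms) auto
  also have "\<dots> = real (card HH) * (1 + real k * real (p ^ n) ^ m + real k * 4 ^ card Ob *
       real (p ^ n) powr (real k / 2 - (real (degree g) - real k / 2) / 3 + real p))"
    by (simp add: card_HH algebra_simps)
  finally show ?thesis .
qed

section \<open>The number of orbits of poles\<close>

lemma orb_eq: assumes "x \<in> Z" "y \<in> orb x" shows "orb y = orb x"
proof -
  obtain j where j: "y = x ^ (p ^ (n * j))" using assms by (auto simp: orb_def)
  obtain r0 where r0: "r0 > 0" "x \<in> FF (n * r0)"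
    using roots_in_FF[OF g_PO g_nz _ n_pos] assms(1) by (auto simp: Z_iff)
  have 1: "y ^ (p ^ (n * i)) = x ^ (p ^ (n * (j + i)))" for i
    by (simp add: j distrib_left power_add power_mult)
  have "x ^ (p ^ (n * i)) \<in> orb y" for i
  proof -
    have le: "j \<le> r0 * j" using r0(1) by simp
    \<comment> \<open>The extra \<open>r0 * j - j\<close> Frobenius steps complete the
      \<open>j\<close> steps from \<open>x\<close> to \<open>y\<close> to full periods.\<close>
    have "y ^ (p ^ (n * (r0 * j - j + i))) = x ^ (p ^ (n * (r0 * j + i)))"
      unfolding 1 by (rule arg_cong[of _ _ "\<lambda>t. x ^ (p ^ (n * t))"]) (use le in linarith)
    also have "\<dots> = (x ^ (p ^ (n * r0 * j))) ^ (p ^ (n * i))"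
      by (simp add: distrib_left power_add power_mult mult.assoc)
    also have "\<dots> = x ^ (p ^ (n * i))" by (simp add: frob_iter[OF r0(2)])
    finally show ?thesis unfolding orb_def by (rule range_eqI[OF sym])
  qed
  moreover have "y ^ (p ^ (n * i)) \<in> orb x" for i unfolding 1 orb_def by (rule rangeI)
  ultimately show ?thesis unfolding orb_def by blast
qed

text \<open>Points of degree at most \<open>t\<close> lie in the fields \<open>FF (n * r)\<close>
  with \<open>r \<le> t\<close>, whose sizes add up to at most \<open>q ^ (t + 1)\<close>. The
  remaining orbits are disjoint subsets of \<open>Z\<close> with more than \<open>t\<close> elements
  each.\<close>

lemma card_Ob_le: assumes t: "t > 0" shows "real (card Ob) \<le> real (p ^ n) ^ (t + 1) + real (degree g) / real t"
proof -
  let ?q = "p ^ n"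
  define sm where "sm = {x\<in>Z. odeg n x \<le> t}"
  define lg where "lg = {x\<in>Z. odeg n x > t}"
  have q1: "?q > 1" using p_gt_1 n_pos one_less_power by blast
  have rz: "\<exists>r0>0. x \<in> FF (n * r0)" if "x \<in> Z" for x
    using roots_in_FF[OF g_PO g_nz _ n_pos] that by (auto simp: Z_iff)
  have "Z = sm \<union> lg" by (auto simp: sm_def lg_def)
  then have Ob: "Ob = orb ` sm \<union> orb ` lg" by (simp add: Ob_def image_Un)
  have fin: "finite sm" "finite lg" using finite_Z by (auto simp: sm_def lg_def)
  have "sm \<subseteq> (\<Union>r\<in>{1..t}. FF (n * r))"
  proof
    fix x assume x: "x \<in> sm"
    then obtain r0 where r0: "r0 > 0" "x \<in> FF (n * r0)" using rz by (auto simp: sm_def)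
    show "x \<in> (\<Union>r\<in>{1..t}. FF (n * r))" using odeg(1,2)[OF r0(2,1)] x by (auto simp: sm_def intro!: bexI[of _ "odeg n x"])
  qed
  moreover have finU: "finite (\<Union>r\<in>{1..t}. FF (n * r))" using card_FF(2) n_pos by auto
  ultimately have "card sm \<le> card (\<Union>r\<in>{1..t}. FF (n * r))" by (rule card_mono[rotated])
  also have "\<dots> \<le> (\<Sum>r\<in>{1..t}. card (FF (n * r)))" by (rule card_UN_le) simp
  also have "\<dots> = (\<Sum>r\<in>{1..t}. ?q ^ r)" by (rule sum.cong) (use card_FF(1) n_pos in \<open>auto simp: power_mult\<close>)
  also have "\<dots> \<le> ?q ^ (t + 1)"
  proof -
    have "(\<Sum>r\<in>{1..s}. ?q ^ r) \<le> ?q ^ (s + 1)" for s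
    proof (induction s)
      case (Suc s)
      have "(\<Sum>r\<in>{1..Suc s}. ?q ^ r) \<le> ?q ^ (s + 1) + ?q ^ (s + 1)" using Suc by simp
      also have "\<dots> = 2 * ?q ^ (s + 1)" by simp
      also have "\<dots> \<le> ?q * ?q ^ (s + 1)" using q1 by (intro mult_right_mono) auto
      finally show ?case by simp
    qed simp
    then show ?thesis .
  qed
  finally have sm: "card sm \<le> ?q ^ (t + 1)" .
  have "t * card (orb ` lg) \<le> degree g"
  proof -
    have fo: "finite (orb x)" if "x \<in> lg" for x by (rule finite_subset[OF orb_subset finite_Z]) (use that in \<open>simp add: lg_def\<close>)
    have big: "t \<le> card (orb x)" if x: "x \<in> lg" for x
    proof -
      obtain r0 where r0: "r0 > 0" "x \<in> FF (n * r0)" using rz x by (auto simp: lg_def)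
      have "card ((\<lambda>j. x ^ (p ^ (n * j))) ` {..<odeg n x}) = odeg n x"
        using card_image[OF odeg_inj[OF r0(2,1)]] by simp
      moreover have "card ((\<lambda>j. x ^ (p ^ (n * j))) ` {..<odeg n x}) \<le> card (orb x)"
        by (rule card_mono[OF fo[OF x]]) (auto simp: orb_def)
      ultimately show ?thesis using x by (simp add: lg_def)
    qed
    have disj: "disjoint (orb ` lg)"
    proof (rule disjointI)
      fix a b assume ab: "a \<in> orb ` lg" "b \<in> orb ` lg" "a \<noteq> b"
      then obtain x y where xy: "x \<in> Z" "y \<in> Z" "a = orb x" "b = orb y" by (auto simp: lg_def)
      show "a \<inter> b = {}"
      proof (rule ccontr)
        assume "a \<inter> b \<noteq> {}"
        then obtain z where "z \<in> orb x" "z \<in> orb y" using xy by blast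
        then have "orb x = orb y" using orb_eq xy by metis
        then show False using ab xy by simp
      qed
    qed
    have "t * card (orb ` lg) = (\<Sum>O'\<in>orb ` lg. t)" by simp
    also have "\<dots> \<le> (\<Sum>O'\<in>orb ` lg. card O')" by (rule sum_mono) (use big in auto)
    also have "\<dots> = card (\<Union>(orb ` lg))"
      by (rule card_Union_disjoint[symmetric]) (use disj fo in \<open>auto simp: pairwise_def disjoint_def\<close>)
    also have "\<dots> \<le> card Z" by (rule card_mono[OF finite_Z]) (use orb_subset in \<open>auto simp: lg_def\<close>)
    finally show ?thesis by (simp add: card_Z)
  qed
  then have lg: "real (card (orb ` lg)) \<le> real (degree g) / real t"
    using t by (simp add: field_simps) (metis mult.commute of_nat_le_iff of_nat_mult)
  have "card Ob \<le> card (orb ` sm) + card (orb ` lg)" unfolding Ob by (rule card_Un_le)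
  also have "\<dots> \<le> card sm + card (orb ` lg)" using card_image_le[OF fin(1)] by simp
  finally have "real (card Ob) \<le> real (card sm) + real (card (orb ` lg))" by (metis of_nat_add of_nat_le_iff)
  moreover have "real (card sm) \<le> real ?q ^ (t + 1)" using sm by (metis of_nat_le_iff of_nat_power)
  ultimately show ?thesis using lg by linarith
qed

lemma card_Ob_le_degree: "card Ob \<le> degree g"
  unfolding Ob_def using card_image_le[OF finite_Z] card_Z by metis

end

section \<open>Poisson summation\<close>

inductive trig_poly :: "(real \<Rightarrow> complex) \<Rightarrow> bool" where
  monomial: "trig_poly (\<lambda>t. a * cis (2 * pi * of_int k * t))"
| add: "trig_poly u \<Longrightarrow> trig_poly v \<Longrightarrow> trig_poly (\<lambda>t. u t + v t)"

lemma trig_poly_const: "trig_poly (\<lambda>t. a)"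
  using trig_poly.monomial[of a 0] by simp

lemma trig_poly_mult: assumes "trig_poly u" "trig_poly v" shows "trig_poly (\<lambda>t. u t * v t)"
  using assms(1)
proof induction
  case (monomial a k)
  show ?case using assms(2)
  proof induction
    case (monomial b l)
    have "(\<lambda>t. a * cis (2 * pi * of_int k * t) * (b * cis (2 * pi * of_int l * t))) =
        (\<lambda>t. (a * b) * cis (2 * pi * of_int (k + l) * t))"
      by (simp add: fun_eq_iff cis_mult[symmetric] distrib_left distrib_right mult_ac)
    then show ?case using trig_poly.monomial[of "a * b" "k + l"] by simp
  next
    case (add u v)
    then show ?case using trig_poly.add by (simp add: distrib_left)
  qed
next
  case (add u v)
  then show ?case using trig_poly.add by (simp add: distrib_right)
qed

lemma trig_poly_real_polynomial:
  fixes r :: "complex \<Rightarrow> real"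
  assumes "real_polynomial_function r"
  shows "trig_poly (\<lambda>t. of_real (r (cis (2 * pi * t))))"
  using assms
proof induction
  case (linear r)
  then interpret bounded_linear r .
  have r: "r z = Re z * r 1 + Im z * r \<i>" for z
  proof -
    have "z = Re z *\<^sub>R 1 + Im z *\<^sub>R \<i>" by (simp add: complex_eq_iff)
    then have "r z = r (Re z *\<^sub>R 1 + Im z *\<^sub>R \<i>)" by simp
    then show ?thesis by (simp only: add scaleR real_scaleR_def)
  qed
  let ?a = "of_real (r 1) / 2 - \<i> * of_real (r \<i>) / 2" and ?b = "of_real (r 1) / 2 + \<i> * of_real (r \<i>) / 2"
  \<comment> \<open>On the circle a real-linear map is \<open>r 1 * cos + r \<i> * sin\<close>,
    rewritten here in the exponentials of frequency 1 and -1.\<close>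
  have "(\<lambda>t. complex_of_real (r (cis (2 * pi * t)))) =
      (\<lambda>t. ?a * cis (2 * pi * of_int 1 * t) + ?b * cis (2 * pi * of_int (-1) * t))"
    by (rule ext, subst r) (simp add: complex_eq_iff field_simps)
  then show ?case by (simp only:) (rule trig_poly.add[OF trig_poly.monomial trig_poly.monomial])
next
  case (const c)
  show ?case by (rule trig_poly_const)
next
  case (add f g)
  then show ?case using trig_poly.add by simp
next
  case (mult f g)
  then show ?case using trig_poly_mult by simp
qed

lemma trig_poly_continuous: "trig_poly u \<Longrightarrow> continuous_on S u"
  by (induction rule: trig_poly.induct) (auto intro!: continuous_intros simp: cis_conv_exp)

lemma trig_poly_orthogonal:
  assumes cont: "continuous_on {0..1} E"
    and orth: "\<And>k::int. integral {0..1} (\<lambda>t. E t * cis (2 * pi * of_int k * t)) = 0" and "trig_poly u"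
  shows "integral {0..1} (\<lambda>t. E t * u t) = 0"
  using assms(3)
proof induction
  case (monomial a k)
  have "integral {0..1} (\<lambda>t. E t * (a * cis (2 * pi * of_int k * t))) = integral {0..1} (\<lambda>t. a * (E t * cis (2 * pi * of_int k * t)))"
    by (simp add: mult_ac)
  then show ?case using orth[of k] by simp
next
  case (add u v)
  have "(\<lambda>t. E t * u t) integrable_on {0..1}" "(\<lambda>t. E t * v t) integrable_on {0..1}"
    using add trig_poly_continuous cont by (auto intro!: integrable_continuous_interval continuous_on_mult)
  then show ?case using add by (simp add: distrib_left integral_add)
qed

lemma periodic_cis:
  fixes E :: "real \<Rightarrow> complex"
  assumes per: "\<And>t. E (t + 1) = E t" and "cis (2 * pi * s) = cis (2 * pi * t)"
  shows "E s = E t"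
proof -
  have nat: "E (t + real k) = E t" for t k
  proof (induction k)
    case (Suc k)
    have "t + real (Suc k) = (t + real k) + 1" by simp
    then show ?case using Suc per by (simp only:)
  qed simp
  have int: "E (t + of_int k) = E t" for t and k :: int
  proof (cases "k \<ge> 0")
    case True
    then show ?thesis using nat[of t "nat k"] by simp
  next
    case False
    then show ?thesis using nat[of "t + of_int k" "nat (- k)"] by simp
  qed
  have "exp (\<i> * complex_of_real (2 * pi * s)) = exp (\<i> * complex_of_real (2 * pi * t))"
    using assms(2) by (simp add: cis_conv_exp)
  then obtain k :: int where "\<i> * complex_of_real (2 * pi * s) = \<i> * complex_of_real (2 * pi * t) + (of_int (2 * k) * pi) * \<i>"
    using exp_eq by blast
  then have "Im (\<i> * complex_of_real (2 * pi * s)) = Im (\<i> * complex_of_real (2 * pi * t) + (of_int (2 * k) * pi) * \<i>)" by simp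
  then have "2 * pi * s = 2 * pi * (t + of_int k)" by (simp add: algebra_simps)
  then have "s = t + of_int k" by simp
  then show ?thesis using int by simp
qed

text \<open>\<open>E\<close> descends to a continuous function on the circle, which
  Stone-Weierstrass approximates by polynomials, hence by trigonometric ones. Orthogonality to these
  bounds the integral of \<open>|E|^2\<close> by a bound for \<open>|E|\<close> times an arbitrary
  error.\<close>

lemma fourier_uniqueness:
  fixes E :: "real \<Rightarrow> complex"
  assumes cont: "continuous_on UNIV E" and per: "\<And>t. E (t + 1) = E t"
    and orth: "\<And>k::int. integral {0..1} (\<lambda>t. E t * cis (2 * pi * of_int k * t)) = 0"
  shows "E t = 0"
proof -
  define H where "H z = E (Arg z / (2 * pi))" for z
  have Hcis: "H (cis (2 * pi * t)) = E t" for t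
    unfolding H_def by (rule periodic_cis[where E = E, OF per]) (simp add: cis_Arg sgn_div_norm)
  \<comment> \<open>\<open>Arg\<close> jumps across the negative real axis; this second expression
    for \<open>H\<close> is continuous there.\<close>
  have H2: "H z = E (Arg (- z) / (2 * pi) + 1 / 2)" if "z \<noteq> 0" for z
    unfolding H_def
  proof (rule periodic_cis[where E = E, OF per])
    have "cis (2 * pi * (Arg (- z) / (2 * pi) + 1 / 2)) = cis (Arg (- z)) * cis pi"
      by (simp only: cis_mult) (simp add: distrib_left)
    then show "cis (2 * pi * (Arg z / (2 * pi))) = cis (2 * pi * (Arg (- z) / (2 * pi) + 1 / 2))"
      using that by (simp add: cis_Arg sgn_minus)
  qed
  have contE: "isCont E s" for s using cont by (simp add: continuous_on_eq_continuous_at)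
  have contH: "continuous_on (sphere 0 1) H"
  proof (rule continuous_at_imp_continuous_on, rule ballI)
    fix z :: complex assume "z \<in> sphere 0 1"
    then have z0: "z \<noteq> 0" by auto
    show "isCont H z"
    proof (cases "z \<in> \<real>\<^sub>\<le>\<^sub>0")
      case False
      then have "isCont Arg z" by (rule continuous_at_Arg)
      then have "isCont (\<lambda>z. Arg z / (2 * pi)) z" by (intro continuous_intros) auto
      then have "isCont (\<lambda>z. E (Arg z / (2 * pi))) z" by (rule isCont_o2[OF _ contE])
      then show ?thesis by (simp add: H_def[abs_def])
    next
      case True
      then have "- z \<notin> \<real>\<^sub>\<le>\<^sub>0" using z0 by (auto simp: complex_nonpos_Reals_iff complex_eq_iff)
      then have "isCont Arg (- z)" by (rule continuous_at_Arg)
      then have "isCont (\<lambda>z. Arg (- z)) z" by (intro isCont_o2[where f = uminus and g = Arg] continuous_intros)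
      then have "isCont (\<lambda>z. Arg (- z) / (2 * pi) + 1 / 2) z" by (intro continuous_intros) auto
      then have c: "isCont (\<lambda>z. E (Arg (- z) / (2 * pi) + 1 / 2)) z" by (rule isCont_o2[OF _ contE])
      have "eventually (\<lambda>w. H w = E (Arg (- w) / (2 * pi) + 1 / 2)) (nhds z)"
        using t1_space_nhds[OF z0] by (rule eventually_mono) (use H2 in auto)
      then show ?thesis using c by (simp add: isCont_cong)
    qed
  qed
  obtain B where B: "\<And>t. t \<in> {0..1} \<Longrightarrow> norm (E t) \<le> B"
  proof -
    have "compact (E ` {0..1})" using cont by (intro compact_continuous_image continuous_on_subset[OF cont]) auto
    then have "bounded (E ` {0..1})" by (rule compact_imp_bounded)
    then obtain B where "\<forall>x\<in>E ` {0..1}. norm x \<le> B" unfolding bounded_iff by blast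
    then show ?thesis using that by blast
  qed
  have B0: "B \<ge> 0" using B[of 0] norm_ge_zero[of "E 0"] by (simp add: order_trans[OF norm_ge_zero])
  have cont01: "continuous_on {0..1} E" by (rule continuous_on_subset[OF cont]) simp
  define I where "I = integral {0..1} (\<lambda>t. (norm (E t))\<^sup>2)"
  have I_eq: "integral {0..1} (\<lambda>t. E t * cnj (E t)) = of_real I"
  proof -
    have "(\<lambda>t. E t * cnj (E t)) = (\<lambda>t. complex_of_real ((norm (E t))\<^sup>2))"
      by (rule ext) (rule complex_norm_square[symmetric])
    moreover have "((\<lambda>t. complex_of_real ((norm (E t))\<^sup>2)) has_integral of_real I) {0..1}"
      unfolding I_def
      by (intro has_integral_of_real integrable_integral integrable_continuous_interval continuous_intros cont01)
    ultimately show ?thesis by (simp add: integral_unique)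
  qed
  have le: "I \<le> B * e" if e: "e > 0" for e
  proof -
    obtain G where G: "polynomial_function G" "\<And>z. z \<in> sphere 0 1 \<Longrightarrow> norm (H z - G z) < e"
      using Stone_Weierstrass_polynomial_function[OF compact_sphere contH e] by blast
    have rp: "real_polynomial_function (\<lambda>z. Re (G z))" "real_polynomial_function (\<lambda>z. Im (G z))"
      using G(1) bounded_linear_Re bounded_linear_Im unfolding polynomial_function_def o_def by auto
    define u where "u t = of_real (Re (G (cis (2 * pi * t)))) + (- \<i>) * of_real (Im (G (cis (2 * pi * t))))" for t
    have tu: "trig_poly u" unfolding u_def
      by (intro trig_poly.add trig_poly_mult trig_poly_const trig_poly_real_polynomial rp)
    have u: "u t = cnj (G (cis (2 * pi * t)))" for t by (simp add: u_def complex_eq_iff)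
    have close: "norm (cnj (E t) - u t) < e" for t
    proof -
      have "norm (H (cis (2 * pi * t)) - G (cis (2 * pi * t))) < e" by (rule G(2)) simp
      then show ?thesis unfolding Hcis u by (metis complex_cnj_diff complex_mod_cnj)
    qed
    have i1: "(\<lambda>t. E t * cnj (E t)) integrable_on {0..1}" "(\<lambda>t. E t * u t) integrable_on {0..1}"
      by (intro integrable_continuous_interval continuous_intros cont01 trig_poly_continuous[OF tu])+
    have "of_real I = integral {0..1} (\<lambda>t. E t * cnj (E t)) - integral {0..1} (\<lambda>t. E t * u t)"
      using I_eq trig_poly_orthogonal[OF cont01 orth tu] by simp
    also have "\<dots> = integral {0..1} (\<lambda>t. E t * (cnj (E t) - u t))"
      by (subst integral_diff[OF i1, symmetric]) (simp add: right_diff_distrib)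
    finally have "norm (complex_of_real I) = norm (integral {0..1} (\<lambda>t. E t * (cnj (E t) - u t)))" by simp
    also have "\<dots> \<le> integral {0..1} (\<lambda>t::real. B * e)"
    proof (rule integral_norm_bound_integral)
      show "(\<lambda>t. E t * (cnj (E t) - u t)) integrable_on {0..1}"
        by (intro integrable_continuous_interval continuous_intros cont01 trig_poly_continuous[OF tu])
      fix t :: real assume "t \<in> {0..1}"
      then show "norm (E t * (cnj (E t) - u t)) \<le> B * e"
        unfolding norm_mult using B close[of t] B0 by (intro mult_mono) auto
    qed (rule integrable_const_ivl)
    finally show ?thesis by simp
  qed
  have "I \<le> 0"
  proof (rule field_le_epsilon)
    fix e :: real assume e: "e > 0"
    have "I \<le> B * (e / (B + 1))" using le[of "e / (B + 1)"] e B0 by simp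
    also have "\<dots> \<le> e" using e B0 by (simp add: field_simps)
    finally show "I \<le> 0 + e" by simp
  qed
  moreover have "I \<ge> 0" unfolding I_def by (rule integral_nonneg) (auto intro!: integrable_continuous_interval continuous_intros cont01)
  ultimately have "I = 0" by simp
  moreover have c2: "continuous_on {0..1} (\<lambda>t. (norm (E t))\<^sup>2)" by (intro continuous_intros cont01)
  ultimately have "\<forall>t\<in>{0..1}. (norm (E t))\<^sup>2 = 0"
    using integral_eq_0_iff[OF c2] by (simp add: I_def)
  then have z: "E s = 0" if "s \<in> {0..1}" for s using that by simp
  have "E t = E (frac t)"
  proof (rule periodic_cis[where E = E, OF per])
    have "cis (2 * pi * t) = cis (2 * pi * frac t) * cis (2 * pi * of_int \<lfloor>t\<rfloor>)"
      by (simp add: cis_mult frac_def algebra_simps)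
    then show "cis (2 * pi * t) = cis (2 * pi * frac t)" by (simp add: cis_multiple_2pi)
  qed
  then show ?thesis using z[of "frac t"] frac_ge_0[of t] frac_lt_1[of t] by simp
qed

section \<open>Decay, periodisation and its Fourier coefficients\<close>

lemma integrable_inverse_square: "integrable lborel (\<lambda>t::real. 1 / (1 + t\<^sup>2))"
proof -
  have half: "(\<integral>\<^sup>+t. ennreal (1 / (1 + t\<^sup>2)) * indicator {0..} t \<partial>lborel) = ennreal (pi / 2 - arctan 0)"
    by (rule nn_integral_FTC_atLeast) (auto intro!: derivative_eq_intros tendsto_arctan_at_top simp: inverse_eq_divide)
  have refl: "(\<integral>\<^sup>+t. ennreal (1 / (1 + t\<^sup>2)) * indicator {..0} t \<partial>lborel) = (\<integral>\<^sup>+t. ennreal (1 / (1 + t\<^sup>2)) * indicator {0..} t \<partial>lborel)"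
  proof -
    have "(\<integral>\<^sup>+t. ennreal (1 / (1 + t\<^sup>2)) * indicator {..0} t \<partial>lborel) =
        ennreal \<bar>- 1\<bar> * (\<integral>\<^sup>+t. ennreal (1 / (1 + (0 + -1 * t)\<^sup>2)) * indicator {..0} (0 + -1 * t) \<partial>lborel)"
      by (rule nn_integral_real_affine) auto
    also have "\<dots> = (\<integral>\<^sup>+t. ennreal (1 / (1 + t\<^sup>2)) * indicator {0..} t \<partial>lborel)"
      by (simp, rule nn_integral_cong) (auto simp: indicator_def)
    finally show ?thesis .
  qed
  have "(\<integral>\<^sup>+t. ennreal (1 / (1 + t\<^sup>2)) \<partial>lborel) \<le>
      (\<integral>\<^sup>+t. ennreal (1 / (1 + t\<^sup>2)) * indicator {0..} t + ennreal (1 / (1 + t\<^sup>2)) * indicator {..0} t \<partial>lborel)"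
    by (rule nn_integral_mono) (auto simp: indicator_def)
  also have "\<dots> = (\<integral>\<^sup>+t. ennreal (1 / (1 + t\<^sup>2)) * indicator {0..} t \<partial>lborel) + (\<integral>\<^sup>+t. ennreal (1 / (1 + t\<^sup>2)) * indicator {..0} t \<partial>lborel)"
    by (rule nn_integral_add) auto
  also have "\<dots> < \<infinity>" unfolding refl half by simp
  finally show ?thesis by (intro integrableI_bounded) auto
qed

lemma summable_on_int_inverse_square: "(\<lambda>m::int. 1 / (1 + (of_int m)\<^sup>2) :: real) summable_on UNIV"
proof -
  let ?f = "\<lambda>m::int. 1 / (1 + (of_int m)\<^sup>2) :: real"
  have "summable (\<lambda>k::nat. 1 / (1 + (real k)\<^sup>2))"
  proof (rule summable_comparison_test'[where N = 1])
    show "summable (\<lambda>k. inverse (real k ^ 2))" by (rule inverse_power_summable) simp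
    fix k :: nat assume "k \<ge> 1"
    then have "1 / (1 + (real k)\<^sup>2) \<le> 1 / (real k)\<^sup>2" by (intro divide_left_mono) (auto simp: add_pos_nonneg)
    then show "norm (1 / (1 + (real k)\<^sup>2)) \<le> inverse (real k ^ 2)" by (simp add: inverse_eq_divide)
  qed
  then have s: "(\<lambda>k::nat. 1 / (1 + (real k)\<^sup>2)) summable_on UNIV"
    by (subst summable_on_UNIV_nonneg_real_iff) auto
  have "?f summable_on (range int)" using s by (subst summable_on_reindex) (auto simp: o_def)
  moreover have "?f summable_on (range (\<lambda>k. - int k))"
    using s by (subst summable_on_reindex) (auto simp: o_def inj_on_def)
  then have "?f summable_on (range (\<lambda>k. - int k) - range int)" by (rule summable_on_subset_banach) auto
  ultimately have "?f summable_on (range int \<union> (range (\<lambda>k. - int k) - range int))"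
    by (rule summable_on_Un_disjoint) auto
  moreover have "range int \<union> (range (\<lambda>k. - int k) - range int) = UNIV"
  proof -
    have "m \<in> range int \<or> m \<in> range (\<lambda>k. - int k)" for m :: int
      by (cases "m \<ge> 0") (auto intro: range_eqI[of _ _ "nat m"] range_eqI[of _ _ "nat (- m)"])
    then show ?thesis by auto
  qed
  ultimately show ?thesis by simp
qed

text \<open>Decay of order 2 makes \<open>\<Phi>\<close> integrable and its periodisation uniformly
  convergent.\<close>

lemma schwartz_bound:
  assumes "schwartz \<Phi>"
  obtains C where "C \<ge> 0" "\<And>t. norm (\<Phi> t) \<le> C / (1 + t\<^sup>2)" "continuous_on UNIV \<Phi>"
proof -
  obtain D :: "nat \<Rightarrow> real \<Rightarrow> complex" where D: "D 0 = \<Phi>" "\<And>k t. (D k has_vector_derivative D (Suc k) t) (at t)"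
    "\<And>k m. \<exists>C. \<forall>t. \<bar>t\<bar> ^ m * norm (D k t) \<le> C"
    using assms unfolding schwartz_def by blast
  obtain C0 where C0: "\<And>t. \<bar>t\<bar> ^ 0 * norm (\<Phi> t) \<le> C0" using D(3)[of 0 0] D(1) by auto
  obtain C2 where C2: "\<And>t. \<bar>t\<bar> ^ 2 * norm (\<Phi> t) \<le> C2" using D(3)[of 2 0] D(1) by auto
  have "norm (\<Phi> t) \<le> (C0 + C2) / (1 + t\<^sup>2)" for t
  proof -
    have "(1 + t\<^sup>2) * norm (\<Phi> t) \<le> C0 + C2" using C0[of t] C2[of t] by (simp add: distrib_right)
    moreover have "1 + t\<^sup>2 > 0" by (simp add: add_pos_nonneg)
    ultimately show ?thesis by (simp add: pos_le_divide_eq mult.commute)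
  qed
  moreover have "C0 + C2 \<ge> 0"
  proof -
    have "norm (\<Phi> 0) \<le> C0" "0 \<le> C2" using C0[of 0] C2[of 0] by simp_all
    then show ?thesis using norm_ge_zero[of "\<Phi> 0"] by linarith
  qed
  moreover have "isCont \<Phi> t" for t using D(1) D(2)[of 0 t] has_vector_derivative_continuous by metis
  then have "continuous_on UNIV \<Phi>" by (simp add: continuous_at_imp_continuous_on)
  ultimately show ?thesis using that by blast
qed

context
  fixes \<Phi> :: "real \<Rightarrow> complex" and C :: real and N :: nat
  assumes C: "C \<ge> 0" "\<And>t. norm (\<Phi> t) \<le> C / (1 + t\<^sup>2)" "continuous_on UNIV \<Phi>" and N: "N > 0"
begin

lemma Phi_integrable: "integrable lborel \<Phi>"
proof (rule Bochner_Integration.integrable_bound)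
  show "integrable lborel (\<lambda>t. C * (1 / (1 + t\<^sup>2)))" by (intro integrable_mult_right integrable_inverse_square)
  show "\<Phi> \<in> borel_measurable lborel" using borel_measurable_continuous_onI[OF C(3)] by simp
  show "AE t in lborel. norm (\<Phi> t) \<le> norm (C * (1 / (1 + t\<^sup>2)))"
    using C by (auto intro!: AE_I2 simp: abs_mult)
qed

text \<open>For \<open>x = N (t + m)\<close>, the inequality
  \<open>m^2 \<le> 2 (t + m)^2 + 2 t^2\<close> with \<open>t^2 \<le> 1\<close> and
  \<open>N \<ge> 1\<close> yields \<open>1 + m^2 \<le> 3 (1 + x^2)\<close>. The interval is longer
  than a period so that \<open>phiN_continuous\<close> can move every \<open>t\<close> to an
  interior point.\<close>

lemma term_bound: assumes "t \<in> {-1..1}" shows "norm (\<Phi> (real N * (t + of_int m))) \<le> 3 * C * (1 / (1 + (of_int m)\<^sup>2))"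
proof -
  let ?x = "real N * (t + of_int m)" and ?m = "of_int m :: real"
  have N1: "real N \<ge> 1" using N by simp
  have "(t + ?m)\<^sup>2 \<le> ?x\<^sup>2"
  proof -
    have "1 * (t + ?m)\<^sup>2 \<le> (real N)\<^sup>2 * (t + ?m)\<^sup>2" using N1 by (intro mult_right_mono) auto
    then show ?thesis by (simp add: power_mult_distrib)
  qed
  moreover have "?m\<^sup>2 \<le> 2 * (t + ?m)\<^sup>2 + 2 * t\<^sup>2"
  proof -
    have "2 * (t + ?m)\<^sup>2 + 2 * t\<^sup>2 - ?m\<^sup>2 = (2 * t + ?m)\<^sup>2" by (simp add: power2_eq_square algebra_simps)
    then show ?thesis using zero_le_power2[of "2 * t + ?m"] by linarith
  qed
  moreover have "t\<^sup>2 \<le> 1" using assms by (simp add: abs_square_le_1 abs_le_iff)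
  ultimately have "1 + ?m\<^sup>2 \<le> 3 * (1 + ?x\<^sup>2)" using zero_le_power2[of ?x] by argo
  then have "1 / (1 + ?x\<^sup>2) \<le> 3 * (1 / (1 + ?m\<^sup>2))"
    by (simp add: divide_simps add_pos_nonneg)
  then have "C * (1 / (1 + ?x\<^sup>2)) \<le> C * (3 * (1 / (1 + ?m\<^sup>2)))" using C(1) by (rule mult_left_mono)
  then show ?thesis using C(2)[of ?x] by (simp add: mult_ac)
qed

lemma uniform_phi: "uniform_limit {-1..1} (\<lambda>X t. \<Sum>m\<in>X. \<Phi> (real N * (t + of_int m))) (phiN \<Phi> N) (finite_subsets_at_top UNIV)"
  unfolding phiN_def
  by (rule Weierstrass_m_test_general[where M = "\<lambda>m. 3 * C * (1 / (1 + (of_int m)\<^sup>2))"])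
    (auto intro!: term_bound summable_on_cmult_right summable_on_int_inverse_square simp del: times_divide_eq_right)

lemma term_continuous: "continuous_on S (\<lambda>t. \<Phi> (real N * (t + of_int m)))"
  by (rule continuous_on_compose2[OF C(3)]) (auto intro!: continuous_intros)

lemma phiN_periodic: "phiN \<Phi> N (t + 1) = phiN \<Phi> N t"
  unfolding phiN_def
  by (rule infsum_reindex_bij_witness[where i = "\<lambda>m. m - 1" and j = "\<lambda>m. m + 1"]) (auto simp: algebra_simps)

lemma phiN_continuous: "continuous_on UNIV (phiN \<Phi> N)"
proof -
  have c: "continuous_on {-1..1} (phiN \<Phi> N)"
    by (rule uniform_limit_theorem[OF _ uniform_phi]) (auto intro!: always_eventually continuous_on_sum term_continuous)
  have "isCont (phiN \<Phi> N) t" for t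
  proof -
    define s where "s = t - of_int \<lfloor>t + 1 / 2\<rfloor>"
    have s: "s \<in> {-1<..<1}" unfolding s_def by (simp, linarith)
    have "isCont (phiN \<Phi> N) s"
      using c s by (intro continuous_on_interior[OF c]) (auto simp: interior_cbox[where 'a=real, simplified])
    then have "isCont (\<lambda>x. phiN \<Phi> N (x - of_int \<lfloor>t + 1 / 2\<rfloor>)) t"
      unfolding s_def by (intro isCont_o2[where g = "phiN \<Phi> N" and f = "\<lambda>x. x - of_int \<lfloor>t + 1 / 2\<rfloor>"] continuous_intros)
    moreover have "(\<lambda>x. phiN \<Phi> N (x - of_int \<lfloor>t + 1 / 2\<rfloor>)) = phiN \<Phi> N"
    proof
      fix x show "phiN \<Phi> N (x - of_int \<lfloor>t + 1 / 2\<rfloor>) = phiN \<Phi> N x"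
      proof (rule periodic_cis[where E = "phiN \<Phi> N", OF phiN_periodic])
        have "cis (2 * pi * x) = cis (2 * pi * (x - of_int \<lfloor>t + 1 / 2\<rfloor>)) * cis (2 * pi * of_int \<lfloor>t + 1 / 2\<rfloor>)"
          by (simp add: cis_mult algebra_simps)
        then show "cis (2 * pi * (x - of_int \<lfloor>t + 1 / 2\<rfloor>)) = cis (2 * pi * x)" by (simp add: cis_multiple_2pi)
      qed
    qed
    ultimately show ?thesis by simp
  qed
  then show ?thesis by (simp add: continuous_at_imp_continuous_on)
qed

text \<open>Unfolding: the integer translates of the unit interval tile the line and
  \<open>e\<close> has period 1. Rescaling by \<open>N\<close> produces both the argument
  \<open>k / N\<close> and the factor \<open>1 / N\<close>.\<close>

lemma phiN_coeff: "integral {0..1} (\<lambda>t. phiN \<Phi> N t * cis (- (2 * pi * of_int k * t))) = fourier \<Phi> (of_int k / real N) / of_nat N"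
proof -
  define e where "e t = cis (- (2 * pi * of_int k * t))" for t
  have e1: "e (t + of_int m) = e t" for t and m :: int
  proof -
    have "e (t + of_int m) = e t * cis (2 * pi * of_int (- k * m))"
      unfolding e_def cis_mult by (rule arg_cong[of _ _ cis]) (simp add: algebra_simps)
    then show ?thesis using cis_multiple_2pi[of "of_int (- k * m)"] by simp
  qed
  have ce: "continuous_on S e" for S unfolding e_def cis_conv_exp by (intro continuous_intros)
  define f where "f s = \<Phi> (real N * s) * e s" for s
  have cf: "continuous_on S f" for S unfolding f_def
    by (intro continuous_on_mult ce continuous_on_compose2[OF C(3)]) (auto intro!: continuous_intros)
  have ul: "uniform_limit {0..1} (\<lambda>X t. (\<Sum>m\<in>X. \<Phi> (real N * (t + of_int m))) * e t) (\<lambda>t. phiN \<Phi> N t * e t) (finite_subsets_at_top UNIV)"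
  proof (rule uniform_lim_mult)
    show "uniform_limit {0..1} (\<lambda>X t. \<Sum>m\<in>X. \<Phi> (real N * (t + of_int m))) (phiN \<Phi> N) (finite_subsets_at_top UNIV)"
      by (rule uniform_limit_on_subset[OF uniform_phi]) auto
    show "uniform_limit {0..1} (\<lambda>X. e) e (finite_subsets_at_top UNIV)" by (rule uniform_limit_const)
    show "bounded (phiN \<Phi> N ` {0..1})"
      by (intro compact_imp_bounded compact_continuous_image continuous_on_subset[OF phiN_continuous]) auto
    show "bounded (e ` {0..1})" by (intro compact_imp_bounded compact_continuous_image ce) auto
  qed
  \<comment> \<open>The sum converges along the net of all finite sets of integers; along these
    intervals the integrals join up to one over \<open>[-j, j]\<close>.\<close>
  have filt: "filterlim (\<lambda>j::nat. {- int j..<int j}) (finite_subsets_at_top UNIV) sequentially"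
    unfolding filterlim_finite_subsets_at_top
  proof (intro allI impI)
    fix X :: "int set" assume X: "finite X \<and> X \<subseteq> UNIV"
    define K where "K = Suc (nat (Max (insert 0 (abs ` X))))"
    have "x \<in> {- int j..<int j}" if "x \<in> X" "j \<ge> K" for x j
    proof -
      have "\<bar>x\<bar> \<le> Max (insert 0 (abs ` X))" using X that by (intro Max_ge) auto
      then show ?thesis using that(2) unfolding K_def by auto
    qed
    then show "\<forall>\<^sub>F j in sequentially. finite {- int j..<int j} \<and> X \<subseteq> {- int j..<int j} \<and> {- int j..<int j} \<subseteq> UNIV"
      unfolding eventually_sequentially by (intro exI[of _ K]) auto
  qed
  obtain I J where IJ: "\<And>X. ((\<lambda>t. (\<Sum>m\<in>X. \<Phi> (real N * (t + of_int m))) * e t) has_integral I X) {0..1}"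
    "((\<lambda>t. phiN \<Phi> N t * e t) has_integral J) {0..1}" "(I \<longlongrightarrow> J) (finite_subsets_at_top UNIV)"
  proof (rule uniform_limit_integral[OF ul])
    show "continuous_on {0..1} (\<lambda>t. (\<Sum>m\<in>X. \<Phi> (real N * (t + of_int m))) * e t)" for X
      by (intro continuous_on_mult continuous_on_sum term_continuous ce)
  qed auto
  have lim1: "(\<lambda>j. I {- int j..<int j}) \<longlonglongrightarrow> J" using filterlim_compose[OF IJ(3) filt] .
  have fint: "f integrable_on {a..b}" for a b by (intro integrable_continuous_interval cf)
  have piece: "integral {0..1} (\<lambda>t. \<Phi> (real N * (t + of_int m)) * e t) = integral {of_int m..of_int m + 1} f" for m :: int
  proof -
    have "integral {0..1} (f \<circ> (+) (of_int m)) = integral {0 + of_int m..1 + of_int m} f" by (rule integral_shift_Icc_real)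
    moreover have "f \<circ> (+) (of_int m) = (\<lambda>t. \<Phi> (real N * (t + of_int m)) * e t)"
      by (auto simp: fun_eq_iff f_def add.commute[of "of_int m"] e1)
    ultimately show ?thesis by (simp add: add.commute)
  qed
  have Ij: "I {- int j..<int j} = integral {- real j..real j} f" for j
  proof -
    have "I {- int j..<int j} = integral {0..1} (\<lambda>t. \<Sum>m\<in>{- int j..<int j}. \<Phi> (real N * (t + of_int m)) * e t)"
      using integral_unique[OF IJ(1)[of "{- int j..<int j}"]] by (simp add: sum_distrib_right)
    also have "\<dots> = (\<Sum>m\<in>{- int j..<int j}. integral {0..1} (\<lambda>t. \<Phi> (real N * (t + of_int m)) * e t))"
      by (rule integral_sum) (auto intro!: integrable_continuous_interval continuous_on_mult term_continuous ce)
    also have "\<dots> = (\<Sum>m\<in>{- int j..<int j}. integral {of_int m..of_int m + 1} f)" unfolding piece ..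
    also have "\<dots> = integral {- real j..real j} f"
    proof (induction j)
      case (Suc j)
      have "{- int (Suc j)..<int (Suc j)} = insert (- int (Suc j)) (insert (int j) {- int j..<int j})" by auto
      then have "(\<Sum>m\<in>{- int (Suc j)..<int (Suc j)}. integral {of_int m..of_int m + 1} f) =
        integral {- real (Suc j)..- real j} f + (integral {real j..real (Suc j)} f + integral {- real j..real j} f)"
        using Suc by (simp add: add.commute)
      also have "integral {real j..real (Suc j)} f + integral {- real j..real j} f = integral {- real j..real (Suc j)} f"
        using Henstock_Kurzweil_Integration.integral_combine[of "- real j" "real j" "real (Suc j)" f] fint by (simp add: add.commute)
      also have "integral {- real (Suc j)..- real j} f + integral {- real j..real (Suc j)} f = integral {- real (Suc j)..real (Suc j)} f"
        using Henstock_Kurzweil_Integration.integral_combine[of "- real (Suc j)" "- real j" "real (Suc j)" f] fint by simp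
      finally show ?case .
    qed simp
    finally show ?thesis .
  qed
  define F where "F t = \<Phi> t * exp (- 2 * of_real pi * \<i> * of_real (of_int k / real N) * of_real t)" for t
  have f_F: "f s = F (0 + real N * s)" for s
    using N by (simp add: f_def F_def e_def cis_conv_exp) (simp add: mult_ac)
  have ne: "norm (e t) = 1" for t by (simp add: e_def)
  have Fint: "integrable lborel F"
  proof (rule Bochner_Integration.integrable_bound[OF Phi_integrable])
    have "continuous_on UNIV F" unfolding F_def by (intro continuous_intros C(3)) (use N in auto)
    then show "F \<in> borel_measurable lborel" using borel_measurable_continuous_onI[of F] by simp
    show "AE t in lborel. norm (F t) \<le> norm (\<Phi> t)" by (auto simp: F_def norm_mult)
  qed
  have fI: "integrable lborel f" unfolding f_F using lborel_integrable_real_affine[OF Fint, of "real N" 0] N by simp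
  have LF: "(LINT s|lborel. f s) = fourier \<Phi> (of_int k / real N) / of_nat N"
  proof -
    have "fourier \<Phi> (of_int k / real N) = (LINT t|lborel. F t)" by (simp add: fourier_def F_def)
    also have "\<dots> = \<bar>real N\<bar> *\<^sub>R (LINT s|lborel. F (0 + real N * s))" by (rule lborel_integral_real_affine) (use N in auto)
    also have "\<dots> = of_nat N * (LINT s|lborel. f s)" unfolding f_F[symmetric] by (simp add: scaleR_conv_of_real)
    finally show ?thesis using N by simp
  qed
  have "(\<lambda>j. LINT s|lborel. indicator {- real j..real j} s *\<^sub>R f s) \<longlonglongrightarrow> (LINT s|lborel. f s)"
  proof (rule integral_dominated_convergence[where w = "\<lambda>s. norm (f s)"])
    show "AE s in lborel. (\<lambda>j. indicator {- real j..real j} s *\<^sub>R f s) \<longlonglongrightarrow> f s"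
    proof (rule AE_I2)
      fix s :: real
      obtain K :: nat where K: "\<bar>s\<bar> \<le> real K" using real_arch_simple by blast
      have "\<forall>\<^sub>F j in sequentially. indicator {- real j..real j} s *\<^sub>R f s = f s"
        unfolding eventually_sequentially by (rule exI[of _ K]) (use K in \<open>auto simp: indicator_def abs_le_iff\<close>)
      then show "(\<lambda>j. indicator {- real j..real j} s *\<^sub>R f s) \<longlonglongrightarrow> f s" by (rule tendsto_eventually)
    qed
    show "AE s in lborel. norm (indicator {- real j..real j} s *\<^sub>R f s) \<le> norm (f s)" for j
      by (auto simp: indicator_def)
  qed (use fI in auto)
  moreover have "(LINT s|lborel. indicator {- real j..real j} s *\<^sub>R f s) = integral {- real j..real j} f" for j
  proof -
    have "set_integrable lborel {- real j..real j} f"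
      using fI integrable_mult_indicator[of "{- real j..real j}" lborel f] by (simp add: set_integrable_def)
    from set_borel_integral_eq_integral(2)[OF this] show ?thesis by (simp add: set_lebesgue_integral_def)
  qed
  ultimately have "(\<lambda>j. I {- int j..<int j}) \<longlonglongrightarrow> (LINT s|lborel. f s)" by (simp add: Ij)
  then have "J = (LINT s|lborel. f s)" using lim1 LIMSEQ_unique by blast
  then show ?thesis using integral_unique[OF IJ(2)] LF by (simp add: e_def)
qed

lemma integral_cis: "integral {0..1} (\<lambda>t. cis (2 * pi * of_int k * t)) = (if k = 0 then 1 else 0)"
proof (cases "k = 0")
  case False
  let ?c = "2 * of_real pi * of_int k * \<i> :: complex"
  have c0: "?c \<noteq> 0" using False by simp
  have "((\<lambda>t. exp (?c * of_real t)) has_integral (exp (?c * of_real 1) / ?c - exp (?c * of_real 0) / ?c)) {0..1}"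
    by (rule fundamental_theorem_of_calculus)
      (auto intro!: derivative_eq_intros has_vector_derivative_real_field simp: c0 False)
  moreover have "exp (?c * of_real 1) = 1"
    using cis_multiple_2pi[of "of_int k"] by (simp add: cis_conv_exp mult_ac)
  moreover have "(\<lambda>t. exp (?c * of_real t)) = (\<lambda>t. cis (2 * pi * of_int k * t))"
    by (auto simp: fun_eq_iff cis_conv_exp mult_ac)
  ultimately show ?thesis using False by (simp add: integral_unique)
qed simp

text \<open>The support condition leaves finitely many coefficients, so no Fourier series has to
  converge: \<open>phiN\<close> minus the finite sum is continuous and periodic with all
  coefficients 0. The outermost terms \<open>k = N\<close> and \<open>k = - N\<close>
  vanish.\<close>

lemma poisson:
  assumes supp: "\<And>\<tau>. \<bar>\<tau>\<bar> \<ge> 1 \<Longrightarrow> fourier \<Phi> \<tau> = 0"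
  shows "phiN \<Phi> N t = (\<Sum>k\<in>{- int N..int N}. fourier \<Phi> (of_int k / real N) / of_nat N * cis (2 * pi * of_int k * t))"
proof -
  let ?c = "\<lambda>k::int. fourier \<Phi> (of_int k / real N) / of_nat N"
  define T where "T t = (\<Sum>k\<in>{- int N..int N}. ?c k * cis (2 * pi * of_int k * t))" for t
  define E where "E t = phiN \<Phi> N t - T t" for t
  have cc: "continuous_on S (\<lambda>t. cis (2 * pi * of_int k * t))" for S and k :: int
    unfolding cis_conv_exp by (intro continuous_intros)
  have contT: "continuous_on S T" for S unfolding T_def by (intro continuous_on_sum continuous_on_mult cc continuous_intros)
  have "E t = 0"
  proof (rule fourier_uniqueness)
    show "continuous_on UNIV E" unfolding E_def by (intro continuous_on_diff phiN_continuous contT)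
    have "T (s + 1) = T s" for s
    proof -
      have "cis (2 * pi * of_int k * (s + 1)) = cis (2 * pi * of_int k * s)" for k :: int
        using cis_multiple_2pi[of "of_int k"] by (simp add: distrib_left cis_mult[symmetric])
      then show ?thesis by (simp add: T_def)
    qed
    then show "E (s + 1) = E s" for s by (simp add: E_def phiN_periodic)
    fix l :: int
    have i1: "(\<lambda>t. phiN \<Phi> N t * cis (2 * pi * of_int l * t)) integrable_on {0..1}"
      "(\<lambda>t. T t * cis (2 * pi * of_int l * t)) integrable_on {0..1}"
      by (intro integrable_continuous_interval continuous_on_mult cc contT continuous_on_subset[OF phiN_continuous] subset_UNIV)+
    have "integral {0..1} (\<lambda>t. T t * cis (2 * pi * of_int l * t)) =
      integral {0..1} (\<lambda>t. \<Sum>k\<in>{- int N..int N}. ?c k * cis (2 * pi * of_int (k + l) * t))"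
    proof -
      have "cis (2 * pi * of_int (k + l) * t) = cis (2 * pi * of_int k * t) * cis (2 * pi * of_int l * t)" for k t
        by (simp add: cis_mult algebra_simps)
      then show ?thesis by (simp only: T_def sum_distrib_right mult.assoc)
    qed
    also have "\<dots> = (\<Sum>k\<in>{- int N..int N}. integral {0..1} (\<lambda>t. ?c k * cis (2 * pi * of_int (k + l) * t)))"
      by (rule integral_sum) (auto intro!: integrable_continuous_interval continuous_on_mult cc continuous_intros simp: N[THEN gr_implies_not0] simp del: of_int_add)
    also have "\<dots> = (\<Sum>k\<in>{- int N..int N}. if k = - l then ?c k else 0)"
      by (intro sum.cong refl) (simp only: integral_mult_right integral_cis, auto)
    also have "\<dots> = ?c (- l)"
    proof (cases "- l \<in> {- int N..int N}")
      case False
      have "\<bar>of_int (- l) / real N\<bar> \<ge> 1"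
      proof -
        have "\<bar>l\<bar> \<ge> int N" using False by auto
        then have "\<bar>of_int l\<bar> \<ge> real N" by linarith
        then show ?thesis using N by (simp add: field_simps)
      qed
      then have "?c (- l) = 0" by (simp only: supp) simp
      moreover have "(\<Sum>k\<in>{- int N..int N}. if k = - l then ?c k else 0) = 0" using False by (intro sum.neutral) auto
      ultimately show ?thesis by (simp only:)
    qed simp
    finally have "integral {0..1} (\<lambda>t. T t * cis (2 * pi * of_int l * t)) = ?c (- l)" .
    moreover have "integral {0..1} (\<lambda>t. phiN \<Phi> N t * cis (2 * pi * of_int l * t)) = ?c (- l)"
      using phiN_coeff[of "- l"] by simp
    ultimately show "integral {0..1} (\<lambda>t. E t * cis (2 * pi * of_int l * t)) = 0"
      unfolding E_def left_diff_distrib by (subst integral_diff[OF i1]) simp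
  qed
  then show ?thesis by (simp add: E_def T_def)
qed

end

section \<open>The explicit formula and the limit\<close>

lemma sum_int_symmetric:
  fixes F :: "int \<Rightarrow> complex"
  shows "(\<Sum>k\<in>{- int N..int N}. F k) = F 0 + (\<Sum>j\<in>{1..N}. F (int j) + F (- int j))"
proof (induction N)
  case (Suc N)
  have "{- int (Suc N)..int (Suc N)} = insert (int (Suc N)) (insert (- int (Suc N)) {- int N..int N})" by auto
  then have "(\<Sum>k\<in>{- int (Suc N)..int (Suc N)}. F k) = F (int (Suc N)) + (F (- int (Suc N)) + (\<Sum>k\<in>{- int N..int N}. F k))"
    by simp
  then show ?case using Suc by simp
qed simp

context ordAS
begin

text \<open>Power sums of the normalized inverse roots \<open>\<rho>_i\<close>, which have the same
  arguments as the inverse roots \<open>z\<close>.\<close>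

definition PS :: "int \<Rightarrow> complex" where
  "PS k = (\<Sum>z | poly RR z = 0. of_nat (order z RR) * cis (of_int k * Arg z))"

lemma PS_0: "PS 0 = of_nat kt"
  unfolding PS_def sum_order_RR[symmetric] by simp

text \<open>The Riemann hypothesis enters here: all roots have the same norm, so normalizing them
  divides the power sum of \<open>newton_power_sum\<close> by one common factor.\<close>

lemma PS_pos: assumes "j > 0" shows "PS (int j) = - char_sum p n \<psi> h g j / of_real (sqrt (real (p ^ n)) ^ j)"
proof -
  let ?s = "complex_of_real (sqrt (real (p ^ n)))"
  have s0: "?s \<noteq> 0" using p_gt_1 by simp
  have z: "cis (of_int (int j) * Arg z) = z ^ j / ?s ^ j" if "poly RR z = 0" for z
  proof -
    have "z = rcis (norm z) (Arg z)" by (rule rcis_cmod_Arg[symmetric])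
    then have "z = ?s * cis (Arg z)" using riemann[OF that] by (simp add: rcis_def)
    then have "z ^ j = ?s ^ j * cis (Arg z) ^ j" by (metis power_mult_distrib)
    also have "cis (Arg z) ^ j = cis (of_int (int j) * Arg z)" by (simp add: Complex.DeMoivre)
    finally show ?thesis using power_not_zero[OF s0, of j] by (simp only: nonzero_mult_div_cancel_left not_False_eq_True)
  qed
  have "PS (int j) = (\<Sum>z | poly RR z = 0. of_nat (order z RR) * z ^ j / ?s ^ j)"
    unfolding PS_def by (rule sum.cong[OF refl]) (simp only: mem_Collect_eq z times_divide_eq_right)
  also have "\<dots> = (\<Sum>z | poly RR z = 0. of_nat (order z RR) * z ^ j) / ?s ^ j" by (simp only: sum_divide_distrib)
  finally show ?thesis using newton_power_sum[OF assms] by (simp only: of_real_power)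
qed

lemma PS_neg: "PS (- k) = cnj (PS k)"
  unfolding PS_def by (simp add: cis_cnj)

lemma W1_formula:
  assumes C: "C \<ge> 0" "\<And>t. norm (\<Phi> t) \<le> C / (1 + t\<^sup>2)" "continuous_on UNIV \<Phi>"
    and supp: "\<And>\<tau>. \<bar>\<tau>\<bar> \<ge> 1 \<Longrightarrow> fourier \<Phi> \<tau> = 0"
  shows "W1 p n \<psi> \<Phi> h g = fourier \<Phi> 0 -
    (\<Sum>j\<in>{1..kt}. (fourier \<Phi> (of_int (int j) / real kt) / of_nat kt * char_sum p n \<psi> h g j +
        fourier \<Phi> (of_int (- int j) / real kt) / of_nat kt * cnj (char_sum p n \<psi> h g j)) / of_real (sqrt (real (p ^ n)) ^ j))"
proof -
  let ?c = "\<lambda>k::int. fourier \<Phi> (of_int k / real kt) / of_nat kt"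
  have N: "kt > 0" using d_ge by simp
  have "W1 p n \<psi> \<Phi> h g = (\<Sum>z | poly RR z = 0. of_nat (order z RR) * phiN \<Phi> kt (Arg z / (2 * pi)))"
    using L_poly_degree by (simp add: W1_def Let_def RR_def LL_def)
  also have "\<dots> = (\<Sum>z | poly RR z = 0. \<Sum>k\<in>{- int kt..int kt}. ?c k * (of_nat (order z RR) * cis (of_int k * Arg z)))"
  proof (rule sum.cong[OF refl])
    fix z
    have "phiN \<Phi> kt (Arg z / (2 * pi)) = (\<Sum>k\<in>{- int kt..int kt}. ?c k * cis (2 * pi * of_int k * (Arg z / (2 * pi))))"
      by (rule poisson[OF C N supp])
    also have "\<dots> = (\<Sum>k\<in>{- int kt..int kt}. ?c k * cis (of_int k * Arg z))" by simp
    finally show "of_nat (order z RR) * phiN \<Phi> kt (Arg z / (2 * pi)) =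
        (\<Sum>k\<in>{- int kt..int kt}. ?c k * (of_nat (order z RR) * cis (of_int k * Arg z)))"
      by (simp only: sum_distrib_left mult.left_commute)
  qed
  also have "\<dots> = (\<Sum>k\<in>{- int kt..int kt}. ?c k * PS k)"
    unfolding PS_def sum_distrib_left by (rule sum.swap)
  also have "\<dots> = ?c 0 * PS 0 + (\<Sum>j\<in>{1..kt}. ?c (int j) * PS (int j) + ?c (- int j) * PS (- int j))"
    by (rule sum_int_symmetric)
  also have "?c 0 * PS 0 = fourier \<Phi> 0" using N by (simp add: PS_0)
  also have "(\<Sum>j\<in>{1..kt}. ?c (int j) * PS (int j) + ?c (- int j) * PS (- int j)) =
      (\<Sum>j\<in>{1..kt}. - ((?c (int j) * char_sum p n \<psi> h g j + ?c (- int j) * cnj (char_sum p n \<psi> h g j)) / of_real (sqrt (real (p ^ n)) ^ j)))"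
  proof (rule sum.cong[OF refl])
    fix j assume "j \<in> {1..kt}"
    then have j: "j > 0" by simp
    have alg: "x * (- u / w) + y * (- v / w) = - ((x * u + y * v) / w)" for x y u v w :: complex
      by (simp add: add_divide_distrib)
    have "PS (- int j) = - cnj (char_sum p n \<psi> h g j) / of_real (sqrt (real (p ^ n)) ^ j)"
      unfolding PS_neg PS_pos[OF j] by simp
    then show "?c (int j) * PS (int j) + ?c (- int j) * PS (- int j) =
        - ((?c (int j) * char_sum p n \<psi> h g j + ?c (- int j) * cnj (char_sum p n \<psi> h g j)) / of_real (sqrt (real (p ^ n)) ^ j))"
      unfolding PS_pos[OF j] by (simp only: alg)
  qed
  finally show ?thesis by (simp only: sum_negf diff_conv_add_uminus)
qed

end

lemma fourier_bound: assumes "integrable lborel \<Phi>" shows "norm (fourier \<Phi> \<tau>) \<le> (LINT t|lborel. norm (\<Phi> t))"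
proof -
  have "norm (exp (- 2 * complex_of_real pi * \<i> * of_real \<tau> * of_real t)) = 1" for t by simp
  then have "norm (fourier \<Phi> \<tau>) \<le> (LINT t|lborel. norm (\<Phi> t * exp (- 2 * of_real pi * \<i> * of_real \<tau> * of_real t)))"
    unfolding fourier_def by (intro integral_norm_bound)
  also have "\<dots> = (LINT t|lborel. norm (\<Phi> t))" by (simp add: norm_mult)
  finally show ?thesis .
qed

lemma fourier_0: "fourier \<Phi> 0 = (LINT t|lborel. \<Phi> t)"
  by (simp add: fourier_def)

section \<open>Averaging over the family\<close>

context ordg
begin

definition avg :: "nat \<Rightarrow> real" where "avg j = norm (\<Sum>h\<in>HH. char_sum p n \<psi> h g j) / real (card HH)"

lemma average_W1:
  assumes C: "C \<ge> 0" "\<And>t. norm (\<Phi> t) \<le> C / (1 + t\<^sup>2)" "continuous_on UNIV \<Phi>"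
    and supp: "\<And>\<tau>. \<bar>\<tau>\<bar> \<ge> 1 - \<delta> \<Longrightarrow> fourier \<Phi> \<tau> = 0" and \<delta>: "\<delta> \<ge> 0"
    and B: "\<And>\<tau>. norm (fourier \<Phi> \<tau>) \<le> B"
  shows "norm ((\<Sum>h\<in>HH. W1 p n \<psi> \<Phi> h g) / of_nat (card HH) - fourier \<Phi> 0) \<le>
    2 * B / real (2 * d - 2) * (\<Sum>j\<in>{j\<in>{1..2 * d - 2}. real j < (1 - \<delta>) * real (2 * d - 2)}. avg j / sqrt (real (p ^ n)) ^ j)"
proof -
  let ?N = "2 * d - 2" and ?s = "sqrt (real (p ^ n))"
  let ?c = "\<lambda>k::int. fourier \<Phi> (of_int k / real ?N) / of_nat ?N"
  let ?S = "\<lambda>j. \<Sum>h\<in>HH. char_sum p n \<psi> h g j"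
  let ?T = "\<lambda>j. (?c (int j) * ?S j + ?c (- int j) * cnj (?S j)) / of_real (?s ^ j)"
  let ?J = "{j\<in>{1..?N}. real j < (1 - \<delta>) * real ?N}"
  have N: "?N > 0" using d_ge by simp
  have s0: "?s > 0" using p_gt_1 by simp
  have H0: "real (card HH) > 0" using card_HH_pos by simp
  have B0: "B \<ge> 0" using B[of 0] norm_ge_zero order_trans by blast
  have W: "W1 p n \<psi> \<Phi> h g = fourier \<Phi> 0 - (\<Sum>j\<in>{1..?N}. (?c (int j) * char_sum p n \<psi> h g j +
        ?c (- int j) * cnj (char_sum p n \<psi> h g j)) / of_real (?s ^ j))" if h: "h \<in> HH" for h
  proof -
    interpret AS: ordAS p K \<psi> n d g h
      by unfold_locales (use h in \<open>auto simp: HH_iff Z_iff\<close>)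
    show ?thesis by (rule AS.W1_formula[OF C]) (use supp \<delta> in auto)
  qed
  have "(\<Sum>h\<in>HH. W1 p n \<psi> \<Phi> h g) = of_nat (card HH) * fourier \<Phi> 0 - (\<Sum>h\<in>HH. \<Sum>j\<in>{1..?N}. (?c (int j) * char_sum p n \<psi> h g j +
        ?c (- int j) * cnj (char_sum p n \<psi> h g j)) / of_real (?s ^ j))"
    by (simp add: W sum_subtractf)
  also have "(\<Sum>h\<in>HH. \<Sum>j\<in>{1..?N}. (?c (int j) * char_sum p n \<psi> h g j +
        ?c (- int j) * cnj (char_sum p n \<psi> h g j)) / of_real (?s ^ j)) = (\<Sum>j\<in>{1..?N}. ?T j)"
    by (subst sum.swap) (simp add: sum_divide_distrib[symmetric] sum.distrib sum_distrib_left)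
  also have "(\<Sum>j\<in>{1..?N}. ?T j) = (\<Sum>j\<in>?J. ?T j)"
  proof (rule sum.mono_neutral_right)
    show "\<forall>j\<in>{1..?N} - ?J. ?T j = 0"
    proof
      fix j assume "j \<in> {1..?N} - ?J"
      then have "real j \<ge> (1 - \<delta>) * real ?N" by auto
      then have "real j / real ?N \<ge> 1 - \<delta>" using N by (simp add: pos_le_divide_eq)
      then have "?c (int j) = 0" "?c (- int j) = 0" using supp[of "real j / real ?N"] supp[of "- real j / real ?N"] by auto
      then show "?T j = 0" by (simp only: mult_zero_left) simp
    qed
  qed auto
  finally have eq: "(\<Sum>h\<in>HH. W1 p n \<psi> \<Phi> h g) / of_nat (card HH) - fourier \<Phi> 0 = - (\<Sum>j\<in>?J. ?T j) / of_nat (card HH)"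
    using H0 by (simp add: diff_divide_distrib)
  have "norm ((\<Sum>h\<in>HH. W1 p n \<psi> \<Phi> h g) / of_nat (card HH) - fourier \<Phi> 0) = norm (\<Sum>j\<in>?J. ?T j) / real (card HH)"
    unfolding eq by (simp add: norm_divide)
  also have "\<dots> \<le> (\<Sum>j\<in>?J. norm (?T j)) / real (card HH)" by (intro divide_right_mono norm_sum) simp
  also have "\<dots> = (\<Sum>j\<in>?J. norm (?T j) / real (card HH))" by (rule sum_divide_distrib)
  also have "\<dots> \<le> (\<Sum>j\<in>?J. 2 * B / real ?N * (avg j / ?s ^ j))"
  proof (rule sum_mono)
    fix j assume "j \<in> ?J"
    have cb: "norm (?c k) \<le> B / real ?N" for k using B by (simp only: norm_divide norm_of_nat) (intro divide_right_mono, auto)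
    have "norm (?c (int j) * ?S j + ?c (- int j) * cnj (?S j)) \<le> norm (?c (int j) * ?S j) + norm (?c (- int j) * cnj (?S j))"
      by (rule norm_triangle_ineq)
    also have "\<dots> \<le> B / real ?N * norm (?S j) + B / real ?N * norm (?S j)"
      unfolding norm_mult complex_mod_cnj by (intro add_mono mult_right_mono cb norm_ge_zero)
    finally have "norm (?c (int j) * ?S j + ?c (- int j) * cnj (?S j)) \<le> 2 * B / real ?N * norm (?S j)" by (simp add: field_simps)
    then have "norm (?c (int j) * ?S j + ?c (- int j) * cnj (?S j)) / ?s ^ j / real (card HH) \<le> 2 * B / real ?N * norm (?S j) / ?s ^ j / real (card HH)"
      using s0 by (intro divide_right_mono) auto
    moreover have "norm (?T j) = norm (?c (int j) * ?S j + ?c (- int j) * cnj (?S j)) / ?s ^ j"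
      using s0 by (simp only: norm_divide norm_of_real abs_of_pos zero_less_power)
    ultimately show "norm (?T j) / real (card HH) \<le> 2 * B / real ?N * (avg j / ?s ^ j)"
      by (simp add: avg_def mult_ac)
  qed
  also have "\<dots> = 2 * B / real ?N * (\<Sum>j\<in>?J. avg j / ?s ^ j)" by (rule sum_distrib_left[symmetric])
  finally show ?thesis .
qed

text \<open>From \<open>m = j / p \<le> j / 3\<close> comes \<open>q\<close> to the power
  \<open>- j / 6\<close> in the part with zero derivative. In the other part
  \<open>?D - j / 2 \<ge> \<delta> * ?D\<close> saves \<open>\<delta> * ?D / 3\<close>, of which
  half is spent on the orbits (\<open>om\<close>), while \<open>p\<close> is lost to rounding. Both
  exponents are at most 0 (by \<open>big\<close> for the second), so \<open>q\<close> may be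
  replaced by its lower bound 3.\<close>

lemma avg_term:
  assumes p2: "p > 2" and \<delta>: "0 < \<delta>" "\<delta> < 1" and j: "j > 0" "real j < (1 - \<delta>) * real (2 * d - 2)"
    and om: "4 ^ card Ob \<le> real (p ^ n) powr (\<delta> * real (degree g) / 6)"
    and big: "real p \<le> \<delta> * real (degree g) / 6"
  shows "avg j / sqrt (real (p ^ n)) ^ j \<le> (1 + real j) * 3 powr (- real j / 6) +
     2 * real (degree g) * 3 powr (real p - \<delta> * real (degree g) / 6)"
proof (cases "p dvd j")
  case False
  then have "avg j = 0" using avg_zero[OF j(1)] by (simp add: avg_def)
  then show ?thesis by simp
next
  case True
  let ?q = "real (p ^ n)" and ?D = "real (degree g)"
  obtain m where m: "j = p * m" using True by blast
  have m0: "m > 0" using m j by (cases m) auto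
  have q3: "?q \<ge> 3"
  proof -
    have "p ^ 1 \<le> p ^ n" using p2 n_pos by (intro power_increasing) auto
    then have "3 \<le> p ^ n" using p2 by simp
    then show ?thesis by (metis of_nat_le_iff of_nat_numeral)
  qed
  have DN: "real (2 * d - 2) \<le> 2 * ?D" using g_deg d_ge by auto
  have jD: "real j \<le> (1 - \<delta>) * (2 * ?D)"
    using j(2) mult_left_mono[OF DN, of "1 - \<delta>"] \<delta> by linarith
  have jD2: "real j \<le> 2 * ?D"
  proof -
    have "(1 - \<delta>) * (2 * ?D) \<le> 1 * (2 * ?D)" using \<delta> by (intro mult_right_mono) auto
    then show ?thesis using jD by linarith
  qed
  then have jle: "j \<le> 2 * degree g" by linarith
  have sq: "sqrt ?q ^ j = ?q powr (real j / 2)"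
  proof -
    have "sqrt ?q ^ j = (?q powr (1 / 2)) ^ j" using q3 by (simp only: powr_half_sqrt)
    also have "\<dots> = (?q powr (1 / 2)) powr real j" using p_gt_1 by (intro powr_realpow[symmetric]) simp
    finally show ?thesis by (simp only: powr_powr) simp
  qed
  have qpos: "?q > 0" using q3 by linarith
  let ?e = "real j / 2 - (?D - real j / 2) / 3 + real p"
  have "avg j \<le> 1 + real j * ?q ^ m + real j * 4 ^ card Ob * ?q powr ?e"
    unfolding avg_def using avg_bound[OF p2 m0 m jle] card_HH_pos by (simp add: pos_divide_le_eq mult.commute)
  then have "avg j / sqrt ?q ^ j \<le> (1 + real j * ?q ^ m + real j * 4 ^ card Ob * ?q powr ?e) / ?q powr (real j / 2)"
    unfolding sq by (intro divide_right_mono) auto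
  also have "\<dots> = (1 + real j * ?q ^ m) / ?q powr (real j / 2) + real j * (4 ^ card Ob * (?q powr ?e / ?q powr (real j / 2)))"
    by (simp add: add_divide_distrib mult.assoc)
  also have "\<dots> \<le> (1 + real j) * 3 powr (- real j / 6) + 2 * ?D * 3 powr (real p - \<delta> * ?D / 6)"
  proof (rule add_mono)
    have qm: "?q ^ m = ?q powr real m" using qpos by (rule powr_realpow[symmetric])
    have "1 + real j * ?q ^ m \<le> (1 + real j) * ?q ^ m" using q3 one_le_power[of ?q m] by (simp add: distrib_right)
    then have "(1 + real j * ?q ^ m) / ?q powr (real j / 2) \<le> (1 + real j) * ?q ^ m / ?q powr (real j / 2)"
      by (intro divide_right_mono) auto
    also have "\<dots> = (1 + real j) * ?q powr (real m - real j / 2)" unfolding qm powr_diff by simp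
    also have "\<dots> \<le> (1 + real j) * ?q powr (- real j / 6)"
    proof -
      have "3 * real m \<le> real j" unfolding m using p2 by (simp add: mult_right_mono)
      then have "real m - real j / 2 \<le> - real j / 6" by simp
      then show ?thesis using q3 by (intro mult_left_mono powr_mono) auto
    qed
    also have "\<dots> \<le> (1 + real j) * 3 powr (- real j / 6)"
      using q3 by (intro mult_left_mono powr_mono2') auto
    finally show "(1 + real j * ?q ^ m) / ?q powr (real j / 2) \<le> (1 + real j) * 3 powr (- real j / 6)" .
    have "4 ^ card Ob * (?q powr ?e / ?q powr (real j / 2)) \<le> ?q powr (\<delta> * ?D / 6) * (?q powr ?e / ?q powr (real j / 2))"
      by (intro mult_right_mono om) auto
    also have "\<dots> = ?q powr (\<delta> * ?D / 6 + (?e - real j / 2))" by (simp only: powr_add powr_diff)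
    also have "\<dots> \<le> ?q powr (real p - \<delta> * ?D / 6)"
    proof -
      have "?D - real j / 2 \<ge> \<delta> * ?D" using jD by (simp add: algebra_simps)
      then have "\<delta> * ?D / 6 + (?e - real j / 2) \<le> real p - \<delta> * ?D / 6" by (simp add: field_simps)
      then show ?thesis using q3 by (intro powr_mono) auto
    qed
    also have "\<dots> \<le> 3 powr (real p - \<delta> * ?D / 6)" using q3 big by (intro powr_mono2') auto
    finally have "4 ^ card Ob * (?q powr ?e / ?q powr (real j / 2)) \<le> 3 powr (real p - \<delta> * ?D / 6)" .
    then show "real j * (4 ^ card Ob * (?q powr ?e / ?q powr (real j / 2))) \<le> 2 * ?D * 3 powr (real p - \<delta> * ?D / 6)"
      using jD2 by (intro mult_mono) auto
  qed
  finally show ?thesis .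
qed

end

text \<open>Either \<open>q\<close> is so small that few orbits are short, or \<open>q\<close> is so large that \<open>\<omega> \<le> D\<close> suffices.\<close>

lemma orbit_count_asymptotic:
  assumes \<kappa>: "\<kappa> > (0::real)"
  obtains D1 where "\<And>D q \<omega>. D \<ge> D1 \<Longrightarrow> q \<ge> (3::real) \<Longrightarrow> \<omega> \<le> D \<Longrightarrow>
    (\<And>t::nat. t > 0 \<Longrightarrow> \<omega> \<le> q ^ (t + 1) + D / real t) \<Longrightarrow> \<omega> \<le> \<kappa> * D * ln q"
proof -
  \<comment> \<open>Makes \<open>D / t\<close> at most half of \<open>\<kappa> * D\<close>.\<close>
  define t where "t = nat \<lceil>2 / \<kappa>\<rceil>"
  have t2: "real t \<ge> 2 / \<kappa>" unfolding t_def by linarith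
  then have t0: "t > 0" using \<kappa> by (metis divide_pos_pos gr0I less_le_not_le of_nat_0 zero_less_numeral)
  \<comment> \<open>If \<open>q ^ (t + 1)\<close> exceeds the other half of
    \<open>\<kappa> * D\<close>, this choice forces \<open>q > exp (1 / \<kappa>)\<close>; then
    \<open>\<kappa> * ln q \<ge> 1\<close> and the trivial bound \<open>D\<close> is enough.\<close>
  define D1 where "D1 = max 0 (2 / \<kappa> * exp (real (t + 1) / \<kappa>))"
  have "\<omega> \<le> \<kappa> * D * ln q" if D: "D \<ge> D1" and q: "q \<ge> 3" and w: "\<omega> \<le> D" "\<And>t::nat. t > 0 \<Longrightarrow> \<omega> \<le> q ^ (t + 1) + D / real t"
    for D q \<omega> :: real
  proof -
    have D0: "D \<ge> 0" using D by (simp add: D1_def)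
    have lnq: "ln q \<ge> 1"
    proof -
      have "exp 1 \<le> q" using q exp_le by linarith
      then show ?thesis using q by (simp add: ln_ge_iff)
    qed
    have Dt: "D / real t \<le> \<kappa> * D / 2"
    proof -
      have "2 \<le> \<kappa> * real t" using t2 \<kappa> by (simp add: field_simps)
      then have "2 * D \<le> \<kappa> * real t * D" using D0 by (rule mult_right_mono)
      then show ?thesis using t0 by (simp add: field_simps)
    qed
    show ?thesis
    proof (cases "q ^ (t + 1) \<le> \<kappa> * D / 2")
      case True
      have "\<omega> \<le> \<kappa> * D" using w(2)[OF t0] True Dt by linarith
      also have "\<dots> \<le> \<kappa> * D * ln q" using lnq D0 \<kappa> mult_left_mono[of 1 "ln q" "\<kappa> * D"] by simp
      finally show ?thesis .
    next
      case False
      have "2 / \<kappa> * exp (real (t + 1) / \<kappa>) \<le> D" using D by (simp add: D1_def)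
      then have "exp (real (t + 1) / \<kappa>) \<le> \<kappa> * D / 2" using \<kappa> by (simp add: field_simps)
      then have "exp (real (t + 1) / \<kappa>) < q ^ (t + 1)" using False by linarith
      then have "ln (exp (real (t + 1) / \<kappa>)) < ln (q ^ (t + 1))" using q by (subst ln_less_cancel_iff) auto
      then have "real (t + 1) / \<kappa> < real (t + 1) * ln q" using q by (simp only: ln_exp ln_realpow)
      then have "real (t + 1) * (1 / \<kappa>) < real (t + 1) * ln q" by simp
      then have "1 / \<kappa> < ln q" by (rule mult_left_less_imp_less) simp
      then have "1 \<le> \<kappa> * ln q" using \<kappa> by (simp add: field_simps)
      then have "D * 1 \<le> D * (\<kappa> * ln q)" using D0 by (intro mult_left_mono)
      then show ?thesis using w(1) by (simp add: mult_ac)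
    qed
  qed
  then show ?thesis using that by blast
qed

text \<open>The support is compact inside the open interval, so the absolute value attains a maximum
  below 1 on it; half of the remaining distance serves as \<open>\<delta>\<close>.\<close>

lemma support_gap:
  assumes "closure {\<tau>::real. F \<tau> \<noteq> (0::complex)} \<subseteq> {\<tau>. \<bar>\<tau>\<bar> < 1}"
  obtains \<delta> where "0 < \<delta>" "\<delta> < 1" "\<And>\<tau>. \<bar>\<tau>\<bar> \<ge> 1 - \<delta> \<Longrightarrow> F \<tau> = 0"
proof -
  let ?S = "closure {\<tau>. F \<tau> \<noteq> 0}"
  have "?S \<subseteq> {-1..1}" using assms by (auto simp: abs_less_iff)
  then have comp: "compact ?S" using bounded_subset[OF bounded_closed_interval] by (simp add: compact_eq_bounded_closed)
  show ?thesis
  proof (cases "?S = {}")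
    case True
    then have "F \<tau> = 0" for \<tau> using closure_subset[of "{\<tau>. F \<tau> \<noteq> 0}"] by auto
    then show ?thesis using that[of "1 / 2"] by simp
  next
    case False
    have "continuous_on ?S (\<lambda>y. \<bar>y\<bar>)" by (intro continuous_intros)
    then have "\<exists>x\<in>?S. \<forall>y\<in>?S. \<bar>y\<bar> \<le> \<bar>x\<bar>" by (rule continuous_attains_sup[OF comp False])
    then obtain x where x: "x \<in> ?S" "\<forall>y\<in>?S. \<bar>y\<bar> \<le> \<bar>x\<bar>" by (elim bexE)
    have x1: "\<bar>x\<bar> < 1" using x(1) assms by blast
    have "F \<tau> = 0" if "\<bar>\<tau>\<bar> \<ge> 1 - (1 - \<bar>x\<bar>) / 2" for \<tau>
    proof (rule ccontr)
      assume "F \<tau> \<noteq> 0"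
      then have "\<tau> \<in> ?S" using closure_subset[of "{\<tau>. F \<tau> \<noteq> 0}"] by (auto simp only: subset_iff mem_Collect_eq)
      then have "\<bar>\<tau>\<bar> \<le> \<bar>x\<bar>" by (rule bspec[OF x(2)])
      then show False using that x1 by argo
    qed
    then show ?thesis using that[of "(1 - \<bar>x\<bar>) / 2"] x1 by auto
  qed
qed

lemma summable_weights: "summable (\<lambda>j::nat. (1 + real j) * 3 powr (- real j / 6))"
proof -
  define x :: real where "x = 3 powr (- 1 / 6)"
  have x: "0 < x" "x < 1" unfolding x_def using powr_less_mono[of "- 1 / 6" 0 "3::real"] by auto
  have "3 powr (- real j / 6) = x ^ j" for j
    by (simp add: x_def powr_powr flip: powr_realpow)
  moreover have "summable (\<lambda>j. of_nat (Suc j) * x ^ j)"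
    using geometric_deriv_sums[of x] x by (intro sums_summable) auto
  ultimately show ?thesis by simp
qed

theorem theorem3:
  fixes p :: nat and \<psi> :: "'k::field \<Rightarrow> complex" and \<Phi> :: "real \<Rightarrow> complex"
  assumes "prime p" and "p > 2"
    and "CHAR('k) = p" and "alg_closed_type TYPE('k)"
    and "nontriv_add_char p \<psi>"
    and "schwartz \<Phi>"
    and "closure {\<tau>. fourier \<Phi> \<tau> \<noteq> 0} \<subseteq> {\<tau>. \<bar>\<tau>\<bar> < 1}"
  shows "\<forall>\<epsilon>>0. \<exists>d0. \<forall>n\<ge>1. \<forall>d\<ge>d0. \<forall>g\<in>polys_over (Fpow p n).
           lead_coeff g = 1 \<and> sqfree_over (Fpow p n) g \<and> (degree g = d \<or> degree g = d - 1) \<longrightarrow>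
           cmod ((\<Sum>h\<in>AS_ord_g p n d g. W1 p n \<psi> \<Phi> h g) / of_nat (card (AS_ord_g p n d g))
                 - (LINT t|lborel. \<Phi> t)) < \<epsilon>"
proof (intro allI impI)
  fix \<epsilon> :: real assume \<epsilon>: "\<epsilon> > 0"
  obtain C where C: "C \<ge> 0" "\<And>t. norm (\<Phi> t) \<le> C / (1 + t\<^sup>2)" "continuous_on UNIV \<Phi>"
    using schwartz_bound[OF assms(6)] by blast
  obtain \<delta> where \<delta>: "0 < \<delta>" "\<delta> < 1" "\<And>\<tau>. \<bar>\<tau>\<bar> \<ge> 1 - \<delta> \<Longrightarrow> fourier \<Phi> \<tau> = 0"
    using support_gap[OF assms(7)] by blast
  define B where "B = (LINT t|lborel. norm (\<Phi> t))"
  have B: "norm (fourier \<Phi> \<tau>) \<le> B" for \<tau>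
    unfolding B_def by (rule fourier_bound[OF Phi_integrable[OF C, of 1]]) simp
  have B0: "B \<ge> 0" using B[of 0] norm_ge_zero order_trans by blast
  define C1 where "C1 = (\<Sum>j. (1 + real j) * 3 powr (- real j / 6))"
  \<comment> \<open>Chosen so that the bound for \<open>card Ob\<close> becomes
    \<open>4 ^ card Ob \<le> q powr (\<delta> * D / 6)\<close>, the hypothesis \<open>om\<close> of
    \<open>avg_term\<close>.\<close>
  define \<kappa> where "\<kappa> = \<delta> / (6 * ln 4)"
  have \<kappa>0: "\<kappa> > 0" using \<delta> by (simp add: \<kappa>_def)
  obtain D1 where D1: "\<And>D q \<omega>. D \<ge> D1 \<Longrightarrow> q \<ge> (3::real) \<Longrightarrow> \<omega> \<le> D \<Longrightarrow>
    (\<And>t::nat. t > 0 \<Longrightarrow> \<omega> \<le> q ^ (t + 1) + D / real t) \<Longrightarrow> \<omega> \<le> \<kappa> * D * ln q"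
    using orbit_count_asymptotic[OF \<kappa>0] by blast
  have "((\<lambda>x. 2 * B * (2 * x * 3 powr (real p - \<delta> * x / 6))) \<longlongrightarrow> 0) at_top"
    using \<delta>(1) by real_asymp
  then have "eventually (\<lambda>x. 2 * B * (2 * x * 3 powr (real p - \<delta> * x / 6)) < \<epsilon> / 2) at_top"
    using \<epsilon> by (intro order_tendstoD(2)) auto
  then obtain D2 where D2: "\<And>x. x \<ge> D2 \<Longrightarrow> 2 * B * (2 * x * 3 powr (real p - \<delta> * x / 6)) < \<epsilon> / 2"
    unfolding eventually_at_top_linorder by blast
  have "((\<lambda>x. 2 * B * C1 / x) \<longlongrightarrow> 0) at_top" by real_asymp
  then have "eventually (\<lambda>x. 2 * B * C1 / x < \<epsilon> / 2) at_top"
    using \<epsilon> by (intro order_tendstoD(2)) auto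
  then obtain D3 where D3: "\<And>x. x \<ge> D3 \<Longrightarrow> 2 * B * C1 / x < \<epsilon> / 2"
    unfolding eventually_at_top_linorder by blast
  \<comment> \<open>The thresholds must hold for \<open>d - 1\<close> since that may be the degree
    of \<open>g\<close>, hence \<open>Suc\<close>. The entry \<open>6 * real p / \<delta>\<close>
    provides the hypothesis \<open>big\<close> of \<open>avg_term\<close>.\<close>
  define d0 where "d0 = Suc (nat \<lceil>Max {2, D1, D2, D3, 6 * real p / \<delta>}\<rceil>)"
  have d0: "real d - 1 \<ge> D1" "real d - 1 \<ge> D2" "real d - 1 \<ge> D3" "real d - 1 \<ge> 6 * real p / \<delta>" "d \<ge> 2" if "d \<ge> d0" for d
  proof -
    have "real d - 1 \<ge> Max {2, D1, D2, D3, 6 * real p / \<delta>}" using that unfolding d0_def by linarith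
    then have "\<forall>x\<in>{2, D1, D2, D3, 6 * real p / \<delta>}. x \<le> real d - 1" by (subst (asm) Max_le_iff) auto
    then show "real d - 1 \<ge> D1" "real d - 1 \<ge> D2" "real d - 1 \<ge> D3" "real d - 1 \<ge> 6 * real p / \<delta>" "d \<ge> 2" by auto
  qed
  show "\<exists>d0. \<forall>n\<ge>1. \<forall>d\<ge>d0. \<forall>g\<in>polys_over (Fpow p n).
           lead_coeff g = 1 \<and> sqfree_over (Fpow p n) g \<and> (degree g = d \<or> degree g = d - 1) \<longrightarrow>
           cmod ((\<Sum>h\<in>AS_ord_g p n d g. W1 p n \<psi> \<Phi> h g) / of_nat (card (AS_ord_g p n d g))
                 - (LINT t|lborel. \<Phi> t)) < \<epsilon>"
  proof (intro exI[of _ d0] allI impI ballI)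
    fix n d :: nat and g :: "'k poly"
    assume n: "1 \<le> n" and d: "d0 \<le> d" and g: "g \<in> polys_over (Fpow p n)"
      and gg: "lead_coeff g = 1 \<and> sqfree_over (Fpow p n) g \<and> (degree g = d \<or> degree g = d - 1)"
    note dd = d0[OF d]
    interpret F: ffield p "TYPE('k)" by unfold_locales (use assms in auto)
    have g0: "g \<noteq> 0" using gg by auto
    interpret ordg p "TYPE('k)" \<psi> n d g
    proof unfold_locales
      show "poly (pderiv g) z \<noteq> 0" if "poly g z = 0" for z
        using F.simple_of_sqfree[OF g _ g0 _ that] n gg by auto
    qed (use assms n dd g gg in auto)
    let ?D = "real (degree g)" and ?q = "real (p ^ n)" and ?N = "2 * d - 2"
    have D: "?D \<ge> real d - 1" using gg dd(5) by auto
    have N0: "real ?N > 0" using dd(5) by auto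
    have q3: "?q \<ge> 3"
    proof -
      have "p ^ 1 \<le> p ^ n" using assms(2) n by (intro power_increasing) auto
      then have "3 \<le> p ^ n" using assms(2) by simp
      then show ?thesis by (metis of_nat_le_iff of_nat_numeral)
    qed
    have "real (card Ob) \<le> \<kappa> * ?D * ln ?q"
      by (rule D1) (use dd D q3 card_Ob_le_degree card_Ob_le in auto)
    then have "real (card Ob) * ln 4 \<le> \<kappa> * ?D * ln ?q * ln 4" by (intro mult_right_mono) auto
    also have "\<dots> = \<delta> * ?D / 6 * ln ?q" by (simp add: \<kappa>_def)
    finally have "exp (real (card Ob) * ln 4) \<le> exp (\<delta> * ?D / 6 * ln ?q)" by simp
    moreover have "exp (real (card Ob) * ln 4) = 4 ^ card Ob" by (simp add: exp_of_nat_mult)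
    moreover have "exp (\<delta> * ?D / 6 * ln ?q) = ?q powr (\<delta> * ?D / 6)" using q3 assms(2) by (simp add: powr_def)
    ultimately have om: "4 ^ card Ob \<le> ?q powr (\<delta> * ?D / 6)" by (simp only:)
    have "\<delta> * (6 * real p / \<delta>) \<le> \<delta> * ?D" using dd(4) D \<delta>(1) by (intro mult_left_mono) auto
    then have big: "real p \<le> \<delta> * ?D / 6" using \<delta>(1) by simp
    let ?J = "{j\<in>{1..?N}. real j < (1 - \<delta>) * real ?N}"
    let ?w = "\<lambda>j. (1 + real j) * 3 powr (- real j / 6)" and ?v = "2 * ?D * 3 powr (real p - \<delta> * ?D / 6)"
    have "cmod ((\<Sum>h\<in>AS_ord_g p n d g. W1 p n \<psi> \<Phi> h g) / of_nat (card (AS_ord_g p n d g)) - fourier \<Phi> 0)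
        \<le> 2 * B / real ?N * (\<Sum>j\<in>?J. avg j / sqrt ?q ^ j)"
      by (rule average_W1[OF C \<delta>(3) _ B]) (use \<delta> in auto)
    also have "\<dots> \<le> 2 * B / real ?N * (\<Sum>j\<in>?J. ?w j + ?v)"
      by (intro mult_left_mono sum_mono avg_term[OF assms(2) \<delta>(1,2) _ _ om big]) (use B0 in auto)
    \<comment> \<open>The weights \<open>?w j\<close> are summable, so dividing by \<open>N\<close>
      makes their part small; \<open>?v\<close> decays exponentially in the degree, and the number
      of terms, at most \<open>N\<close>, cancels against the division.\<close>
    also have "\<dots> \<le> 2 * B / real ?N * (C1 + real ?N * ?v)"
    proof (rule mult_left_mono)
      have "(\<Sum>j\<in>?J. ?w j) \<le> C1" unfolding C1_def by (rule sum_le_suminf[OF summable_weights]) auto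
      moreover have "real (card ?J) * ?v \<le> real ?N * ?v"
      proof (rule mult_right_mono)
        have "card ?J \<le> card {1..?N}" by (rule card_mono) auto
        then show "real (card ?J) \<le> real ?N" by simp
      qed simp
      ultimately show "(\<Sum>j\<in>?J. ?w j + ?v) \<le> C1 + real ?N * ?v" by (simp add: sum.distrib)
    qed (use B0 in auto)
    also have "\<dots> = 2 * B * C1 / real ?N + 2 * B * ?v" using N0 by (simp add: field_simps)
    also have "\<dots> < \<epsilon> / 2 + \<epsilon> / 2"
    proof (rule add_strict_mono)
      show "2 * B * C1 / real ?N < \<epsilon> / 2" by (rule D3) (use dd in auto)
      show "2 * B * ?v < \<epsilon> / 2" by (rule D2) (use dd D in auto)
    qed
    finally show "cmod ((\<Sum>h\<in>AS_ord_g p n d g. W1 p n \<psi> \<Phi> h g) / of_nat (card (AS_ord_g p n d g))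
                 - (LINT t|lborel. \<Phi> t)) < \<epsilon>" by (simp add: fourier_0)
  qed
qed

end
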